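(* Let $r,s,t>0$. For every $\epsilon>0$ there exists $\delta>0$ such that if $(f_0,g_0,h_0)\in Y$ satisfies $$\inf_{\mathbf{\Phi}\in\mathcal{O}_{r,s,t}}\|(f_0,g_0,h_0)-\mathbf{\Phi}\|_Y<\delta,$$ then the solution $\mathbf{u}(x,\tau)=(u_1,u_2,u_3)(x,\tau)$ of $$i\partial_\tau u_j+\partial_{xx}u_j+\Big(\sum_{k=1}^{3}a_{kj}|u_k|^p\Big)|u_j|^{p-2}u_j=0,\qquad j=1,2,3,\quad (x,\tau)\in\mathbb{R}^2,$$ with $\mathbf{u}(x,0)=(f_0(x),g_0(x),h_0(x))$ satisfies $$\sup_{\tau\in\mathbb{R}}\ \inf_{\mathbf{\Phi}\in\mathcal{O}_{r,s,t}}\|\mathbf{u}(\cdot,\tau)-\mathbf{\Phi}\|_Y<\epsilon.$$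
   Context: Standing assumptions: $p\in[2,3)$, and $a_{kj}$ ($k,j\in\{1,2,3\}$) are positive real constants with $a_{kj}=a_{jk}$. Notation: $H^1=H^1(\mathbb{R})$ is the Sobolev space of complex-valued functions on $\mathbb{R}$ with norm $\|f\|_1=\big(\int_{\mathbb{R}}(|f|^2+|f'|^2)\,dx\big)^{1/2}$; $\|f\|$ denotes the $L^2(\mathbb{R})$ norm. $Y=H^1\times H^1\times H^1$ with $\|(f_1,f_2,f_3)\|_Y^2=\sum_{j=1}^3\|f_j\|_1^2$. For $\mathbf{f}=(f_1,f_2,f_3)\in Y$ set $$\mathcal{H}(\mathbf{f})=\int_{-\infty}^{\infty}\Big(\sum_{j=1}^{3}|f_j'|^2-\frac1p\sum_{k,j=1}^{3}a_{kj}|f_k|^p|f_j|^p\Big)dx,\qquad \mathcal{Q}(f_j)=\int_{-\infty}^{\infty}|f_j|^2\,dx.$$ For $r,s,t>0$ set $\Delta_{r,s,t}=\{\mathbf{f}\in Y:\|f_1\|^2=r,\ \|f_2\|^2=s,\ \|f_3\|^2=t\}$, $\lambda(r,s,t)=\inf\{\mathcal{H}(\mathbf{f}):\mathbf{f}\in\Delta_{r,s,t}\}$, and $\mathcal{O}_{r,s,t}=\{\mathbf{\Phi}\in\Delta_{r,s,t}:\mathcal{H}(\mathbf{\Phi})=\lambda(r,s,t)\}$. Well-posedness convention (a known result the paper relies on): for every initial datum in $Y$ the initial-value problem for the Schr\"odinger system above has a unique solution $\mathbf{u}\in\mathcal{C}(\mathbb{R};Y)$ emanating from it, and this solution satisfies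 $\mathcal{H}(\mathbf{u}(\cdot,\tau))=\mathcal{H}(\mathbf{u}(\cdot,0))$ and $\mathcal{Q}(u_j(\cdot,\tau))=\mathcal{Q}(u_j(\cdot,0))$ for $j=1,2,3$ and all $\tau\in\mathbb{R}$. "The solution" in the claim means this one. The time variable is written $\tau$, since $t$ denotes a mass. *)

theory Defs
  imports "HOL-Analysis.Analysis"
begin

text \<open>
  Elements of \<open>L\<^sup>2(\<real>)\<close>, of \<open>H\<^sup>1(\<real>)\<close> and of \<open>Y\<close> are represented by Borel functions; two
  representatives of the same element agree almost everywhere. All quantities below
  depend only on the almost-everywhere class.
\<close>

definition L2 :: "(real \<Rightarrow> complex) set" where
  "L2 = {f \<in> borel_measurable lborel. integrable lborel (\<lambda>x. (cmod (f x))\<^sup>2)}"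

definition norm_L2 :: "(real \<Rightarrow> complex) \<Rightarrow> real" where
  "norm_L2 f = sqrt (LINT x|lborel. (cmod (f x))\<^sup>2)"

text \<open>Real-valued test functions suffice, since distributions extend complex-linearly.\<close>

definition test_function :: "(real \<Rightarrow> real) \<Rightarrow> bool" where
  "test_function \<phi> \<longleftrightarrow>
     (\<forall>n x. (deriv ^^ n) \<phi> differentiable (at x)) \<and> compact (closure {x. \<phi> x \<noteq> 0})"

definition has_weak_derivative :: "(real \<Rightarrow> complex) \<Rightarrow> (real \<Rightarrow> complex) \<Rightarrow> bool" where
  "has_weak_derivative f g \<longleftrightarrow>
     (\<forall>\<phi>. test_function \<phi> \<longrightarrow>
        (LINT x|lborel. deriv \<phi> x *\<^sub>R f x) = - (LINT x|lborel. \<phi> x *\<^sub>R g x))"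

definition H1 :: "(real \<Rightarrow> complex) set" where
  "H1 = {f \<in> L2. \<exists>g \<in> L2. has_weak_derivative f g}"

text \<open>The weak derivative is unique up to a null set, so the choice is immaterial.\<close>

definition weak_deriv :: "(real \<Rightarrow> complex) \<Rightarrow> real \<Rightarrow> complex" where
  "weak_deriv f = (SOME g. g \<in> L2 \<and> has_weak_derivative f g)"

definition norm_H1 :: "(real \<Rightarrow> complex) \<Rightarrow> real" where
  "norm_H1 f = sqrt (LINT x|lborel. (cmod (f x))\<^sup>2 + (cmod (weak_deriv f x))\<^sup>2)"

type_synonym triple = "3 \<Rightarrow> real \<Rightarrow> complex"

definition Y :: "triple set" where
  "Y = {f. \<forall>j. f j \<in> H1}"

definition norm_Y :: "triple \<Rightarrow> real" where
  "norm_Y f = sqrt (\<Sum>j\<in>UNIV. (norm_H1 (f j))\<^sup>2)"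

definition eq_Y :: "triple \<Rightarrow> triple \<Rightarrow> bool" where
  "eq_Y f g \<longleftrightarrow> (\<forall>j. AE x in lborel. f j x = g j x)"

definition energy :: "real \<Rightarrow> (3 \<Rightarrow> 3 \<Rightarrow> real) \<Rightarrow> triple \<Rightarrow> real" where
  "energy p a f =
     (LINT x|lborel. (\<Sum>j\<in>UNIV. (cmod (weak_deriv (f j) x))\<^sup>2)
        - 1 / p * (\<Sum>k\<in>UNIV. \<Sum>j\<in>UNIV. a k j * cmod (f k x) powr p * cmod (f j x) powr p))"

definition mass :: "(real \<Rightarrow> complex) \<Rightarrow> real" where
  "mass f = (LINT x|lborel. (cmod (f x))\<^sup>2)"

definition constraint_set :: "real \<Rightarrow> real \<Rightarrow> real \<Rightarrow> triple set" where
  "constraint_set r s t =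
     {f \<in> Y. (norm_L2 (f 1))\<^sup>2 = r \<and> (norm_L2 (f 2))\<^sup>2 = s \<and> (norm_L2 (f 3))\<^sup>2 = t}"

definition min_energy ::
    "real \<Rightarrow> (3 \<Rightarrow> 3 \<Rightarrow> real) \<Rightarrow> real \<Rightarrow> real \<Rightarrow> real \<Rightarrow> ereal" where
  "min_energy p a r s t = (INF f \<in> constraint_set r s t. ereal (energy p a f))"

definition minimizers ::
    "real \<Rightarrow> (3 \<Rightarrow> 3 \<Rightarrow> real) \<Rightarrow> real \<Rightarrow> real \<Rightarrow> real \<Rightarrow> triple set" where
  "minimizers p a r s t =
     {\<Phi> \<in> constraint_set r s t. ereal (energy p a \<Phi>) = min_energy p a r s t}"

text \<open>
  The infimum is taken in the extended reals, so that it is \<open>\<infinity>\<close> for an empty set.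
\<close>

definition dist_Y_set :: "triple \<Rightarrow> triple set \<Rightarrow> ereal" where
  "dist_Y_set f S = (INF \<Phi> \<in> S. ereal (norm_Y (f - \<Phi>)))"

text \<open>
  Isabelle's \<open>0 powr 0 = 0\<close> does no harm when \<open>p = 2\<close>: the last factor vanishes
  wherever \<open>u\<^sub>j\<close> does.
\<close>

definition nonlinearity :: "real \<Rightarrow> (3 \<Rightarrow> 3 \<Rightarrow> real) \<Rightarrow> triple \<Rightarrow> triple" where
  "nonlinearity p a u j x =
     ((\<Sum>k\<in>UNIV. a k j * cmod (u k x) powr p) * cmod (u j x) powr (p - 2)) *\<^sub>R u j x"

definition continuous_in_Y :: "(real \<Rightarrow> triple) \<Rightarrow> bool" where
  "continuous_in_Y u \<longleftrightarrow>
     (\<forall>\<tau>. u \<tau> \<in> Y) \<and> (\<forall>\<tau>\<^sub>0. ((\<lambda>\<tau>. norm_Y (u \<tau> - u \<tau>\<^sub>0)) \<longlongrightarrow> 0) (at \<tau>\<^sub>0))"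

text \<open>
  Solutions in \<open>C(\<real>; Y)\<close>. The equation
  \<open>\<i> \<partial>\<^sub>\<tau> u\<^sub>j + \<partial>\<^sub>x\<^sub>x u\<^sub>j + (\<Sum>\<^sub>k a\<^sub>k\<^sub>j |u\<^sub>k|\<^sup>p) |u\<^sub>j|\<^sup>p\<^sup>-\<^sup>2 u\<^sub>j = 0\<close> is required at every time \<open>\<tau>\<close> in
  the sense of distributions in \<open>x\<close>, with \<open>D\<close> the pairing of \<open>\<partial>\<^sub>\<tau> u\<^sub>j\<close> with \<open>\<phi>\<close>. For curves in
  \<open>C(\<real>; Y)\<close> this is the same as the equation in \<open>C(\<real>; H\<^sup>-\<^sup>1)\<close> and as the equation in the sense
  of distributions on \<open>\<real>\<^sup>2\<close>.
\<close>

definition nls_solution :: "real \<Rightarrow> (3 \<Rightarrow> 3 \<Rightarrow> real) \<Rightarrow> (real \<Rightarrow> triple) \<Rightarrow> bool" where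
  "nls_solution p a u \<longleftrightarrow> continuous_in_Y u \<and>
     (\<forall>j \<phi> \<tau>. test_function \<phi> \<longrightarrow>
        (\<exists>D. ((\<lambda>\<sigma>. LINT x|lborel. \<phi> x *\<^sub>R u \<sigma> j x) has_vector_derivative D) (at \<tau>) \<and>
             \<i> * D + (LINT x|lborel. deriv (deriv \<phi>) x *\<^sub>R u \<tau> j x)
               + (LINT x|lborel. \<phi> x *\<^sub>R nonlinearity p a (u \<tau>) j x) = 0))"

text \<open>Uniqueness is uniqueness as a curve in \<open>Y\<close>, i.e. up to null sets at each time.\<close>

definition well_posed :: "real \<Rightarrow> (3 \<Rightarrow> 3 \<Rightarrow> real) \<Rightarrow> bool" where
  "well_posed p a \<longleftrightarrow>
     (\<forall>u\<^sub>0\<in>Y. \<exists>u. nls_solution p a u \<and> eq_Y (u 0) u\<^sub>0 \<and>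
        (\<forall>v. nls_solution p a v \<and> eq_Y (v 0) u\<^sub>0 \<longrightarrow> (\<forall>\<tau>. eq_Y (v \<tau>) (u \<tau>))) \<and>
        (\<forall>\<tau>. energy p a (u \<tau>) = energy p a (u 0)) \<and>
        (\<forall>\<tau> j. mass (u \<tau> j) = mass (u 0 j)))"

end

theory Submission
  imports Defs "HOL-Complex_Analysis.Great_Picard"
begin

text \<open>
  Stability follows from compactness of minimizing sequences and the conservation laws: along a solution
  starting near a minimizer the energy and the masses stay close to their minimizing values, so it
  suffices that every triple with almost the right masses and almost minimal energy is close to a minimizer.

  Compactness uses no rearrangement. For \<open>p \<ge> 2\<close> the pointwise combination \<open>\<surd>(A\<^sup>2 + B\<^sup>2)\<close> of two real triples
  adds masses, does not increase the total kinetic energy, and gains the cross terms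
  \<open>a\<^sub>k\<^sub>j \<integral> A\<^sub>k\<^sup>p B\<^sub>j\<^sup>p\<close> in the potential energy. Hence an almost minimizer cannot carry mass far away
  from a point where it is not small: the remote part could be translated onto the main part, or, if
  it is flat, be replaced by a wide profile of negative energy. Tightness yields convergence in \<open>L\<^sup>2\<close> after a
  translation, and the parallelogram identity applied to midpoints upgrades it to convergence in \<open>Y\<close>.

  The arguments are carried out for real functions \<open>f \<ge> 0\<close> with an \<open>L\<^sup>2\<close> upper gradient \<open>h\<close>, that is,
  \<open>\<bar>f y - f x\<bar> \<le> \<integral> h\<close> over \<open>(x, y]\<close>; such an \<open>f\<close> lies in \<open>H\<^sup>1\<close> with \<open>\<bar>f'\<bar> \<le> h\<close> by the Radon-Nikodym theorem.
\<close>

section \<open>Upper gradients\<close>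

text \<open>The condition p < 3 works in two places: at fixed mass the potential part grows at most
  like the power (p-1)/2 < 1 of the kinetic part, so energy bounds control derivatives; and widely
  spread profiles get negative energy. The condition p \<ge> 2 gives x^p + y^p \<le> (x^2 +
  y^2)^(p/2), on which merging rests.

  Upper gradients replace weak derivatives because moduli, roots of sums of squares and products
  with cutoffs preserve them by plain inequalities, without differentiating at zeros. The price is
  paid once, by showing that such pairs cannot undercut the infimum over \<open>Y\<close>. Tightness
  sees only moduli; phases return in the midpoint argument, which works with the complex triples.

  If there are no minimizers, the distance to the empty set is infinite and the hypothesis on the
  datum fails; otherwise one minimizer supplies a finite value \<open>L\<close>. A datum near a
  minimizer has only approximately the right masses, so stability is proved for exact masses first
  and then transferred by rescaling each component.\<close>

lemma square_integrable_mult: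
  fixes f g :: "'a \<Rightarrow> real"
  assumes [measurable]: "f \<in> borel_measurable M" "g \<in> borel_measurable M"
    and "integrable M (\<lambda>x. (f x)\<^sup>2)" "integrable M (\<lambda>x. (g x)\<^sup>2)"
  shows "integrable M (\<lambda>x. f x * g x)"
proof (rule Bochner_Integration.integrable_bound)
  show "integrable M (\<lambda>x. (f x)\<^sup>2 + (g x)\<^sup>2)" using assms by simp
  have "norm (f x * g x) \<le> norm ((f x)\<^sup>2 + (g x)\<^sup>2)" for x
  proof -
    have "2 * \<bar>f x\<bar> * \<bar>g x\<bar> \<le> (f x)\<^sup>2 + (g x)\<^sup>2"
      using sum_squares_bound[of "\<bar>f x\<bar>" "\<bar>g x\<bar>"] by simp
    moreover have "0 \<le> \<bar>f x\<bar> * \<bar>g x\<bar>" by simp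
    ultimately show ?thesis by (simp add: abs_mult del: zero_le_mult_iff mult_nonneg_nonneg)
  qed
  then show "AE x in M. norm (f x * g x) \<le> norm ((f x)\<^sup>2 + (g x)\<^sup>2)" by simp
qed simp

lemma Cauchy_Schwarz_integral:
  fixes f g :: "'a \<Rightarrow> real"
  assumes [measurable]: "f \<in> borel_measurable M" "g \<in> borel_measurable M"
    and f: "integrable M (\<lambda>x. (f x)\<^sup>2)" and g: "integrable M (\<lambda>x. (g x)\<^sup>2)"
  shows "(LINT x|M. f x * g x)\<^sup>2 \<le> (LINT x|M. (f x)\<^sup>2) * (LINT x|M. (g x)\<^sup>2)"
proof -
  define A B C where "A = (LINT x|M. (f x)\<^sup>2)" and "B = (LINT x|M. f x * g x)"
    and "C = (LINT x|M. (g x)\<^sup>2)"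
  have fg: "integrable M (\<lambda>x. f x * g x)" using square_integrable_mult assms by blast
  \<comment> \<open>Nonnegativity of a quadratic form in (s, t). The pairs (C, -B) and (-B, A) give
    the claim multiplied by C or by A; if both vanish, (1, 1) and (1, -1) force B = 0.\<close>
  have key: "0 \<le> s\<^sup>2 * A + 2 * s * t * B + t\<^sup>2 * C" for s t
  proof -
    have "0 \<le> (LINT x|M. (s * f x + t * g x)\<^sup>2)" by simp
    also have "\<dots> = (LINT x|M. s\<^sup>2 * (f x)\<^sup>2 + 2 * s * t * (f x * g x) + t\<^sup>2 * (g x)\<^sup>2)"
      by (intro Bochner_Integration.integral_cong) (auto simp: power2_eq_square algebra_simps)
    also have "\<dots> = s\<^sup>2 * A + 2 * s * t * B + t\<^sup>2 * C"
      using f g fg by (simp add: A_def B_def C_def)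
    finally show ?thesis .
  qed
  have AC: "0 \<le> A" "0 \<le> C" by (auto simp: A_def C_def)
  have "B\<^sup>2 \<le> A * C"
  proof (cases "C = 0")
    case False
    have "0 \<le> C * (A * C - B\<^sup>2)"
      using key[of C "-B"] by (simp add: power2_eq_square algebra_simps)
    then show ?thesis using False AC by (simp add: zero_le_mult_iff)
  next
    case C: True
    show ?thesis
    proof (cases "A = 0")
      case False
      have "0 \<le> A * (A * C - B\<^sup>2)"
        using key[of "-B" A] by (simp add: power2_eq_square algebra_simps)
      then show ?thesis using False AC by (simp add: zero_le_mult_iff)
    next
      case True
      then show ?thesis using C key[of 1 1] key[of 1 "-1"] by simp
    qed
  qed
  then show ?thesis by (simp add: A_def B_def C_def)
qed

section \<open>Square-integrable real functions and integrals over half-open intervals\<close>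

definition sq_integrable :: "(real \<Rightarrow> real) \<Rightarrow> bool" where
  "sq_integrable h \<longleftrightarrow> h \<in> borel_measurable borel \<and> integrable lborel (\<lambda>x. (h x)\<^sup>2)"

lemma sq_integrable_measurable [measurable_dest]:
  "sq_integrable h \<Longrightarrow> h \<in> borel_measurable borel"
  by (simp add: sq_integrable_def)

lemma sq_integrable_bound:
  assumes "sq_integrable h" and [measurable]: "f \<in> borel_measurable borel"
    and "\<And>x. \<bar>f x\<bar> \<le> C * \<bar>h x\<bar>"
  shows "sq_integrable f"
proof -
  have "integrable lborel (\<lambda>x. (f x)\<^sup>2)"
  proof (rule Bochner_Integration.integrable_bound)
    show "integrable lborel (\<lambda>x. C\<^sup>2 * (h x)\<^sup>2)" using assms by (simp add: sq_integrable_def)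
    have "(f x)\<^sup>2 \<le> C\<^sup>2 * (h x)\<^sup>2" for x
      using power_mono[OF assms(3)[of x], of 2] by (simp add: power_mult_distrib)
    then show "AE x in lborel. norm ((f x)\<^sup>2) \<le> norm (C\<^sup>2 * (h x)\<^sup>2)" by simp
  qed simp
  then show ?thesis by (simp add: sq_integrable_def)
qed

lemma sq_integrable_hypot:
  assumes "sq_integrable f" "sq_integrable g"
  shows "sq_integrable (\<lambda>x. sqrt ((f x)\<^sup>2 + (g x)\<^sup>2))"
  using assms by (auto simp: sq_integrable_def)

lemma sq_integrable_cmult: "sq_integrable f \<Longrightarrow> sq_integrable (\<lambda>x. c * f x)"
  by (rule sq_integrable_bound[where C = "\<bar>c\<bar>"]) (auto simp: abs_mult sq_integrable_def)

lemma sq_integrable_add: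
  assumes "sq_integrable f" "sq_integrable g"
  shows "sq_integrable (\<lambda>x. f x + g x)"
proof (rule sq_integrable_bound[OF sq_integrable_hypot[OF assms], where C = 2])
  show "(\<lambda>x. f x + g x) \<in> borel_measurable borel" using assms by (auto simp: sq_integrable_def)
  show "\<bar>f x + g x\<bar> \<le> 2 * \<bar>sqrt ((f x)\<^sup>2 + (g x)\<^sup>2)\<bar>" for x
    using real_sqrt_ge_abs1[of "f x" "g x"] real_sqrt_ge_abs2[of "g x" "f x"] by linarith
qed

lemma sq_integrable_shift:
  assumes "sq_integrable f" shows "sq_integrable (\<lambda>x. f (x + c))"
    and "(LINT x|lborel. (f (x + c))\<^sup>2) = (LINT x|lborel. (f x)\<^sup>2)"
proof -
  note [measurable] = sq_integrable_measurable[OF assms]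
  show "sq_integrable (\<lambda>x. f (x + c))"
    using assms lborel_integrable_real_affine[of "\<lambda>x. (f x)\<^sup>2" 1 c]
    by (simp add: sq_integrable_def add.commute)
  show "(LINT x|lborel. (f (x + c))\<^sup>2) = (LINT x|lborel. (f x)\<^sup>2)"
    using lborel_integral_real_affine[of 1 "\<lambda>x. (f x)\<^sup>2" c] by (simp add: add.commute)
qed

lemma square_integrable_indicator_Ioc:
  fixes x y :: real
  shows
    "integrable lborel (\<lambda>z. (indicat_real {x<..y} z)\<^sup>2)"
    "x \<le> y \<Longrightarrow> (LINT z|lborel. (indicat_real {x<..y} z)\<^sup>2) = y - x"
proof -
  have *: "(\<lambda>z. (indicat_real {x<..y} z)\<^sup>2) = indicat_real {x<..y}"
    by (auto simp: indicator_def fun_eq_iff)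
  show "integrable lborel (\<lambda>z. (indicat_real {x<..y} z)\<^sup>2)"
    unfolding * by (cases "x \<le> y") (simp_all add: integrable_indicator_iff)
  show "(LINT z|lborel. (indicat_real {x<..y} z)\<^sup>2) = y - x" if "x \<le> y"
    using that unfolding * by simp
qed

lemma sq_integrable_imp_set_integrable:
  assumes "sq_integrable h" shows "set_integrable lborel {x<..y} h"
  using square_integrable_mult[of "indicat_real {x<..y}" lborel h]
    square_integrable_indicator_Ioc(1)[of x y] assms
  by (auto simp: set_integrable_def sq_integrable_def)

lemma integral_Ioc_le_sqrt:
  fixes x y :: real
  assumes "sq_integrable h" "x \<le> y"
  shows "(LINT z:{x<..y}|lborel. h z)\<^sup>2 \<le> (y - x) * (LINT z|lborel. (h z)\<^sup>2)"
  using Cauchy_Schwarz_integral[of "indicat_real {x<..y}" lborel h] assms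
    square_integrable_indicator_Ioc[of x y]
  by (auto simp: sq_integrable_def set_lebesgue_integral_def)

lemma integral_Ioc_combine:
  fixes h :: "real \<Rightarrow> 'a::{banach, second_countable_topology}"
  assumes "\<And>x y. set_integrable lborel {x<..y} h" "x \<le> y" "y \<le> z"
  shows "(LINT t:{x<..z}|lborel. h t) = (LINT t:{x<..y}|lborel. h t) + (LINT t:{y<..z}|lborel. h t)"
proof -
  have "{x<..z} = {x<..y} \<union> {y<..z}" using assms by auto
  then show ?thesis using set_integral_Un[of "{x<..y}" "{y<..z}" lborel h] assms by simp
qed

lemma integral_Ioc_shift:
  fixes h :: "real \<Rightarrow> 'a::{banach, second_countable_topology}"
  shows "(LINT t:{x<..y}|lborel. h (t + c)) = (LINT t:{x+c<..y+c}|lborel. h t)"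
proof -
  have "indicat_real {x + c<..y + c} (c + t) = indicat_real {x<..y} t" for t
    by (auto simp: indicator_def)
  then show ?thesis
    using lborel_integral_real_affine[of 1 "\<lambda>t. indicat_real {x+c<..y+c} t *\<^sub>R h t" c]
    by (simp add: set_lebesgue_integral_def add.commute)
qed

text \<open>Halving the interval repeatedly improves the local bound by the factor \<open>2\<close> each time.\<close>

lemma subadditive_interval_nonpos:
  fixes S \<omega> :: "real \<Rightarrow> real \<Rightarrow> real"
  assumes sub: "\<And>x y z. x \<le> y \<Longrightarrow> y \<le> z \<Longrightarrow> S x z \<le> S x y + S y z"
    and add: "\<And>x y z. x \<le> y \<Longrightarrow> y \<le> z \<Longrightarrow> \<omega> x z = \<omega> x y + \<omega> y z"
    and bnd: "\<And>x y. x \<le> y \<Longrightarrow> S x y \<le> (y - x) * \<omega> x y"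
    and xy: "x \<le> y"
  shows "S x y \<le> 0"
proof -
  have *: "x \<le> y \<Longrightarrow> S x y \<le> (y - x) / 2 ^ n * \<omega> x y" for n x y
  proof (induction n arbitrary: x y)
    case 0
    then show ?case using bnd by simp
  next
    case (Suc n)
    define m where "m = (x + y) / 2"
    have m: "x \<le> m" "m \<le> y" "m - x = (y - x) / 2" "y - m = (y - x) / 2"
      using Suc.prems by (auto simp: m_def field_simps)
    have "S x y \<le> S x m + S m y" by (rule sub[OF m(1,2)])
    also have "\<dots> \<le> (m - x) / 2 ^ n * \<omega> x m + (y - m) / 2 ^ n * \<omega> m y"
      using Suc.IH m by (intro add_mono) auto
    also have "\<dots> = (y - x) / 2 ^ Suc n * (\<omega> x m + \<omega> m y)"
      unfolding m(3,4) by (simp add: distrib_left)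
    also have "\<omega> x m + \<omega> m y = \<omega> x y" by (rule add[OF m(1,2), symmetric])
    finally show ?case .
  qed
  have "(\<lambda>n. (y - x) * \<omega> x y * (1 / 2) ^ n) \<longlonglongrightarrow> (y - x) * \<omega> x y * 0"
    by (intro tendsto_intros LIMSEQ_power_zero) simp
  then show ?thesis
    using *[OF xy] by (intro LIMSEQ_le_const) (auto simp: power_one_over divide_simps)
qed

definition upper_grad :: "(real \<Rightarrow> real) \<Rightarrow> (real \<Rightarrow> real) \<Rightarrow> bool" where
  "upper_grad f h \<longleftrightarrow> (\<forall>x. 0 \<le> f x) \<and> (\<forall>x. 0 \<le> h x) \<and> sq_integrable f \<and> sq_integrable h \<and>
     (\<forall>x y. x \<le> y \<longrightarrow> \<bar>f y - f x\<bar> \<le> (LINT z:{x<..y}|lborel. h z))"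

lemma upper_gradD:
  assumes "upper_grad f h"
  shows "0 \<le> f x" "0 \<le> h x" "sq_integrable f" "sq_integrable h"
    "x \<le> y \<Longrightarrow> \<bar>f y - f x\<bar> \<le> (LINT z:{x<..y}|lborel. h z)"
    "f \<in> borel_measurable borel" "h \<in> borel_measurable borel"
    "integrable lborel (\<lambda>x. (f x)\<^sup>2)" "integrable lborel (\<lambda>x. (h x)\<^sup>2)"
  using assms by (auto simp: upper_grad_def sq_integrable_def)

lemma upper_grad_scale:
  assumes "upper_grad f h" "0 \<le> c"
  shows "upper_grad (\<lambda>x. c * f x) (\<lambda>x. c * h x)"
proof -
  have "\<bar>c * f y - c * f x\<bar> \<le> (LINT z:{x<..y}|lborel. c * h z)" if "x \<le> y" for x y
  proof -
    have "\<bar>c * f y - c * f x\<bar> = c * \<bar>f y - f x\<bar>"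
      using assms(2) by (simp add: abs_mult flip: right_diff_distrib)
    also have "\<dots> \<le> c * (LINT z:{x<..y}|lborel. h z)"
      using assms(2) upper_gradD(5)[OF assms(1) that] by (intro mult_left_mono)
    finally show ?thesis by simp
  qed
  then show ?thesis
    using assms by (auto simp: upper_grad_def intro: sq_integrable_cmult)
qed

lemma upper_grad_shift:
  assumes "upper_grad f h"
  shows "upper_grad (\<lambda>x. f (x + c)) (\<lambda>x. h (x + c))"
  using assms integral_Ioc_shift[of _ _ h c]
  by (auto simp: upper_grad_def intro: sq_integrable_shift)

lemma set_integral_complex_of_real_integrable:
  "set_integrable M A f \<Longrightarrow> set_integrable M A (\<lambda>x. complex_of_real (f x))"
  unfolding set_integrable_def
  by (drule integrable_of_real[where 'a = complex]) (simp add: scaleR_conv_of_real)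

text \<open>The root is the modulus of the complex number f + i g. So the reverse triangle
  inequality and the bound of the norm of an integral by the integral of the norm do the work, and
  no derivative of the square root at 0 appears.\<close>

lemma upper_grad_hypot:
  assumes f: "upper_grad f h" and g: "upper_grad g k"
  shows "upper_grad (\<lambda>x. sqrt ((f x)\<^sup>2 + (g x)\<^sup>2)) (\<lambda>x. sqrt ((h x)\<^sup>2 + (k x)\<^sup>2))"
proof -
  have "\<bar>sqrt ((f y)\<^sup>2 + (g y)\<^sup>2) - sqrt ((f x)\<^sup>2 + (g x)\<^sup>2)\<bar>
    \<le> (LINT z:{x<..y}|lborel. sqrt ((h z)\<^sup>2 + (k z)\<^sup>2))" if "x \<le> y" for x y
  proof -
    have sh: "set_integrable lborel {x<..y} (\<lambda>z. complex_of_real (h z))"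
      and sk: "set_integrable lborel {x<..y} (\<lambda>z. \<i> * complex_of_real (k z))"
      using upper_gradD(4)[OF f] upper_gradD(4)[OF g]
      by (auto intro!: set_integral_complex_of_real_integrable set_integrable_mult_right
          sq_integrable_imp_set_integrable)
    have C: "complex_of_real (h z) + \<i> * complex_of_real (k z) = Complex (h z) (k z)" for z
      by (simp add: complex_eq_iff)
    have "\<bar>sqrt ((f y)\<^sup>2 + (g y)\<^sup>2) - sqrt ((f x)\<^sup>2 + (g x)\<^sup>2)\<bar>
      \<le> cmod (Complex (f y) (g y) - Complex (f x) (g x))"
      using norm_triangle_ineq3[of "Complex (f y) (g y)" "Complex (f x) (g x)"]
      by (simp add: cmod_def)
    also have "\<dots> = sqrt (\<bar>f y - f x\<bar>\<^sup>2 + \<bar>g y - g x\<bar>\<^sup>2)"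
      by (simp add: cmod_def)
    also have "\<dots> \<le> sqrt ((LINT z:{x<..y}|lborel. h z)\<^sup>2 + (LINT z:{x<..y}|lborel. k z)\<^sup>2)"
      using upper_gradD(5)[OF f that] upper_gradD(5)[OF g that]
      by (intro real_sqrt_le_mono add_mono power_mono) auto
    also have "\<dots> = cmod (complex_of_real (LINT z:{x<..y}|lborel. h z)
                        + \<i> * complex_of_real (LINT z:{x<..y}|lborel. k z))"
      by (simp add: cmod_def)
    also have "complex_of_real (LINT z:{x<..y}|lborel. h z)
         + \<i> * complex_of_real (LINT z:{x<..y}|lborel. k z)
       = (LINT z:{x<..y}|lborel. complex_of_real (h z) + \<i> * complex_of_real (k z))"
      using sh sk by (simp add: set_integral_add set_integral_complex_of_real)
    also have "cmod \<dots> \<le> (LINT z:{x<..y}|lborel. cmod (complex_of_real (h z) + \<i> * complex_of_real (k z)))"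
      using integral_norm_bound[of lborel "\<lambda>z. indicat_real {x<..y} z *\<^sub>R (complex_of_real (h z) + \<i> * complex_of_real (k z))"]
      by (simp add: set_lebesgue_integral_def)
    finally show ?thesis unfolding C by (simp add: cmod_def)
  qed
  then show ?thesis using f g by (auto simp: upper_grad_def intro: sq_integrable_hypot)
qed

text \<open>The product rule as an inequality. On a short interval \<eta> is frozen at the right end
  and f at the left end; each replacement costs at most \<open>L * (y - x)\<close> times the
  integral of \<open>h\<close>. This error is quadratically small, and
  \<open>subadditive_interval_nonpos\<close> removes it.\<close>

lemma upper_grad_cutoff:
  assumes f: "upper_grad f h" and \<eta>: "\<And>x. 0 \<le> \<eta> x" "\<And>x. \<eta> x \<le> 1"
    and lip: "\<And>x y. x \<le> y \<Longrightarrow> \<bar>\<eta> y - \<eta> x\<bar> \<le> L * (y - x)" and L: "0 \<le> L"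
    and [measurable]: "\<eta> \<in> borel_measurable borel"
  shows "upper_grad (\<lambda>x. \<eta> x * f x) (\<lambda>x. \<eta> x * h x + L * f x)"
proof -
  let ?I = "\<lambda>g x y. LINT z:{x<..y}|lborel. g z"
  note fD = upper_gradD[OF f]
  note [measurable] = fD(6,7)
  have sq: "sq_integrable (\<lambda>x. \<eta> x * f x)" "sq_integrable (\<lambda>x. \<eta> x * h x)" "sq_integrable (\<lambda>x. L * f x)"
    by (rule sq_integrable_bound[OF fD(3), of _ 1], use \<eta> in \<open>auto intro: mult_left_le_one_le simp: abs_mult\<close>)
      (rule sq_integrable_bound[OF fD(4), of _ 1] sq_integrable_cmult[OF fD(3)],
        (use \<eta> in \<open>auto intro: mult_left_le_one_le simp: abs_mult\<close>)?)+
  have sq': "sq_integrable (\<lambda>x. \<eta> x * h x + L * f x)" using sq by (intro sq_integrable_add)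
  have si: "set_integrable lborel {x<..y} (\<lambda>x. \<eta> x * h x + L * f x)"
    "set_integrable lborel {x<..y} h" "set_integrable lborel {x<..y} f"
    "set_integrable lborel {x<..y} (\<lambda>x. \<eta> x * h x)" for x y
    using sq' sq fD by (auto intro: sq_integrable_imp_set_integrable)
  have sc: "set_integrable lborel {x<..y} (\<lambda>_. c)" for x y c :: real
    by (cases "x \<le> y") (simp_all add: set_integrable_def integrable_indicator_iff)
  have cI: "?I (\<lambda>_. c) x y = c * (y - x)" if "x \<le> y" for x y c :: real
    using that by (simp add: set_lebesgue_integral_def)
  define S where "S x y = \<bar>\<eta> y * f y - \<eta> x * f x\<bar> - ?I (\<lambda>z. \<eta> z * h z + L * f z) x y" for x y
  have "S x y \<le> 0" if "x \<le> y" for x y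
  proof (rule subadditive_interval_nonpos[where \<omega> = "\<lambda>x y. 2 * L * ?I h x y", OF _ _ _ that])
    fix x y z :: real assume "x \<le> y" "y \<le> z"
    then show "S x z \<le> S x y + S y z" unfolding S_def
      using integral_Ioc_combine[OF si(1), of x y z] by linarith
    show "2 * L * ?I h x z = 2 * L * ?I h x y + 2 * L * ?I h y z"
      using integral_Ioc_combine[OF si(2) \<open>x \<le> y\<close> \<open>y \<le> z\<close>] by (simp add: algebra_simps)
  next
    fix x y :: real assume xy: "x \<le> y"
    have "\<bar>\<eta> y * f y - \<eta> x * f x\<bar> = \<bar>\<eta> y * (f y - f x) + (\<eta> y - \<eta> x) * f x\<bar>"
      by (simp add: algebra_simps)
    also have "\<dots> \<le> \<eta> y * \<bar>f y - f x\<bar> + \<bar>\<eta> y - \<eta> x\<bar> * f x"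
      using \<eta>(1)[of y] fD(1)[of x] by (metis abs_mult abs_of_nonneg abs_triangle_ineq)
    also have "\<dots> \<le> \<eta> y * ?I h x y + (L * (y - x)) * f x"
      using \<eta> fD(1)[of x] fD(5)[OF xy] lip[OF xy] by (intro add_mono mult_left_mono mult_right_mono) auto
    also have "\<eta> y * ?I h x y = ?I (\<lambda>z. \<eta> y * h z) x y" by simp
    also have "(L * (y - x)) * f x = ?I (\<lambda>_. L * f x) x y" using cI[OF xy] by simp
    also have "?I (\<lambda>z. \<eta> y * h z) x y \<le> ?I (\<lambda>z. \<eta> z * h z + L * (y - x) * h z) x y"
    proof (rule set_integral_mono)
      fix z assume z: "z \<in> {x<..y}"
      have "\<eta> y \<le> \<eta> z + L * (y - z)" using lip[of z y] z by auto
      also have "\<dots> \<le> \<eta> z + L * (y - x)" using z L by (auto intro!: mult_left_mono)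
      finally show "\<eta> y * h z \<le> \<eta> z * h z + L * (y - x) * h z"
        using mult_right_mono[OF _ fD(2)[of z]] by (metis distrib_right)
    qed (use si in auto)
    also have "\<dots> = ?I (\<lambda>z. \<eta> z * h z) x y + L * (y - x) * ?I h x y"
      using si by simp
    also have "?I (\<lambda>_. L * f x) x y \<le> ?I (\<lambda>z. L * f z + L * ?I h x y) x y"
    proof (rule set_integral_mono)
      fix z assume z: "z \<in> {x<..y}"
      have "f x \<le> f z + ?I h x z" using fD(5)[of x z] z by auto
      also have "?I h x z \<le> ?I h x y"
        using integral_Ioc_combine[OF si(2), of x z y] z fD(2)
        by (auto simp: set_lebesgue_integral_def)
      finally show "L * f x \<le> L * f z + L * ?I h x y"
        using L by (metis distrib_left mult_left_mono add_left_mono)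
    qed (use si sc in auto)
    also have "\<dots> = ?I (\<lambda>z. L * f z) x y + ?I (\<lambda>_. L * ?I h x y) x y"
      using si sc by (subst set_integral_add) auto
    also have "?I (\<lambda>_. L * ?I h x y) x y = L * ?I h x y * (y - x)" using cI[OF xy] by simp
    finally have "\<bar>\<eta> y * f y - \<eta> x * f x\<bar> \<le> (?I (\<lambda>z. \<eta> z * h z) x y + ?I (\<lambda>z. L * f z) x y)
        + (y - x) * (2 * L * ?I h x y)"
      by (simp add: algebra_simps)
    moreover have "?I (\<lambda>z. \<eta> z * h z) x y + ?I (\<lambda>z. L * f z) x y = ?I (\<lambda>z. \<eta> z * h z + L * f z) x y"
      using si by (subst set_integral_add) auto
    ultimately show "S x y \<le> (y - x) * (2 * L * ?I h x y)" unfolding S_def by simp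
  qed
  then show ?thesis
    using sq sq' \<eta> fD L by (auto simp: upper_grad_def S_def)
qed

text \<open>Hoelder continuity of order 1/2, from Cauchy-Schwarz on the interval between the two
  points.\<close>

lemma upper_grad_increment_sq:
  fixes x y :: real
  assumes "upper_grad f h"
  shows "(f y - f x)\<^sup>2 \<le> \<bar>y - x\<bar> * (LINT z|lborel. (h z)\<^sup>2)"
proof -
  have "(f y - f x)\<^sup>2 \<le> (y - x) * (LINT z|lborel. (h z)\<^sup>2)" if "x \<le> y" for x y
    using integral_Ioc_le_sqrt[OF upper_gradD(4)[OF assms] that]
      power_mono[OF upper_gradD(5)[OF assms that], of 2] by simp
  from this[of x y] this[of y x] show ?thesis
    by (cases "x \<le> y") (auto simp: power2_commute)
qed

text \<open>Compare the value at x with the average over the window (x, x + l]. The length l stays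
  free: a small window puts little weight on the derivative, and choosing it in terms of the two
  norms gives an interpolation inequality.\<close>

lemma upper_grad_sup_bound:
  assumes f: "upper_grad f h" and l: "0 < l"
  shows "(f x)\<^sup>2 \<le> 2 / l * (LINT z|lborel. (f z)\<^sup>2) + 2 * l * (LINT z|lborel. (h z)\<^sup>2)"
proof -
  define K where "K = (LINT z|lborel. (h z)\<^sup>2)"
  note fD = upper_gradD[OF f]
  have K: "0 \<le> K" by (simp add: K_def)
  have ptw: "(f x)\<^sup>2 - 2 * l * K \<le> 2 * (f z)\<^sup>2" if "z \<in> {x<..x+l}" for z
  proof -
    have "(f x)\<^sup>2 \<le> 2 * (f z)\<^sup>2 + 2 * (f x - f z)\<^sup>2"
      using sum_squares_bound[of "f z" "f x - f z"] by (simp add: power2_eq_square algebra_simps)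
    also have "(f x - f z)\<^sup>2 \<le> \<bar>x - z\<bar> * K" unfolding K_def by (rule upper_grad_increment_sq[OF f])
    also have "\<dots> \<le> l * K" using that K by (intro mult_right_mono) auto
    finally show ?thesis by simp
  qed
  have si: "integrable lborel (\<lambda>z. indicat_real {x<..x+l} z *\<^sub>R (2 * (f z)\<^sup>2))"
    "integrable lborel (indicat_real {x<..x+l})"
    using fD(8) l by (intro integrable_mult_indicator, auto simp: integrable_indicator_iff)
  have "((f x)\<^sup>2 - 2 * l * K) * l = (LINT z:{x<..x+l}|lborel. (f x)\<^sup>2 - 2 * l * K)"
    using l by (simp add: set_lebesgue_integral_def)
  also have "\<dots> \<le> (LINT z:{x<..x+l}|lborel. 2 * (f z)\<^sup>2)"
    using ptw si by (intro set_integral_mono) (auto simp: set_integrable_def)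
  also have "\<dots> \<le> (LINT z|lborel. 2 * (f z)\<^sup>2)"
    unfolding set_lebesgue_integral_def using fD(8) si(1)
    by (intro integral_mono) (auto split: split_indicator)
  finally have "((f x)\<^sup>2 - 2 * l * K) * l \<le> 2 * (LINT z|lborel. (f z)\<^sup>2)" by simp
  then show ?thesis using l by (fold K_def) (simp add: field_simps)
qed

section \<open>Smooth test functions\<close>

definition smooth :: "(real \<Rightarrow> real) \<Rightarrow> bool" where
  "smooth f \<longleftrightarrow> (\<forall>n x. (deriv ^^ n) f differentiable (at x))"

text \<open>Smoothness is shown by exhibiting a class of differentiable functions closed under
  \<open>deriv\<close>, which avoids formulas for the iterated derivatives.\<close>

lemma smooth_coinduct:
  assumes "P f" "\<And>f x. P f \<Longrightarrow> f differentiable (at x)" "\<And>f. P f \<Longrightarrow> P (deriv f)"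
  shows "smooth f"
proof -
  have "P ((deriv ^^ n) f)" for n by (induction n) (use assms in auto)
  then show ?thesis using assms by (auto simp: smooth_def)
qed

lemma smooth_differentiable: "smooth f \<Longrightarrow> f differentiable (at x)"
  by (drule smooth_def[THEN iffD1]) (metis funpow_0)

lemma smooth_deriv: "smooth f \<Longrightarrow> smooth (deriv f)"
  unfolding smooth_def by (metis comp_apply funpow_Suc_right)

lemma smooth_has_derivative: "smooth f \<Longrightarrow> (f has_real_derivative deriv f x) (at x)"
  using smooth_differentiable[of f x] by (metis DERIV_imp_deriv real_differentiable_def)

lemma smooth_antiderivative:
  assumes "\<And>x. (F has_real_derivative f x) (at x)" "smooth f"
  shows "smooth F"
proof -
  have "deriv F = f" using assms DERIV_imp_deriv by blast
  then have "(deriv ^^ n) F differentiable (at x)" for n x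
    using assms by (cases n) (auto simp: smooth_def funpow_Suc_right real_differentiable_def simp del: funpow.simps(2))
  then show ?thesis by (simp add: smooth_def)
qed

text \<open>Derivatives of members are again members, so this is a class to which
  \<open>smooth_coinduct\<close> applies. It justifies all smooth functions assembled below from
  sums, products and affine substitutions.\<close>

inductive smooth_alg :: "(real \<Rightarrow> real) \<Rightarrow> bool" where
  base: "smooth f \<Longrightarrow> smooth_alg f"
| const: "smooth_alg (\<lambda>_. c)"
| add: "smooth_alg f \<Longrightarrow> smooth_alg g \<Longrightarrow> smooth_alg (\<lambda>x. f x + g x)"
| mult: "smooth_alg f \<Longrightarrow> smooth_alg g \<Longrightarrow> smooth_alg (\<lambda>x. f x * g x)"
| affine: "smooth_alg f \<Longrightarrow> smooth_alg (\<lambda>x. f (c * x + d))"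

lemma smooth_alg_deriv:
  "smooth_alg f \<Longrightarrow> \<exists>f'. smooth_alg f' \<and> (\<forall>x. (f has_real_derivative f' x) (at x))"
proof (induction rule: smooth_alg.induct)
  case (base f)
  then show ?case using smooth_deriv smooth_has_derivative smooth_alg.base by blast
next
  case (const c)
  then show ?case by (intro exI[of _ "\<lambda>_. 0"]) (auto intro: smooth_alg.const)
next
  case (add f g)
  then obtain f' g' where *: "smooth_alg f'" "\<And>x. (f has_real_derivative f' x) (at x)"
    "smooth_alg g'" "\<And>x. (g has_real_derivative g' x) (at x)" by blast
  show ?case
    by (rule exI[of _ "\<lambda>x. f' x + g' x"]) (use * in \<open>auto intro: smooth_alg.add DERIV_add\<close>)
next
  case (mult f g)
  then obtain f' g' where *: "smooth_alg f'" "\<And>x. (f has_real_derivative f' x) (at x)"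
    "smooth_alg g'" "\<And>x. (g has_real_derivative g' x) (at x)" by blast
  show ?case
    by (rule exI[of _ "\<lambda>x. f' x * g x + f x * g' x"])
      (use * mult.hyps in \<open>auto intro!: smooth_alg.add smooth_alg.mult derivative_eq_intros\<close>)
next
  case (affine f c d)
  then obtain f' where *: "smooth_alg f'" "\<And>x. (f has_real_derivative f' x) (at x)" by blast
  have "((\<lambda>x. f (c * x + d)) has_real_derivative f' (c * x + d) * c) (at x)" for x
    by (rule DERIV_chain2[OF *(2)]) (auto intro!: derivative_eq_intros)
  then show ?case
    by (intro exI[of _ "\<lambda>x. f' (c * x + d) * c"])
      (use * in \<open>auto intro!: smooth_alg.mult smooth_alg.const smooth_alg.affine\<close>)
qed

lemma smooth_alg_imp_smooth: "smooth_alg f \<Longrightarrow> smooth f"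
proof (erule smooth_coinduct[where P = smooth_alg])
  show "f differentiable (at x)" if "smooth_alg f" for f x
    using smooth_alg_deriv[OF that] real_differentiable_def by blast
  show "smooth_alg (deriv f)" if f: "smooth_alg f" for f
  proof -
    obtain f' where f': "smooth_alg f'" "\<And>x. (f has_real_derivative f' x) (at x)"
      using smooth_alg_deriv[OF f] by blast
    then have "deriv f = f'" using DERIV_imp_deriv by blast
    then show ?thesis using f' by simp
  qed
qed

text \<open>The classical smooth function exp(-1/x) extended by zero. The polynomial factor in 1/x
  makes the family closed under differentiation.\<close>

definition flat :: "real poly \<Rightarrow> real \<Rightarrow> real" where
  "flat q x = (if 0 < x then poly q (1 / x) * exp (- (1 / x)) else 0)"

lemma flat_tendsto_0: "((\<lambda>h. flat q h / h) \<longlongrightarrow> 0) (at_right 0)"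
proof -
  have "((\<lambda>y. \<Sum>i\<le>degree q. coeff q i * (y ^ Suc i / exp y)) \<longlongrightarrow> (\<Sum>i\<le>degree q. coeff q i * 0)) at_top"
    by (intro tendsto_intros tendsto_power_div_exp_0)
  then have "((\<lambda>y. y * poly q y * exp (- y)) \<longlongrightarrow> 0) at_top"
    by (simp add: poly_altdef sum_distrib_left sum_distrib_right exp_minus field_simps)
  then have "((\<lambda>h. inverse h * poly q (inverse h) * exp (- inverse h)) \<longlongrightarrow> 0) (at_right 0)"
    by (rule filterlim_compose[OF _ filterlim_inverse_at_top_right])
  then show ?thesis
    by (rule Lim_transform_eventually)
      (auto simp: flat_def eventually_at_filter field_simps)
qed

text \<open>The polynomial \<open>[:0, 0, 1:]\<close> is X^2: differentiating 1/x and -1/x produces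
  a factor 1/x^2 with opposite signs, whence q minus its derivative. At 0 the right difference
  quotient tends to 0 by exponential decay and the left one is identically 0.\<close>

lemma flat_has_derivative:
  "(flat q has_real_derivative flat ([:0, 0, 1:] * (q - pderiv q)) x) (at x)"
proof -
  consider "0 < x" | "x < 0" | "x = 0" by linarith
  then show ?thesis
  proof cases
    case 1
    have "((\<lambda>x. poly q (1 / x) * exp (- (1 / x))) has_real_derivative
        flat ([:0, 0, 1:] * (q - pderiv q)) x) (at x)"
      using 1 by (auto intro!: derivative_eq_intros simp: flat_def field_simps power2_eq_square)
    then show ?thesis
      by (rule has_field_derivative_transform_within_open[of _ _ _ "{0<..}"])
        (use 1 in \<open>auto simp: flat_def\<close>)
  next
    case 2
    have "((\<lambda>x. 0) has_real_derivative flat ([:0, 0, 1:] * (q - pderiv q)) x) (at x)"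
      using 2 by (simp add: flat_def)
    then show ?thesis
      by (rule has_field_derivative_transform_within_open[of _ _ _ "{..<0}"])
        (use 2 in \<open>auto simp: flat_def\<close>)
  next
    case 3
    have "((\<lambda>h. flat q h / h) \<longlongrightarrow> 0) (at_left 0)"
      by (rule Lim_transform_eventually[OF tendsto_const])
        (auto simp: flat_def eventually_at_filter)
    with flat_tendsto_0 have "((\<lambda>h. flat q h / h) \<longlongrightarrow> 0) (at 0)"
      by (simp add: filterlim_split_at)
    then show ?thesis using 3 by (simp add: DERIV_def flat_def)
  qed
qed

lemma smooth_flat: "smooth (flat q)"
proof (rule smooth_coinduct[where P = "\<lambda>f. \<exists>q. f = flat q"])
  show "f differentiable (at x)" if "\<exists>q. f = flat q" for f x
    using that flat_has_derivative real_differentiable_def by blast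
  show "\<exists>q. deriv f = flat q" if "\<exists>q. f = flat q" for f
    using that flat_has_derivative DERIV_imp_deriv by (metis ext)
qed auto

section \<open>A smooth step and its primitive\<close>

lemma antiderivative_from_0:
  fixes f :: "real \<Rightarrow> real"
  assumes f: "continuous_on UNIV f" "\<And>x. x \<le> 0 \<Longrightarrow> f x = 0"
  obtains F where "\<And>x. (F has_real_derivative f x) (at x)" "\<And>x. x \<le> 0 \<Longrightarrow> F x = 0"
proof -
  \<comment> \<open>The integrand vanishes up to 0, so starting at -1 gives the same values as
    starting at 0, and every x \<ge> 0 becomes an interior point of the interval of
    integration.\<close>
  define F where "F x = integral {-1..x} f" for x
  have F0: "F x = 0" if "x \<le> 0" for x
  proof -
    have "integral {-1..x} f = integral {-1..x} (\<lambda>_. 0)"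
      using f(2) that by (intro integral_cong) auto
    then show ?thesis by (simp add: F_def)
  qed
  have "(F has_real_derivative f x) (at x)" for x
  proof (cases "x < 0")
    case True
    have "((\<lambda>_. 0) has_real_derivative f x) (at x)" using True f by simp
    then show ?thesis
      by (rule has_field_derivative_transform_within_open[of _ _ _ "{..<0}"])
        (use True F0 in auto)
  next
    case False
    have "(F has_real_derivative f x) (at x within {-1..x+1})"
      unfolding F_def using False f(1) continuous_on_subset
      by (intro integral_has_real_derivative) auto
    moreover have "at x within {-1..x+1} = at x" using False by (intro at_within_Icc_at) auto
    ultimately show ?thesis by metis
  qed
  then show ?thesis using F0 that by blast
qed

text \<open>A bump on (0, 1) is integrated and normalised to the step \<open>s\<close>, which is
  integrated again to \<open>S\<close>. Beyond 1, \<open>S\<close> has slope 1. Differences of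
  scaled copies of \<open>S\<close> will be primitives of smooth approximations to indicators of
  intervals.\<close>

lemma smooth_step:
  obtains S s :: "real \<Rightarrow> real" where
    "\<And>x. (S has_real_derivative s x) (at x)" "smooth s" "\<And>x. x \<le> 0 \<Longrightarrow> S x = 0"
    "\<And>x. x \<le> 0 \<Longrightarrow> s x = 0" "\<And>x. 1 \<le> x \<Longrightarrow> s x = 1" "\<And>x. 0 \<le> s x" "\<And>x. s x \<le> 1"
proof -
  define b where "b x = flat 1 x * flat 1 ((-1) * x + 1)" for x
  have b: "smooth b" unfolding b_def
    by (intro smooth_alg_imp_smooth smooth_alg.mult[OF smooth_alg.base[OF smooth_flat]
          smooth_alg.affine[OF smooth_alg.base[OF smooth_flat]]])
  have b0: "b x = 0" if "x \<le> 0 \<or> 1 \<le> x" for x using that by (auto simp: b_def flat_def)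
  have bnn: "0 \<le> b x" for x by (simp add: b_def flat_def)
  have bpos: "0 < b (1/2)" by (simp add: b_def flat_def)
  have cont: "continuous_on UNIV f" if "smooth f" for f
    using that smooth_differentiable by (metis differentiable_imp_continuous_within continuous_at_imp_continuous_on)
  obtain B where B: "\<And>x. (B has_real_derivative b x) (at x)" "\<And>x. x \<le> 0 \<Longrightarrow> B x = 0"
    using antiderivative_from_0[OF cont[OF b]] b0 by blast
  have mono: "B x \<le> B y" if "x \<le> y" for x y
    using that B(1) bnn by (meson DERIV_nonneg_imp_nondecreasing)
  have const: "B x = B 1" if "1 \<le> x" for x
  proof (rule antisym)
    show "B x \<le> B 1"
    proof (rule DERIV_nonpos_imp_nonincreasing[OF that])
      show "\<exists>z. (B has_real_derivative z) (at y) \<and> z \<le> 0" if "1 \<le> y" for y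
        using B(1)[of y] b0[of y] that by auto
    qed
  qed (rule mono[OF that])
  \<comment> \<open>Otherwise monotonicity would make \<open>B\<close> constant on (0, 1), against
    the positive derivative at 1/2.\<close>
  have B1: "0 < B 1"
  proof (rule ccontr)
    assume "\<not> 0 < B 1"
    then have z: "B x = 0" if "0 < x" "x < 1" for x
      using mono[of 0 x] mono[of x 1] that B(2)[of 0] by simp
    have "((\<lambda>_. 0) has_real_derivative b (1/2)) (at (1/2))"
      by (rule has_field_derivative_transform_within_open[OF B(1), of "{0<..<1}"]) (use z in auto)
    then show False using bpos DERIV_unique[OF _ DERIV_const] by (metis less_irrefl)
  qed
  define s where "s x = 1 / B 1 * B x" for x
  have "smooth B" using smooth_antiderivative[OF B(1) b] .
  then have s: "smooth s" unfolding s_def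
    by (intro smooth_alg_imp_smooth[OF smooth_alg.mult[OF smooth_alg.const smooth_alg.base]])
  have s0: "s x = 0" if "x \<le> 0" for x using B(2) that by (simp add: s_def)
  obtain S where S: "\<And>x. (S has_real_derivative s x) (at x)" "\<And>x. x \<le> 0 \<Longrightarrow> S x = 0"
    using antiderivative_from_0[OF cont[OF s]] s0 by blast
  have s1: "s x = 1" if "1 \<le> x" for x using const[OF that] B1 by (simp add: s_def)
  have "0 \<le> B x" for x using mono[of 0 x] B(2)[of 0] B(2)[of x] by (cases "0 \<le> x") auto
  moreover have "B x \<le> B 1" for x using mono[of x 1] const[of x] by (cases "x \<le> 1") auto
  ultimately show ?thesis
    using that[OF S(1) s S(2) s0 s1] B1 by (simp add: s_def)
qed

section \<open>Support, bounds and integrability for test functions\<close>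

lemma test_function_iff:
  "test_function \<phi> \<longleftrightarrow> smooth \<phi> \<and> (\<exists>R. \<forall>x. R < \<bar>x\<bar> \<longrightarrow> \<phi> x = 0)"
proof -
  have "compact (closure {x. \<phi> x \<noteq> 0}) \<longleftrightarrow> (\<exists>R. \<forall>x. R < \<bar>x\<bar> \<longrightarrow> \<phi> x = 0)"
    unfolding compact_closure bounded_iff by (auto simp: not_le[symmetric])
  then show ?thesis by (simp add: test_function_def smooth_def)
qed

lemma test_function_deriv:
  assumes "test_function \<phi>" shows "test_function (deriv \<phi>)"
proof -
  obtain R where R: "smooth \<phi>" "\<And>x. R < \<bar>x\<bar> \<Longrightarrow> \<phi> x = 0"
    using assms unfolding test_function_iff by metis
  have "deriv \<phi> x = 0" if x: "R < \<bar>x\<bar>" for x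
  proof -
    have "open {x. R < \<bar>x\<bar>}" by (intro open_Collect_less continuous_intros)
    then have "((\<lambda>_. 0) has_real_derivative deriv \<phi> x) (at x)"
      using has_field_derivative_transform_within_open[OF smooth_has_derivative[OF R(1)], of "{x. R < \<bar>x\<bar>}" x "\<lambda>_. 0"]
        R(2) x by auto
    then show ?thesis using DERIV_unique[OF _ DERIV_const] by metis
  qed
  then show ?thesis using smooth_deriv[OF R(1)] test_function_iff by blast
qed

lemma test_function_continuous: "test_function \<phi> \<Longrightarrow> continuous_on UNIV \<phi>"
  using smooth_differentiable test_function_iff
  by (metis differentiable_imp_continuous_within continuous_at_imp_continuous_on)

lemma test_function_bounded:
  assumes "test_function \<phi>" obtains B where "0 \<le> B" "\<And>x. \<bar>\<phi> x\<bar> \<le> B"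
proof -
  obtain R where R: "\<And>x. R < \<bar>x\<bar> \<Longrightarrow> \<phi> x = 0"
    using assms unfolding test_function_iff by metis
  have "compact (\<phi> ` {-R..R})"
    using continuous_on_subset[OF test_function_continuous[OF assms]]
    by (intro compact_continuous_image) auto
  then obtain B where "\<forall>x\<in>{-R..R}. \<bar>\<phi> x\<bar> \<le> B"
    by (auto dest!: compact_imp_bounded simp: bounded_iff)
  then have B: "\<bar>\<phi> x\<bar> \<le> B" if "x \<in> {-R..R}" for x using that by blast
  have "\<bar>\<phi> x\<bar> \<le> max 0 B" for x
    using B[of x] R[of x] by (cases "R < \<bar>x\<bar>") (force simp: abs_le_iff max_def not_less)+
  then show ?thesis using that[of "max 0 B"] by simp
qed

lemma test_function_scaleR_integrable:
  fixes f :: "real \<Rightarrow> 'a::{banach, second_countable_topology}"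
  assumes \<phi>: "test_function \<phi>" and f: "\<And>x y. set_integrable lborel {x<..y} f"
    and [measurable]: "f \<in> borel_measurable borel"
  shows "integrable lborel (\<lambda>x. \<phi> x *\<^sub>R f x)"
proof -
  obtain B where B: "0 \<le> B" "\<And>x. \<bar>\<phi> x\<bar> \<le> B" using test_function_bounded[OF \<phi>] by metis
  obtain R where R: "\<And>x. R < \<bar>x\<bar> \<Longrightarrow> \<phi> x = 0" using \<phi> unfolding test_function_iff by metis
  have [measurable]: "\<phi> \<in> borel_measurable borel"
    using test_function_continuous[OF \<phi>] by (rule borel_measurable_continuous_onI)
  show ?thesis
  proof (rule Bochner_Integration.integrable_bound)
    show "integrable lborel (\<lambda>x. B * norm (indicat_real {-R-1<..R+1} x *\<^sub>R f x))"
      using f[of "-R-1" "R+1"] unfolding set_integrable_def by (intro integrable_mult_right integrable_norm)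
    have "norm (\<phi> x *\<^sub>R f x) \<le> B * norm (indicat_real {-R-1<..R+1} x *\<^sub>R f x)" for x
    proof (cases "R < \<bar>x\<bar>")
      case False
      then have "indicat_real {-R-1<..R+1} x = 1" by (auto simp: indicator_def)
      then show ?thesis using B(2)[of x] by (simp add: mult_right_mono)
    qed (use R B in auto)
    then show "AE x in lborel. norm (\<phi> x *\<^sub>R f x) \<le> norm (B * norm (indicat_real {-R-1<..R+1} x *\<^sub>R f x))"
      using B by (intro AE_I2) (metis abs_of_nonneg mult_nonneg_nonneg norm_ge_zero real_norm_def)
  qed simp
qed

text \<open>Half-open intervals form an intersection-stable generator of the Borel sets, so the
  pi-lambda theorem carries the vanishing of the integrals to all Borel sets. The function is only
  locally integrable, hence the preliminary truncation to (-N, N].\<close>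

lemma AE_zero_if_integral_Ioc_zero:
  fixes f :: "real \<Rightarrow> 'a::{banach, second_countable_topology}"
  assumes f: "\<And>x y. set_integrable lborel {x<..y} f"
    and zero: "\<And>x y. x < y \<Longrightarrow> (LINT z:{x<..y}|lborel. f z) = 0"
  shows "AE x in lborel. f x = 0"
proof -
  have z: "(LINT z:{x<..y}|lborel. f z) = 0" for x y
    by (cases "x < y") (simp_all add: zero, simp add: set_lebesgue_integral_def)
  have "AE x in lborel. indicat_real {-real N<..real N} x *\<^sub>R f x = 0" for N
  proof (rule sigma_finite_measure.density_zero[OF sigma_finite_lborel])
    let ?I = "{-real N<..real N}"
    let ?g = "\<lambda>x. indicat_real ?I x *\<^sub>R f x"
    show int: "integrable lborel ?g" using f by (simp add: set_integrable_def)
    fix A :: "real set" assume A: "A \<in> sets lborel"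
    then have A': "A \<in> sigma_sets UNIV (range (\<lambda>(a, b). {a<..b::real}))"
      by (simp add: borel_sigma_sets_Ioc)
    have "Int_stable (range (\<lambda>(a, b). {a<..b::real}))"
      unfolding Int_stable_def by (auto simp: Int_greaterThanAtMost)
    moreover have "range (\<lambda>(a, b). {a<..b::real}) \<subseteq> Pow UNIV" by simp
    ultimately show "(LINT x:A|lborel. ?g x) = 0" using A'
    proof (induction rule: sigma_sets_induct_disjoint)
      case (basic A)
      then obtain a b where ab: "A = {a<..b}" by auto
      have "(LINT x:A|lborel. ?g x) = (LINT x:{max a (-real N)<..min b (real N)}|lborel. f x)"
        unfolding set_lebesgue_integral_def ab
        by (intro Bochner_Integration.integral_cong) (auto simp: indicator_def)
      also have "\<dots> = 0" by (rule z)
      finally show ?case .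
    next
      case (compl A)
      then have [measurable]: "A \<in> sets lborel" by (simp add: borel_sigma_sets_Ioc)
      have s: "set_integrable lborel B ?g" if "B \<in> sets lborel" for B
        unfolding set_integrable_def using that by (intro integrable_mult_indicator int)
      have "(LINT x:A \<union> (UNIV - A)|lborel. ?g x) = (LINT x:A|lborel. ?g x) + (LINT x:UNIV-A|lborel. ?g x)"
        using sets.Diff[OF sets.top[of lborel] \<open>A \<in> sets lborel\<close>] \<open>A \<in> sets lborel\<close>
        by (intro set_integral_Un s) auto
      moreover have "A \<union> (UNIV - A) = UNIV" by auto
      moreover have "(LINT x:UNIV|lborel. ?g x) = (LINT x:?I|lborel. f x)"
        by (simp add: set_lebesgue_integral_def)
      ultimately show ?case using compl.IH z by simp
    next
      case (union A)
      have m: "A i \<in> sets lborel" for i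
        using union.hyps(2) by (simp add: borel_sigma_sets_Ioc range_subsetD)
      have d: "A i \<inter> A j = {}" if "i \<noteq> j" for i j
        using union.hyps(1) that by (simp add: disjoint_family_on_def)
      have "set_integrable lborel (\<Union>i. A i) ?g"
        unfolding set_integrable_def using m by (intro integrable_mult_indicator int sets.countable_UN) auto
      from lebesgue_integral_countable_add[OF m d this]
      have "(LINT x:(\<Union>i. A i)|lborel. ?g x) = (\<Sum>i. (LINT x:A i|lborel. ?g x))" .
      also have "\<dots> = (\<Sum>i::nat. 0)" by (simp only: union.IH)
      finally show ?case by simp
    qed (simp add: set_lebesgue_integral_def)
  qed
  then have "AE x in lborel. \<forall>N. indicat_real {-real N<..real N} x *\<^sub>R f x = 0"
    unfolding AE_all_countable by blast
  then show ?thesis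
  proof (rule AE_mp, intro AE_I2 impI)
    fix x assume *: "\<forall>N. indicat_real {-real N<..real N} x *\<^sub>R f x = 0"
    obtain N where "\<bar>x\<bar> < real N" using reals_Archimedean2 by blast
    then have "indicat_real {-real N<..real N} x = 1" by (auto simp: indicator_def)
    then show "f x = 0" using spec[OF *, of N] by simp
  qed
qed

section \<open>Absolutely continuous functions\<close>

text \<open>The oriented integral from 0 to x: one of the two intervals is always empty.\<close>

definition primitive :: "(real \<Rightarrow> 'a::{banach, second_countable_topology}) \<Rightarrow> real \<Rightarrow> 'a" where
  "primitive g x = (LINT z:{0<..x}|lborel. g z) - (LINT z:{x<..0}|lborel. g z)"

lemma primitive_diff:
  fixes g :: "real \<Rightarrow> 'a::{banach, second_countable_topology}"
  assumes g: "\<And>x y. set_integrable lborel {x<..y} g" and xy: "x \<le> y"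
  shows "primitive g y - primitive g x = (LINT z:{x<..y}|lborel. g z)"
proof -
  have e: "(LINT z:{a<..b}|lborel. g z) = 0" if "b \<le> a" for a b
    using that by (simp add: set_lebesgue_integral_def)
  consider "0 \<le> x" | "y \<le> 0" | "x \<le> 0" "0 \<le> y" by linarith
  then show ?thesis
  proof cases
    case 1
    then show ?thesis using integral_Ioc_combine[OF g, of 0 x y] e[of 0 x] e[of 0 y] xy
      by (simp add: primitive_def)
  next
    case 2
    then show ?thesis using integral_Ioc_combine[OF g, of x y 0] e[of x 0] e[of y 0] xy
      by (simp add: primitive_def)
  next
    case 3
    then show ?thesis using integral_Ioc_combine[OF g, of x 0 y] e[of 0 y] e[of x 0]
      by (simp add: primitive_def)
  qed
qed

lemma L2_iff: "g \<in> L2 \<longleftrightarrow> g \<in> borel_measurable borel \<and> sq_integrable (\<lambda>x. cmod (g x))"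
  by (auto simp: L2_def sq_integrable_def)

lemma L2_set_integrable:
  assumes "g \<in> L2" shows "set_integrable lborel {x<..y} g"
proof -
  have [measurable]: "g \<in> borel_measurable borel" using assms by (simp add: L2_iff)
  have "integrable lborel (\<lambda>z. norm (indicat_real {x<..y} z *\<^sub>R g z))"
    using sq_integrable_imp_set_integrable[of "\<lambda>z. cmod (g z)" x y] assms
    by (simp add: set_integrable_def L2_iff)
  then show ?thesis unfolding set_integrable_def by (rule integrable_norm_cancel) simp
qed

lemma L2_add:
  assumes "f \<in> L2" "g \<in> L2" shows "(\<lambda>x. f x + g x) \<in> L2"
proof -
  have [measurable]: "f \<in> borel_measurable borel" "g \<in> borel_measurable borel"
    using assms by (auto simp: L2_iff)
  have "sq_integrable (\<lambda>x. cmod (f x) + cmod (g x))"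
    using assms by (auto simp: L2_iff intro: sq_integrable_add)
  then have "sq_integrable (\<lambda>x. cmod (f x + g x))"
    by (rule sq_integrable_bound[where C = 1]) (auto intro: norm_triangle_ineq)
  then show ?thesis by (simp add: L2_iff)
qed

lemma L2_cmult:
  assumes "f \<in> L2" shows "(\<lambda>x. c * f x) \<in> L2"
proof -
  have [measurable]: "f \<in> borel_measurable borel" using assms by (auto simp: L2_iff)
  show ?thesis
    using assms sq_integrable_cmult[of "\<lambda>x. cmod (f x)" "cmod c"] by (simp add: L2_iff norm_mult)
qed

lemma L2_diff: "f \<in> L2 \<Longrightarrow> g \<in> L2 \<Longrightarrow> (\<lambda>x. f x - g x) \<in> L2"
  using L2_add[of f "\<lambda>x. (-1) * g x"] L2_cmult[of g "-1"] by simp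

lemma L2_shift:
  assumes "f \<in> L2" shows "(\<lambda>x. f (x + c)) \<in> L2"
proof -
  have [measurable]: "f \<in> borel_measurable borel" using assms by (auto simp: L2_iff)
  show ?thesis using assms sq_integrable_shift(1)[of "\<lambda>x. cmod (f x)" c] by (simp add: L2_iff)
qed

lemma L2_AE_cong:
  assumes "f \<in> L2" "AE x in lborel. f x = g x" "g \<in> borel_measurable borel" shows "g \<in> L2"
proof -
  have [measurable]: "f \<in> borel_measurable borel" "g \<in> borel_measurable borel"
    using assms by (auto simp: L2_iff)
  have "integrable lborel (\<lambda>x. (cmod (g x))\<^sup>2) \<longleftrightarrow> integrable lborel (\<lambda>x. (cmod (f x))\<^sup>2)"
    using assms(2) by (intro Bochner_Integration.integrable_cong_AE) auto
  then show ?thesis using assms by (simp add: L2_def)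
qed

lemma increment_sq_le:
  assumes g: "g \<in> L2" and xy: "x \<le> y"
  shows "cmod (LINT z:{x<..y}|lborel. g z) ^ 2 \<le> (y - x) * (LINT z|lborel. (cmod (g z))\<^sup>2)"
    and "cmod (LINT z:{x<..y}|lborel. g z) \<le> (LINT z:{x<..y}|lborel. cmod (g z))"
proof -
  show *: "cmod (LINT z:{x<..y}|lborel. g z) \<le> (LINT z:{x<..y}|lborel. cmod (g z))"
    using integral_norm_bound[of lborel "\<lambda>z. indicat_real {x<..y} z *\<^sub>R g z"]
    by (simp add: set_lebesgue_integral_def)
  have "cmod (LINT z:{x<..y}|lborel. g z) ^ 2 \<le> (LINT z:{x<..y}|lborel. cmod (g z)) ^ 2"
    using * by (intro power_mono) auto
  also have "\<dots> \<le> (y - x) * (LINT z|lborel. (cmod (g z))\<^sup>2)"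
    using integral_Ioc_le_sqrt[OF _ xy] g by (simp add: L2_iff)
  finally show "cmod (LINT z:{x<..y}|lborel. g z) ^ 2 \<le> (y - x) * (LINT z|lborel. (cmod (g z))\<^sup>2)" .
qed

lemma continuous_of_increment_sq:
  fixes F :: "real \<Rightarrow> 'a::real_normed_vector"
  assumes "\<And>x y. x \<le> y \<Longrightarrow> (norm (F y - F x))\<^sup>2 \<le> (y - x) * K"
  shows "continuous_on UNIV F"
proof -
  have b: "norm (F y - F x) \<le> sqrt (\<bar>y - x\<bar> * K)" for x y
    using assms[of x y] assms[of y x]
    by (cases "x \<le> y") (auto intro!: real_le_rsqrt simp: norm_minus_commute)
  have "(F \<longlongrightarrow> F x) (at x)" for x
  proof (rule Lim_null[THEN iffD2], rule Lim_null_comparison)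
    show "\<forall>\<^sub>F y in at x. norm (F y - F x) \<le> sqrt (\<bar>y - x\<bar> * K)" using b by simp
    have "((\<lambda>y. sqrt (\<bar>y - x\<bar> * K)) \<longlongrightarrow> sqrt (\<bar>x - x\<bar> * K)) (at x)" by (intro tendsto_intros)
    then show "((\<lambda>y. sqrt (\<bar>y - x\<bar> * K)) \<longlongrightarrow> 0) (at x)" by simp
  qed
  then show ?thesis by (simp add: continuous_on_def)
qed

lemma continuous_of_L2_increment:
  fixes F :: "real \<Rightarrow> complex"
  assumes "g \<in> L2" "\<And>x y. x \<le> y \<Longrightarrow> F y - F x = (LINT z:{x<..y}|lborel. g z)"
  shows "continuous_on UNIV F"
  using increment_sq_le(1)[OF assms(1)] assms(2)
  by (intro continuous_of_increment_sq[where K = "LINT z|lborel. (cmod (g z))\<^sup>2"]) simp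

lemma continuous_set_integrable_Ioc:
  fixes F :: "real \<Rightarrow> 'a::{banach, second_countable_topology}"
  assumes "continuous_on UNIV F"
  shows "set_integrable lborel {x<..y} F"
proof -
  have "set_integrable lborel {x..y} F"
    unfolding set_integrable_def
    by (intro borel_integrable_compact continuous_on_subset[OF assms]) auto
  then show ?thesis by (rule set_integrable_subset) auto
qed

section \<open>Product rule and integration by parts against test functions\<close>

lemma deriv_bound_increment:
  fixes \<phi> :: "real \<Rightarrow> real"
  assumes "smooth \<phi>" "\<And>x. \<bar>deriv \<phi> x\<bar> \<le> B"
  shows "\<bar>\<phi> y - \<phi> x\<bar> \<le> B * \<bar>y - x\<bar>"
  using field_differentiable_bound[of UNIV \<phi> "deriv \<phi>" B y x]
    smooth_has_derivative[OF assms(1)] assms(2)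
  by (auto simp: has_field_derivative_at_within)

lemma deriv_integral_Ioc:
  fixes \<phi> :: "real \<Rightarrow> real"
  assumes \<phi>: "smooth \<phi>" and xy: "x \<le> y"
  shows "(LINT z:{x<..y}|lborel. deriv \<phi> z) = \<phi> y - \<phi> x"
proof -
  have c: "continuous_on UNIV (deriv \<phi>)"
    using smooth_differentiable[OF smooth_deriv[OF \<phi>]]
    by (metis differentiable_imp_continuous_within continuous_at_imp_continuous_on)
  have "(LINT z:{x..y}|lborel. deriv \<phi> z) = \<phi> y - \<phi> x"
    unfolding set_lebesgue_integral_def
    using xy smooth_has_derivative[OF \<phi>] continuous_on_subset[OF c]
    by (intro integral_FTC_atLeastAtMost)
      (auto simp: has_real_derivative_iff_has_vector_derivative has_vector_derivative_at_within)
  moreover have "(LINT z:{x..y}|lborel. deriv \<phi> z) = (LINT z:{x<..y}|lborel. deriv \<phi> z)"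
  proof (rule set_integral_cong_set)
    show "AE z in lborel. (z \<in> {x<..y}) = (z \<in> {x..y})"
      using AE_lborel_singleton[of x] by eventually_elim auto
  qed (use borel_measurable_continuous_onI[OF c] in \<open>auto simp: set_borel_measurable_def\<close>)
  ultimately show ?thesis by simp
qed

text \<open>Almost everywhere differentiability of F is bypassed. The defect \<open>D\<close> of the
  identity is additive over adjacent intervals, and freezing \<phi> at the right end and F at the
  left end bounds it by the length times an additive quantity, so
  \<open>subadditive_interval_nonpos\<close> makes it vanish.\<close>

lemma product_rule_Ioc:
  fixes F g :: "real \<Rightarrow> complex"
  assumes \<phi>: "test_function \<phi>" and g: "g \<in> L2"
    and F: "\<And>x y. x \<le> y \<Longrightarrow> F y - F x = (LINT z:{x<..y}|lborel. g z)" and ab: "a \<le> b"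
  shows "\<phi> b *\<^sub>R F b - \<phi> a *\<^sub>R F a = (LINT z:{a<..b}|lborel. deriv \<phi> z *\<^sub>R F z + \<phi> z *\<^sub>R g z)"
proof -
  let ?I = "\<lambda>h x y. LINT z:{x<..y}|lborel. h z"
  have sm: "smooth \<phi>" using \<phi> test_function_iff by blast
  obtain B where B: "0 \<le> B" "\<And>x. \<bar>deriv \<phi> x\<bar> \<le> B"
    using test_function_bounded[OF test_function_deriv[OF \<phi>]] by metis
  have cF: "continuous_on UNIV F" using continuous_of_L2_increment[OF g F] .
  have c\<phi>: "continuous_on UNIV \<phi>" "continuous_on UNIV (deriv \<phi>)"
    using test_function_continuous \<phi> test_function_deriv by blast+
  have [measurable]: "g \<in> borel_measurable borel" using g by (simp add: L2_iff)
  have int: "set_integrable lborel {x<..y} (\<lambda>z. \<phi> z *\<^sub>R g z)" for x y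
    using test_function_scaleR_integrable[OF \<phi> L2_set_integrable[OF g]]
    by (simp add: set_integrable_def integrable_mult_indicator del: scaleR_scaleR)
  have int': "set_integrable lborel {x<..y} (\<lambda>z. deriv \<phi> z *\<^sub>R F z)" for x y
    using c\<phi> cF by (intro continuous_set_integrable_Ioc continuous_intros)
  have ig: "set_integrable lborel {x<..y} g" for x y using L2_set_integrable[OF g] .
  have ig': "set_integrable lborel {x<..y} (\<lambda>z. cmod (g z))" for x y
    using sq_integrable_imp_set_integrable g by (auto simp: L2_iff)
  have i1: "set_integrable lborel {x<..y} (deriv \<phi>)" for x y
    using c\<phi> by (intro continuous_set_integrable_Ioc)
  define D where "D x y = \<phi> y *\<^sub>R F y - \<phi> x *\<^sub>R F x - ?I (\<lambda>z. deriv \<phi> z *\<^sub>R F z + \<phi> z *\<^sub>R g z) x y" for x y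
  have "cmod (D a b) \<le> 0"
  proof (rule subadditive_interval_nonpos[where S = "\<lambda>x y. cmod (D x y)" and
        \<omega> = "\<lambda>x y. 2 * B * ?I (\<lambda>z. cmod (g z)) x y", OF _ _ _ ab])
    fix x y z :: real assume *: "x \<le> y" "y \<le> z"
    have "D x z = D x y + D y z"
      unfolding D_def using integral_Ioc_combine[OF set_integral_add(1)[OF int' int] *] by simp
    then show "cmod (D x z) \<le> cmod (D x y) + cmod (D y z)" by (simp add: norm_triangle_ineq)
    show "2 * B * ?I (\<lambda>z. cmod (g z)) x z = 2 * B * ?I (\<lambda>z. cmod (g z)) x y + 2 * B * ?I (\<lambda>z. cmod (g z)) y z"
      using integral_Ioc_combine[OF ig' *] by (simp add: algebra_simps)
  next
    fix x y :: real assume xy: "x \<le> y"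
    define W where "W = ?I (\<lambda>z. cmod (g z)) x y"
    have "\<phi> y *\<^sub>R F y - \<phi> x *\<^sub>R F x = \<phi> y *\<^sub>R (F y - F x) + (\<phi> y - \<phi> x) *\<^sub>R F x"
      by (simp add: algebra_simps)
    also have "\<dots> = \<phi> y *\<^sub>R ?I g x y + ?I (deriv \<phi>) x y *\<^sub>R F x"
      using F[OF xy] deriv_integral_Ioc[OF sm xy] by simp
    also have "\<dots> = ?I (\<lambda>z. \<phi> y *\<^sub>R g z) x y + ?I (\<lambda>z. deriv \<phi> z *\<^sub>R F x) x y"
      using Bochner_Integration.integral_scaleR_left[of "F x" lborel "\<lambda>z. indicat_real {x<..y} z *\<^sub>R deriv \<phi> z"]
        i1[of x y]
      by (simp add: set_lebesgue_integral_def set_integrable_def)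
    also have "\<dots> = ?I (\<lambda>z. \<phi> y *\<^sub>R g z + deriv \<phi> z *\<^sub>R F x) x y"
      using ig i1 by (subst set_integral_add) auto
    finally have "D x y = ?I (\<lambda>z. (\<phi> y *\<^sub>R g z + deriv \<phi> z *\<^sub>R F x) - (deriv \<phi> z *\<^sub>R F z + \<phi> z *\<^sub>R g z)) x y"
      unfolding D_def using ig i1 int int' by (subst set_integral_diff) auto
    then have "cmod (D x y) \<le> ?I (\<lambda>z. cmod ((\<phi> y *\<^sub>R g z + deriv \<phi> z *\<^sub>R F x) - (deriv \<phi> z *\<^sub>R F z + \<phi> z *\<^sub>R g z))) x y"
      using integral_norm_bound[of lborel "\<lambda>z. indicat_real {x<..y} z *\<^sub>R ((\<phi> y *\<^sub>R g z + deriv \<phi> z *\<^sub>R F x) - (deriv \<phi> z *\<^sub>R F z + \<phi> z *\<^sub>R g z))"]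
      by (simp add: set_lebesgue_integral_def)
    also have "\<dots> \<le> ?I (\<lambda>z. B * (y - x) * cmod (g z) + B * W) x y"
    proof (rule set_integral_mono)
      have "set_integrable lborel {x<..y} (\<lambda>z. (\<phi> y *\<^sub>R g z + deriv \<phi> z *\<^sub>R F x) - (deriv \<phi> z *\<^sub>R F z + \<phi> z *\<^sub>R g z))"
        using ig i1 int int' by (intro set_integral_diff(1) set_integral_add(1)) auto
      then show "set_integrable lborel {x<..y} (\<lambda>z. cmod ((\<phi> y *\<^sub>R g z + deriv \<phi> z *\<^sub>R F x) - (deriv \<phi> z *\<^sub>R F z + \<phi> z *\<^sub>R g z)))"
        unfolding set_integrable_def by (drule_tac integrable_norm) simp
      show "set_integrable lborel {x<..y} (\<lambda>z. B * (y - x) * cmod (g z) + B * W)"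
        using ig' continuous_set_integrable_Ioc[OF continuous_on_const] by (intro set_integral_add(1)) auto
      fix z assume z: "z \<in> {x<..y}"
      have "(\<phi> y *\<^sub>R g z + deriv \<phi> z *\<^sub>R F x) - (deriv \<phi> z *\<^sub>R F z + \<phi> z *\<^sub>R g z)
        = (\<phi> y - \<phi> z) *\<^sub>R g z - deriv \<phi> z *\<^sub>R (F z - F x)" by (simp add: algebra_simps)
      then have "cmod ((\<phi> y *\<^sub>R g z + deriv \<phi> z *\<^sub>R F x) - (deriv \<phi> z *\<^sub>R F z + \<phi> z *\<^sub>R g z))
        \<le> \<bar>\<phi> y - \<phi> z\<bar> * cmod (g z) + \<bar>deriv \<phi> z\<bar> * cmod (F z - F x)"
        by (metis norm_triangle_ineq4 norm_scaleR)
      also have "\<dots> \<le> (B * (y - x)) * cmod (g z) + B * W"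
      proof (intro add_mono mult_mono)
        have "\<bar>\<phi> y - \<phi> z\<bar> \<le> B * \<bar>y - z\<bar>" using deriv_bound_increment[OF sm B(2)] .
        also have "\<dots> \<le> B * (y - x)" using z B by (intro mult_left_mono) auto
        finally show "\<bar>\<phi> y - \<phi> z\<bar> \<le> B * (y - x)" .
        have "cmod (F z - F x) \<le> ?I (\<lambda>z. cmod (g z)) x z"
          using z increment_sq_le(2)[OF g, of x z] F[of x z] by auto
        also have "\<dots> \<le> W"
          unfolding W_def using integral_Ioc_combine[OF ig', of x z y] z
          by (auto simp: set_lebesgue_integral_def)
        finally show "cmod (F z - F x) \<le> W" .
      qed (use B xy in auto)
      finally show "cmod ((\<phi> y *\<^sub>R g z + deriv \<phi> z *\<^sub>R F x) - (deriv \<phi> z *\<^sub>R F z + \<phi> z *\<^sub>R g z))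
        \<le> B * (y - x) * cmod (g z) + B * W" .
    qed
    also have "\<dots> = ?I (\<lambda>z. B * (y - x) * cmod (g z)) x y + ?I (\<lambda>_. B * W) x y"
      using ig' continuous_set_integrable_Ioc[OF continuous_on_const] by (subst set_integral_add) auto
    also have "\<dots> = (y - x) * (2 * B * W)"
      using xy by (simp add: W_def) (simp add: set_lebesgue_integral_def algebra_simps)
    finally show "cmod (D x y) \<le> (y - x) * (2 * B * ?I (\<lambda>z. cmod (g z)) x y)" by (simp add: W_def)
  qed
  then show ?thesis by (simp add: D_def)
qed

lemma integral_supported_Ioc:
  fixes f :: "real \<Rightarrow> 'a::{banach, second_countable_topology}"
  assumes "\<And>x. R < \<bar>x\<bar> \<Longrightarrow> f x = 0"
  shows "(LINT x|lborel. f x) = (LINT x:{-R-1<..R+1}|lborel. f x)"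
  unfolding set_lebesgue_integral_def
  by (intro Bochner_Integration.integral_cong) (use assms in \<open>auto simp: indicator_def abs_if split: if_splits\<close>)

text \<open>The product rule is applied on an interval reaching beyond the support of the test
  function, where both boundary terms are zero.\<close>

lemma has_weak_derivative_primitive:
  fixes F g :: "real \<Rightarrow> complex"
  assumes g: "g \<in> L2" and F: "\<And>x y. x \<le> y \<Longrightarrow> F y - F x = (LINT z:{x<..y}|lborel. g z)"
  shows "has_weak_derivative F g"
  unfolding has_weak_derivative_def
proof (intro allI impI)
  fix \<phi> assume \<phi>: "test_function \<phi>"
  obtain R0 where R0: "\<And>x. R0 < \<bar>x\<bar> \<Longrightarrow> \<phi> x = 0" using \<phi> unfolding test_function_iff by metis
  obtain R1 where R1: "\<And>x. R1 < \<bar>x\<bar> \<Longrightarrow> deriv \<phi> x = 0"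
    using test_function_deriv[OF \<phi>] unfolding test_function_iff by metis
  define R where "R = max 0 (max R0 R1)"
  have R: "\<phi> x = 0" "deriv \<phi> x = 0" if "R < \<bar>x\<bar>" for x using R0 R1 that by (auto simp: R_def)
  have "R \<ge> 0" by (simp add: R_def)
  have cF: "continuous_on UNIV F" using continuous_of_L2_increment[OF g F] .
  have [measurable]: "g \<in> borel_measurable borel" "F \<in> borel_measurable borel"
    using g borel_measurable_continuous_onI[OF cF] by (auto simp: L2_iff)
  have i: "integrable lborel (\<lambda>x. deriv \<phi> x *\<^sub>R F x)" "integrable lborel (\<lambda>x. \<phi> x *\<^sub>R g x)"
    using test_function_scaleR_integrable[OF test_function_deriv[OF \<phi>] continuous_set_integrable_Ioc[OF cF]]
      test_function_scaleR_integrable[OF \<phi> L2_set_integrable[OF g]] by auto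
  have "(LINT x|lborel. deriv \<phi> x *\<^sub>R F x) + (LINT x|lborel. \<phi> x *\<^sub>R g x)
     = (LINT x|lborel. deriv \<phi> x *\<^sub>R F x + \<phi> x *\<^sub>R g x)" using i by simp
  also have "\<dots> = (LINT x:{-R-1<..R+1}|lborel. deriv \<phi> x *\<^sub>R F x + \<phi> x *\<^sub>R g x)"
    using R by (intro integral_supported_Ioc) auto
  also have "\<dots> = \<phi> (R+1) *\<^sub>R F (R+1) - \<phi> (-R-1) *\<^sub>R F (-R-1)"
    using product_rule_Ioc[OF \<phi> g F, of "-R-1" "R+1"] \<open>R \<ge> 0\<close> by simp
  also have "\<dots> = 0" using R(1)[of "R+1"] R(1)[of "-R-1"] \<open>R \<ge> 0\<close> by simp
  finally show "(LINT x|lborel. deriv \<phi> x *\<^sub>R F x) = - (LINT x|lborel. \<phi> x *\<^sub>R g x)"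
    by (simp add: add_eq_0_iff2)
qed

section \<open>Weak derivatives and absolutely continuous representatives\<close>

text \<open>The du Bois-Reymond lemma. A test function \<rho> of integral 1 fixes the candidate
  constant. A smooth approximation of the indicator of (a, b] minus (b - a) \<rho> has integral 0,
  hence is the derivative of a test function; in the limit, k and the constant have the same
  integral over (a, b].\<close>

lemma AE_const_if_weak_derivative_zero:
  fixes k :: "real \<Rightarrow> complex"
  assumes k: "\<And>x y. set_integrable lborel {x<..y} k" and [measurable]: "k \<in> borel_measurable borel"
    and zero: "\<And>\<phi>. test_function \<phi> \<Longrightarrow> (LINT x|lborel. deriv \<phi> x *\<^sub>R k x) = 0"
  shows "\<exists>c. AE x in lborel. k x = c"
proof -
  obtain S s where S: "\<And>x. (S has_real_derivative s x) (at x)" and s: "smooth s"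
    and S0: "\<And>x. x \<le> 0 \<Longrightarrow> S x = 0" and s0: "\<And>x. x \<le> 0 \<Longrightarrow> s x = 0"
    and s1: "\<And>x. 1 \<le> x \<Longrightarrow> s x = 1" and s01: "\<And>x. 0 \<le> s x" "\<And>x. s x \<le> 1"
    using smooth_step by metis
  have smS: "smooth S" using smooth_antiderivative[OF S s] .
  \<comment> \<open>Past 1 the slope of \<open>S\<close> is 1, so two copies of it shifted against
    each other differ there by a constant. This is what gives \<phi> below compact support.\<close>
  have S1: "S x = S 1 + (x - 1)" if "1 \<le> x" for x
  proof -
    have D: "((\<lambda>x. S x - x) has_real_derivative 0) (at y)" if "1 \<le> y" for y
      using DERIV_diff[OF S[of y] DERIV_ident] s1[OF that] by simp
    have "S x - x \<le> S 1 - 1"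
      by (rule DERIV_nonpos_imp_nonincreasing[OF that]) (use D in blast)
    moreover have "S 1 - 1 \<le> S x - x"
      by (rule DERIV_nonneg_imp_nondecreasing[OF that]) (use D in blast)
    ultimately show ?thesis by simp
  qed
  have [measurable]: "s \<in> borel_measurable borel"
    using smooth_differentiable[OF s]
    by (intro borel_measurable_continuous_onI continuous_at_imp_continuous_on)
      (metis differentiable_imp_continuous_within)
  have ds0: "deriv s x = 0" if "1 < \<bar>x\<bar>" for x
  proof -
    have "((\<lambda>_. s x) has_real_derivative deriv s x) (at x)"
    proof (rule has_field_derivative_transform_within_open[OF smooth_has_derivative[OF s]])
      show "open {y. 1 < \<bar>y\<bar> \<and> 0 < x * y}"
        by (intro open_Collect_conj open_Collect_less continuous_intros)
      show "x \<in> {y. 1 < \<bar>y\<bar> \<and> 0 < x * y}" using that by (auto simp: zero_less_mult_iff)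
      show "s y = s x" if "y \<in> {y. 1 < \<bar>y\<bar> \<and> 0 < x * y}" for y
        using that \<open>1 < \<bar>x\<bar>\<close> s0[of x] s0[of y] s1[of x] s1[of y]
        by (auto simp: zero_less_mult_iff)
    qed
    then show ?thesis using DERIV_unique[OF _ DERIV_const] by metis
  qed
  define \<rho> where "\<rho> = deriv s"
  have \<rho>: "test_function \<rho>"
    unfolding \<rho>_def test_function_iff using smooth_deriv[OF s] ds0 by blast
  have i\<rho>: "integrable lborel (\<lambda>x. \<rho> x *\<^sub>R k x)"
    using test_function_scaleR_integrable[OF \<rho> k] by simp
  define c where "c = (LINT x|lborel. \<rho> x *\<^sub>R k x)"
  have main: "(LINT x:{a<..b}|lborel. k x) = (b - a) *\<^sub>R c" if ab: "a < b" for a b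
  proof -
    \<comment> \<open>Two steps of the same steepness, rising at a and at b. They have the same
      shape, so the integral of \<psi> is b - a exactly for every n and not only in the
      limit.\<close>
    define \<psi> where "\<psi> n x = s (real (Suc n) * (x - a)) - s (real (Suc n) * (x - b))" for n x
    have \<psi>0: "\<psi> n x = 0" if "x \<notin> {a<..b+1}" for n x
    proof (cases "x \<le> a")
      case True
      then show ?thesis using ab s0 by (simp add: \<psi>_def mult_le_0_iff)
    next
      case False
      then have x: "b + 1 < x" using that by auto
      have "1 * 1 \<le> real (Suc n) * (x - b)" using x by (intro mult_mono) auto
      moreover have "1 * 1 \<le> real (Suc n) * (x - a)" using x ab by (intro mult_mono) auto
      ultimately show ?thesis by (simp add: \<psi>_def s1)
    qed
    have \<psi>b: "\<bar>\<psi> n x\<bar> \<le> 1" for n x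
      unfolding \<psi>_def using s01[of "real (Suc n) * (x - a)"] s01[of "real (Suc n) * (x - b)"] by linarith
    have [measurable]: "\<psi> n \<in> borel_measurable borel" for n unfolding \<psi>_def[abs_def] by measurable
    let ?d = "\<lambda>x. norm (indicat_real {a<..b+1} x *\<^sub>R k x)"
    have id: "integrable lborel ?d" using k[of a "b+1"] by (simp add: set_integrable_def integrable_norm del: norm_scaleR)
    have bd: "norm (\<psi> n x *\<^sub>R k x) \<le> ?d x" for n x
      using \<psi>0[of x n] \<psi>b[of n x] by (cases "x \<in> {a<..b+1}") (auto simp: mult_left_le_one_le)
    have lim: "(\<lambda>n. \<psi> n x *\<^sub>R k x) \<longlonglongrightarrow> indicat_real {a<..b} x *\<^sub>R k x" for x
    proof -
      have st: "(\<lambda>n. s (real (Suc n) * (x - e))) \<longlonglongrightarrow> (if e < x then 1 else 0)" for e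
      proof (cases "e < x")
        case True
        obtain N where N: "1 / (x - e) < real N" using reals_Archimedean2 by blast
        have "s (real (Suc n) * (x - e)) = 1" if "n \<ge> N" for n
        proof (rule s1)
          have "1 / (x - e) \<le> real (Suc n)" using N that by linarith
          then show "1 \<le> real (Suc n) * (x - e)" using True by (simp add: divide_simps split: if_splits)
        qed
        then show ?thesis using True
          by (intro tendsto_eventually) (auto simp: eventually_sequentially)
      next
        case False
        then show ?thesis using s0 by (simp add: mult_le_0_iff)
      qed
      have "(\<lambda>n. \<psi> n x) \<longlonglongrightarrow> (if a < x then 1 else 0) - (if b < x then 1 else 0)"
        unfolding \<psi>_def by (intro tendsto_diff st)
      also have "(if a < x then 1 else 0) - (if b < x then 1 else 0) = indicat_real {a<..b} x"
        using ab by (auto simp: indicator_def)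
      finally show ?thesis by (intro tendsto_scaleR tendsto_const)
    qed
    have i\<psi>: "integrable lborel (\<lambda>x. \<psi> n x *\<^sub>R k x)" for n
      by (rule Bochner_Integration.integrable_bound[OF id]) (use bd in auto)
    have "(\<lambda>n. LINT x|lborel. \<psi> n x *\<^sub>R k x) \<longlonglongrightarrow> (LINT x|lborel. indicat_real {a<..b} x *\<^sub>R k x)"
      by (rule integral_dominated_convergence[where w = ?d]) (use id lim bd in auto)
    moreover have "(LINT x|lborel. \<psi> n x *\<^sub>R k x) = (b - a) *\<^sub>R c" for n
    proof -
      define \<nu> where "\<nu> = real (Suc n)"
      have \<nu>: "1 \<le> \<nu>" by (simp add: \<nu>_def)
      \<comment> \<open>The explicit primitive of \<psi> minus (b - a) \<rho>. Far to the right the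
        two \<open>S\<close> terms contribute b - a, which the last term cancels because s = 1
        there; far to the left all terms vanish.\<close>
      define \<phi> where "\<phi> x = (1 / \<nu> * S (\<nu> * x + (- \<nu> * a)) + (- 1 / \<nu>) * S (\<nu> * x + (- \<nu> * b)))
          + (- (b - a)) * s x" for x
      have sm\<phi>: "smooth \<phi>"
        unfolding \<phi>_def
        by (intro smooth_alg_imp_smooth[OF smooth_alg.add[OF smooth_alg.add[OF
            smooth_alg.mult[OF smooth_alg.const smooth_alg.affine]
            smooth_alg.mult[OF smooth_alg.const smooth_alg.affine]]
            smooth_alg.mult[OF smooth_alg.const smooth_alg.base[OF s]]]] smooth_alg.base smS)
      have \<phi>0: "\<phi> x = 0" if x: "\<bar>a\<bar> + \<bar>b\<bar> + 1 < \<bar>x\<bar>" for x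
      proof (cases "x \<le> 0")
        case True
        have "\<nu> * x + (- \<nu> * a) = \<nu> * (x - a)" "\<nu> * x + (- \<nu> * b) = \<nu> * (x - b)"
          by (simp_all add: algebra_simps)
        moreover have "\<nu> * (x - a) \<le> 0" "\<nu> * (x - b) \<le> 0"
          using x True \<nu> by (auto intro!: mult_nonneg_nonpos)
        ultimately show ?thesis using True by (simp only: \<phi>_def S0 s0)
      next
        case False
        have e: "\<nu> * x + (- \<nu> * a) = \<nu> * (x - a)" "\<nu> * x + (- \<nu> * b) = \<nu> * (x - b)"
          by (simp_all add: algebra_simps)
        have "1 \<le> \<nu> * d" if "1 \<le> d" for d
          using mult_mono[of 1 \<nu> 1 d] \<nu> that by simp
        then have "1 \<le> \<nu> * (x - a)" "1 \<le> \<nu> * (x - b)" using x False by auto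
        then have "S (\<nu> * (x - a)) = S 1 + (\<nu> * (x - a) - 1)" "S (\<nu> * (x - b)) = S 1 + (\<nu> * (x - b) - 1)"
          using S1[of "\<nu> * (x - a)"] S1[of "\<nu> * (x - b)"] by blast+
        moreover have "s x = 1" using x False by (intro s1) auto
        ultimately show ?thesis unfolding \<phi>_def e using \<nu> by (simp add: field_simps)
      qed
      have t\<phi>: "test_function \<phi>" unfolding test_function_iff using sm\<phi> \<phi>0 by blast
      have \<psi>\<nu>: "\<psi> n x = s (\<nu> * (x - a)) - s (\<nu> * (x - b))" for x
        by (simp only: \<psi>_def \<nu>_def)
      have d\<phi>: "deriv \<phi> x = \<psi> n x - (b - a) * \<rho> x" for x
      proof (rule DERIV_imp_deriv)
        have a: "((\<lambda>x. S (\<nu> * x + (- \<nu> * e))) has_real_derivative s (\<nu> * x + (- \<nu> * e)) * \<nu>) (at x)" for e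
          by (rule DERIV_chain2[OF S]) (auto intro!: derivative_eq_intros)
        show "(\<phi> has_real_derivative \<psi> n x - (b - a) * \<rho> x) (at x)"
          unfolding \<phi>_def
          by (rule DERIV_cong[OF DERIV_add[OF DERIV_add[OF DERIV_cmult[OF a] DERIV_cmult[OF a]]
                  DERIV_cmult[OF smooth_has_derivative[OF s]]]])
            (use \<nu> in \<open>simp add: \<psi>\<nu> \<rho>_def right_diff_distrib left_diff_distrib\<close>)
      qed
      have "0 = (LINT x|lborel. deriv \<phi> x *\<^sub>R k x)" by (rule zero[OF t\<phi>, symmetric])
      also have "\<dots> = (LINT x|lborel. \<psi> n x *\<^sub>R k x - (b - a) *\<^sub>R (\<rho> x *\<^sub>R k x))"
        unfolding d\<phi> by (intro Bochner_Integration.integral_cong) (auto simp: scaleR_diff_left)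
      also have "\<dots> = (LINT x|lborel. \<psi> n x *\<^sub>R k x) - (b - a) *\<^sub>R c"
        unfolding c_def
        by (subst Bochner_Integration.integral_diff[OF i\<psi> Bochner_Integration.integrable_scaleR_right[OF i\<rho>]])
          (simp only: Bochner_Integration.integral_scaleR_right)
      finally show ?thesis by simp
    qed
    ultimately have "(\<lambda>n. (b - a) *\<^sub>R c) \<longlonglongrightarrow> (LINT x|lborel. indicat_real {a<..b} x *\<^sub>R k x)" by simp
    from LIMSEQ_unique[OF tendsto_const this] show ?thesis by (simp add: set_lebesgue_integral_def)
  qed
  have "AE x in lborel. k x - c = 0"
  proof (rule AE_zero_if_integral_Ioc_zero)
    have ic: "set_integrable lborel {x<..y} (\<lambda>_. c)" for x y :: real
      by (intro continuous_set_integrable_Ioc continuous_on_const)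
    show "set_integrable lborel {x<..y} (\<lambda>x. k x - c)" for x y
      by (intro set_integral_diff(1) k ic)
    show "(LINT z:{x<..y}|lborel. k z - c) = 0" if "x < y" for x y
    proof -
      have "(LINT z:{x<..y}|lborel. c) = (y - x) *\<^sub>R c"
        using that Bochner_Integration.integral_scaleR_left[of c lborel "indicat_real {x<..y}"]
        by (simp add: set_lebesgue_integral_def integrable_indicator_iff)
      then show ?thesis using set_integral_diff(2)[OF k ic] main[OF that] by simp
    qed
  qed
  then show ?thesis by (intro exI[of _ c]) (auto elim!: eventually_mono)
qed

text \<open>The line has infinite measure.\<close>

lemma L2_const_zero:
  assumes "AE x in lborel. f x = c" "f \<in> L2" shows "c = 0"
proof -
  have "integrable lborel (\<lambda>x::real. (cmod c)\<^sup>2)"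
    using L2_AE_cong[OF assms(2,1)] by (simp add: L2_def)
  then have "(\<integral>\<^sup>+x. ennreal (norm ((cmod c)\<^sup>2)) \<partial>(lborel :: real measure)) < \<infinity>"
    unfolding integrable_iff_bounded by blast
  then show ?thesis
    by (auto simp: ennreal_mult_top ennreal_zero_less_mult_iff split: if_splits)
qed

text \<open>An element of H^1 through its absolutely continuous representative F and its derivative
  g. The increment identity holds at every pair of points, so values such as \<open>F 0\<close> are
  meaningful.\<close>

definition ac_pair :: "(real \<Rightarrow> complex) \<Rightarrow> (real \<Rightarrow> complex) \<Rightarrow> bool" where
  "ac_pair F g \<longleftrightarrow> F \<in> L2 \<and> g \<in> L2 \<and> (\<forall>x y. x \<le> y \<longrightarrow> F y - F x = (LINT z:{x<..y}|lborel. g z))"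

lemma ac_pairD:
  assumes "ac_pair F g"
  shows "F \<in> L2" "g \<in> L2" "x \<le> y \<Longrightarrow> F y - F x = (LINT z:{x<..y}|lborel. g z)"
    "F \<in> borel_measurable borel" "g \<in> borel_measurable borel"
    "integrable lborel (\<lambda>x. (cmod (F x))\<^sup>2)" "integrable lborel (\<lambda>x. (cmod (g x))\<^sup>2)"
  using assms by (auto simp: ac_pair_def L2_def)

text \<open>The difference of two weak derivatives annihilates every test function, in particular
  derivatives of test functions, so it is constant almost everywhere; being square integrable, it is
  zero.\<close>

lemma weak_derivative_AE_unique:
  assumes "f \<in> L2" "g \<in> L2" "h \<in> L2" "has_weak_derivative f g" "has_weak_derivative f h"
  shows "AE x in lborel. g x = h x"
proof -
  let ?k = "\<lambda>x. g x - h x"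
  have k: "?k \<in> L2" using L2_diff assms by blast
  have "\<exists>c. AE x in lborel. ?k x = c"
  proof (rule AE_const_if_weak_derivative_zero)
    show "set_integrable lborel {x<..y} ?k" for x y using L2_set_integrable[OF k] .
    show "?k \<in> borel_measurable borel" using k by (simp add: L2_iff)
    fix \<phi> assume "test_function \<phi>"
    then have \<psi>: "test_function (deriv \<phi>)" by (rule test_function_deriv)
    have i: "integrable lborel (\<lambda>x. deriv \<phi> x *\<^sub>R u x)" if "u \<in> L2" for u
      using test_function_scaleR_integrable[OF \<psi> L2_set_integrable[OF that]] that by (simp add: L2_iff)
    have "(LINT x|lborel. deriv \<phi> x *\<^sub>R ?k x) = (LINT x|lborel. deriv \<phi> x *\<^sub>R g x) - (LINT x|lborel. deriv \<phi> x *\<^sub>R h x)"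
      using i[OF assms(2)] i[OF assms(3)] by (simp add: scaleR_diff_right)
    also have "\<dots> = 0"
      using assms(4,5)[unfolded has_weak_derivative_def, rule_format, OF \<psi>] by simp
    finally show "(LINT x|lborel. deriv \<phi> x *\<^sub>R ?k x) = 0" .
  qed
  then obtain c where c: "AE x in lborel. ?k x = c" by blast
  have "c = 0" by (rule L2_const_zero[OF c k])
  from c[unfolded this] show ?thesis by eventually_elim simp
qed

text \<open>Subtracting a primitive of g leaves a function with weak derivative zero; the resulting
  constant is absorbed into the representative.\<close>

lemma weak_derivative_imp_ac_pair:
  assumes f: "f \<in> L2" and g: "g \<in> L2" and w: "has_weak_derivative f g"
  obtains F where "ac_pair F g" "AE x in lborel. f x = F x"
proof -
  note pd = primitive_diff[OF L2_set_integrable[OF g]]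
  have cG: "continuous_on UNIV (primitive g)" using continuous_of_L2_increment[OF g pd] .
  have [measurable]: "f \<in> borel_measurable borel" "primitive g \<in> borel_measurable borel"
    using f borel_measurable_continuous_onI[OF cG] by (auto simp: L2_iff)
  let ?k = "\<lambda>x. f x - primitive g x"
  have "\<exists>c. AE x in lborel. ?k x = c"
  proof (rule AE_const_if_weak_derivative_zero)
    show "set_integrable lborel {x<..y} ?k" for x y
      using L2_set_integrable[OF f] continuous_set_integrable_Ioc[OF cG] by (rule set_integral_diff(1))
    fix \<phi> assume \<phi>: "test_function \<phi>"
    have "integrable lborel (\<lambda>x. deriv \<phi> x *\<^sub>R f x)" "integrable lborel (\<lambda>x. deriv \<phi> x *\<^sub>R primitive g x)"
      using test_function_scaleR_integrable[OF test_function_deriv[OF \<phi>] L2_set_integrable[OF f]]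
        test_function_scaleR_integrable[OF test_function_deriv[OF \<phi>] continuous_set_integrable_Ioc[OF cG]]
      by simp_all
    then have "(LINT x|lborel. deriv \<phi> x *\<^sub>R ?k x) = (LINT x|lborel. deriv \<phi> x *\<^sub>R f x) - (LINT x|lborel. deriv \<phi> x *\<^sub>R primitive g x)"
      by (simp add: scaleR_diff_right)
    also have "\<dots> = 0"
      using w has_weak_derivative_primitive[OF g pd] \<phi> unfolding has_weak_derivative_def by simp
    finally show "(LINT x|lborel. deriv \<phi> x *\<^sub>R ?k x) = 0" .
  qed simp
  then obtain c where c: "AE x in lborel. ?k x = c" by blast
  define F where "F x = primitive g x + c" for x
  have ae: "AE x in lborel. f x = F x" using c by eventually_elim (simp add: F_def algebra_simps)
  have "F \<in> borel_measurable borel" unfolding F_def by simp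
  then have "F \<in> L2" using L2_AE_cong[OF f ae] by simp
  then have "ac_pair F g" using g pd by (simp add: ac_pair_def F_def)
  then show ?thesis using ae that by blast
qed

lemma H1_weak_deriv:
  assumes "f \<in> H1"
  shows "f \<in> L2" "weak_deriv f \<in> L2" "has_weak_derivative f (weak_deriv f)"
proof -
  show "f \<in> L2" using assms by (simp add: H1_def)
  have "\<exists>g. g \<in> L2 \<and> has_weak_derivative f g" using assms by (auto simp: H1_def)
  from someI_ex[OF this] show "weak_deriv f \<in> L2" "has_weak_derivative f (weak_deriv f)"
    unfolding weak_deriv_def by auto
qed

lemma H1_imp_ac_pair:
  assumes "f \<in> H1" obtains F where "ac_pair F (weak_deriv f)" "AE x in lborel. f x = F x"
  using weak_derivative_imp_ac_pair H1_weak_deriv[OF assms] by blast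

lemma ac_pair_imp_H1:
  assumes F: "ac_pair F g" and f: "AE x in lborel. f x = F x" and m: "f \<in> borel_measurable borel"
  shows "f \<in> H1" "AE x in lborel. weak_deriv f x = g x"
proof -
  note FD = ac_pairD[OF F]
  have "AE x in lborel. F x = f x" using f by eventually_elim simp
  then have fL: "f \<in> L2" using L2_AE_cong[OF FD(1) _ m] by simp
  have "has_weak_derivative F g" using has_weak_derivative_primitive[OF FD(2) FD(3)] .
  moreover have "(LINT x|lborel. deriv \<phi> x *\<^sub>R f x) = (LINT x|lborel. deriv \<phi> x *\<^sub>R F x)"
    if "test_function \<phi>" for \<phi>
  proof (rule integral_cong_AE)
    have [measurable]: "deriv \<phi> \<in> borel_measurable borel"
      using test_function_continuous[OF test_function_deriv[OF that]] borel_measurable_continuous_onI by blast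
    show "(\<lambda>x. deriv \<phi> x *\<^sub>R f x) \<in> borel_measurable lborel" "(\<lambda>x. deriv \<phi> x *\<^sub>R F x) \<in> borel_measurable lborel"
      using m FD(4) by auto
    show "AE x in lborel. deriv \<phi> x *\<^sub>R f x = deriv \<phi> x *\<^sub>R F x" using f by eventually_elim simp
  qed
  ultimately have w: "has_weak_derivative f g" by (simp add: has_weak_derivative_def)
  then show H: "f \<in> H1" using fL FD(2) by (auto simp: H1_def)
  show "AE x in lborel. weak_deriv f x = g x"
    using weak_derivative_AE_unique[OF fL H1_weak_deriv(2)[OF H] FD(2) H1_weak_deriv(3)[OF H] w] .
qed

lemma ac_pair_upper_grad:
  assumes "ac_pair F g" shows "upper_grad (\<lambda>x. cmod (F x)) (\<lambda>x. cmod (g x))"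
proof -
  have "\<bar>cmod (F y) - cmod (F x)\<bar> \<le> (LINT z:{x<..y}|lborel. cmod (g z))" if "x \<le> y" for x y
    using increment_sq_le(2)[OF ac_pairD(2)[OF assms] that] ac_pairD(3)[OF assms that]
      norm_triangle_ineq3[of "F y" "F x"] by simp
  then show ?thesis using assms by (simp add: upper_grad_def ac_pair_def L2_iff)
qed

text \<open>The Stieltjes measures of N1 and N2 add up to the measure with density h. Each is
  therefore dominated by it and absolutely continuous, and its Radon-Nikodym density lies between 0
  and h.\<close>

lemma interval_measure_le_density:
  fixes N1 N2 H :: "real \<Rightarrow> real"
  assumes mono: "\<And>x y. x \<le> y \<Longrightarrow> N1 x \<le> N1 y" "\<And>x y. x \<le> y \<Longrightarrow> N2 x \<le> N2 y"
    and cont: "continuous_on UNIV N1" "continuous_on UNIV N2"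
    and h: "\<And>x. 0 \<le> h x" "\<And>x y. set_integrable lborel {x<..y} h" and [measurable]: "h \<in> borel_measurable borel"
    and eq: "\<And>x y. x \<le> y \<Longrightarrow> (N1 y - N1 x) + (N2 y - N2 x) = (LINT z:{x<..y}|lborel. h z)"
  shows "\<exists>g. g \<in> borel_measurable borel \<and> (AE x in lborel. 0 \<le> g x \<and> g x \<le> h x) \<and>
    (\<forall>x y. x \<le> y \<longrightarrow> N1 y - N1 x = (LINT z:{x<..y}|lborel. g z))"
proof -
  let ?M = "interval_measure N1" and ?N = "interval_measure N2"
  let ?\<mu> = "\<lambda>A. emeasure ?M A + emeasure ?N A"
  have cr: "continuous (at_right a) N1" "continuous (at_right a) N2" for a
    using cont unfolding continuous_on_eq_continuous_at[OF open_UNIV]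
    by (blast intro: continuous_at_imp_continuous_at_within)+
  have Ioc: "emeasure ?M {a<..b} = ennreal (N1 b - N1 a)" "emeasure ?N {a<..b} = ennreal (N2 b - N2 a)"
    if "a \<le> b" for a b
    using emeasure_interval_measure_Ioc[OF that mono(1) cr(1)]
      emeasure_interval_measure_Ioc[OF that mono(2) cr(2)] by auto
  \<comment> \<open>The sum of the two Stieltjes measures. By \<open>eq\<close> it agrees with the
    measure of density h on half-open intervals, hence on all Borel sets.\<close>
  define K where "K = measure_of UNIV (sets borel) ?\<mu>"
  have sK: "sets K = sets borel" "space K = UNIV"
    by (auto simp: K_def sets.sigma_sets_eq[of borel, simplified])
  have eK: "emeasure K A = ?\<mu> A" if "A \<in> sets borel" for A
  proof (rule emeasure_measure_of[OF K_def])
    show "positive (sets K) ?\<mu>" by (simp add: positive_def)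
    show "countably_additive (sets K) ?\<mu>"
    proof (rule countably_additiveI)
      fix A :: "nat \<Rightarrow> real set" assume A: "range A \<subseteq> sets K" "disjoint_family A"
      have "(\<Sum>i. ?\<mu> (A i)) = (\<Sum>i. emeasure ?M (A i)) + (\<Sum>i. emeasure ?N (A i))"
        by (rule suminf_add[symmetric]) auto
      also have "\<dots> = ?\<mu> (\<Union> (range A))"
        using A by (subst (1 2) suminf_emeasure) (auto simp: sK)
      finally show "(\<Sum>i. ?\<mu> (A i)) = ?\<mu> (\<Union> (range A))" .
    qed
  qed (use that sK in auto)
  have nnI: "(\<integral>\<^sup>+z. ennreal (h z) * indicator {a<..b} z \<partial>lborel) = ennreal (LINT z:{a<..b}|lborel. h z)" for a b
  proof -
    have "(\<integral>\<^sup>+z. ennreal (h z) * indicator {a<..b} z \<partial>lborel) = (\<integral>\<^sup>+z. ennreal (indicat_real {a<..b} z *\<^sub>R h z) \<partial>lborel)"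
      by (intro nn_integral_cong) (auto simp: indicator_def)
    also have "\<dots> = ennreal (LINT z:{a<..b}|lborel. h z)"
      unfolding set_lebesgue_integral_def
      using h by (intro nn_integral_eq_integral) (auto simp: set_integrable_def)
    finally show ?thesis .
  qed
  have dens: "K = density lborel (\<lambda>x. ennreal (h x))"
  proof (rule measure_eqI_generator_eq[where E = "range (\<lambda>(a, b). {a<..b::real})" and \<Omega> = UNIV
        and A = "\<lambda>n. {- real n<..real n}"])
    show "Int_stable (range (\<lambda>(a, b). {a<..b::real}))"
      unfolding Int_stable_def by (auto simp: Int_greaterThanAtMost)
    show "sets K = sigma_sets UNIV (range (\<lambda>(a, b). {a<..b::real}))"
      "sets (density lborel (\<lambda>x. ennreal (h x))) = sigma_sets UNIV (range (\<lambda>(a, b). {a<..b::real}))"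
      by (auto simp: sK borel_sigma_sets_Ioc)
    show "(\<Union>i. {- real i<..real i}) = (UNIV::real set)"
    proof (intro equalityI subsetI UNIV_I)
      fix x :: real
      obtain n where "\<bar>x\<bar> < real n" using reals_Archimedean2 by blast
      then have "x \<in> {- real n<..real n}" by auto
      then show "x \<in> (\<Union>i. {- real i<..real i})" by blast
    qed
    show "emeasure K {- real i<..real i} \<noteq> \<infinity>" for i by (simp add: eK Ioc)
    fix X :: "real set" assume "X \<in> range (\<lambda>(a, b). {a<..b})"
    then obtain a b where X: "X = {a<..b}" by auto
    show "emeasure K X = emeasure (density lborel (\<lambda>x. ennreal (h x))) X"
    proof (cases "a \<le> b")
      case True
      then show ?thesis
        using eq[OF True] mono(1)[OF True] mono(2)[OF True]
        by (simp add: X eK Ioc emeasure_density nnI flip: ennreal_plus)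
    qed (simp add: X)
  qed auto
  have RN: "\<exists>\<rho>\<in>borel_measurable lborel. density lborel \<rho> = L"
    if L: "sets L = sets borel" "\<And>A. A \<in> sets borel \<Longrightarrow> emeasure L A \<le> emeasure K A" for L
  proof (rule sigma_finite_measure.Radon_Nikodym[OF sigma_finite_lborel])
    show "absolutely_continuous lborel L"
      unfolding absolutely_continuous_def
    proof
      fix A :: "real set" assume A: "A \<in> null_sets lborel"
      then have "A \<in> null_sets K"
        unfolding dens using absolutely_continuousI_density[of "\<lambda>x. ennreal (h x)" lborel]
        by (auto simp: absolutely_continuous_def)
      then have "emeasure L A \<le> 0" using L(2)[of A] A by (auto simp: null_sets_def)
      then show "A \<in> null_sets L" using A L by (auto simp: null_sets_def)
    qed
  qed (use L in simp)
  obtain \<rho>1 where r1: "\<rho>1 \<in> borel_measurable lborel" "density lborel \<rho>1 = ?M"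
    using RN[of ?M] by (auto simp: eK)
  obtain \<rho>2 where r2: "\<rho>2 \<in> borel_measurable lborel" "density lborel \<rho>2 = ?N"
    using RN[of ?N] by (auto simp: eK)
  \<comment> \<open>Uniqueness of densities: both sides are densities of \<open>K\<close>. The bound
    of \<rho>1 by h then follows since \<rho>2 is nonnegative.\<close>
  have "AE x in lborel. \<rho>1 x + \<rho>2 x = ennreal (h x)"
  proof (rule sigma_finite_measure.density_unique2[OF sigma_finite_lborel])
    fix A :: "real set" assume A: "A \<in> sets lborel"
    have "(\<integral>\<^sup>+x\<in>A. (\<rho>1 x + \<rho>2 x) \<partial>lborel) = emeasure (density lborel \<rho>1) A + emeasure (density lborel \<rho>2) A"
      using A r1(1) r2(1) by (simp add: emeasure_density nn_integral_add distrib_right)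
    also have "\<dots> = emeasure (density lborel (\<lambda>x. ennreal (h x))) A"
      unfolding r1(2) r2(2) dens[symmetric] using A by (simp add: eK)
    finally show "(\<integral>\<^sup>+x\<in>A. (\<rho>1 x + \<rho>2 x) \<partial>lborel) = (\<integral>\<^sup>+x\<in>A. ennreal (h x) \<partial>lborel)"
      using A by (simp add: emeasure_density)
  qed (use r1 r2 in auto)
  then have le: "AE x in lborel. \<rho>1 x \<le> ennreal (h x)"
    by eventually_elim (metis le_add1 le_iff_add)
  define g where "g x = enn2real (\<rho>1 x)" for x
  have [measurable]: "\<rho>1 \<in> borel_measurable borel" using r1 by simp
  have "AE x in lborel. 0 \<le> g x \<and> g x \<le> h x"
    using le by eventually_elim (auto simp: g_def h intro: enn2real_leI)
  moreover have "N1 y - N1 x = (LINT z:{x<..y}|lborel. g z)" if xy: "x \<le> y" for x y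
  proof -
    have "emeasure (density lborel \<rho>1) {x<..y} = ennreal (N1 y - N1 x)"
      unfolding r1(2) by (rule Ioc(1)[OF xy])
    then have "ennreal (N1 y - N1 x) = (\<integral>\<^sup>+z\<in>{x<..y}. \<rho>1 z \<partial>lborel)"
      using r1(1) by (simp add: emeasure_density)
    also have "\<dots> = (\<integral>\<^sup>+z. ennreal (indicat_real {x<..y} z *\<^sub>R g z) \<partial>lborel)"
    proof (intro nn_integral_cong_AE)
      have "AE z in lborel. \<rho>1 z < top"
        using le by eventually_elim (metis ennreal_less_top le_less_trans)
      then show "AE z in lborel. \<rho>1 z * indicator {x<..y} z = ennreal (indicat_real {x<..y} z *\<^sub>R g z)"
        by eventually_elim (simp add: indicator_def g_def)
    qed
    finally have nn: "(\<integral>\<^sup>+z. ennreal (indicat_real {x<..y} z *\<^sub>R g z) \<partial>lborel) = ennreal (N1 y - N1 x)" by simp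
    show ?thesis
      unfolding set_lebesgue_integral_def
      using nn mono(1)[OF xy] by (subst integral_eq_nn_integral) (auto simp: g_def[abs_def])
  qed
  moreover have "g \<in> borel_measurable borel" unfolding g_def[abs_def] by simp
  ultimately show ?thesis by blast
qed

text \<open>Adding f to, or subtracting it from, a primitive of h gives increasing functions: this
  is exactly the upper gradient inequality. Their sum is twice the primitive, so the first has a
  density between 0 and 2h, and subtracting h from it leaves a derivative of f between -h and
  h.\<close>

lemma upper_grad_derivative:
  assumes f: "upper_grad f h"
  obtains g where "g \<in> borel_measurable borel" "AE x in lborel. \<bar>g x\<bar> \<le> h x"
    "\<And>x y. x \<le> y \<Longrightarrow> f y - f x = (LINT z:{x<..y}|lborel. g z)"
proof -
  note fD = upper_gradD[OF f]
  have sh: "set_integrable lborel {x<..y} h" for x y using sq_integrable_imp_set_integrable fD(4) .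
  note pd = primitive_diff[OF sh]
  define N1 N2 where "N1 x = primitive h x + f x" and "N2 x = primitive h x - f x" for x
  have cf: "continuous_on UNIV f"
  proof (rule continuous_of_increment_sq[where K = "LINT z|lborel. (h z)\<^sup>2"])
    fix x y :: real assume "x \<le> y"
    then show "(norm (f y - f x))\<^sup>2 \<le> (y - x) * (LINT z|lborel. (h z)\<^sup>2)"
      using upper_grad_increment_sq[OF f, where x = x and y = y] by simp
  qed
  have ch: "continuous_on UNIV (primitive h)"
    using integral_Ioc_le_sqrt[OF fD(4)] pd
    by (intro continuous_of_increment_sq[where K = "LINT z|lborel. (h z)\<^sup>2"]) simp
  have mono: "N1 x \<le> N1 y" "N2 x \<le> N2 y" if "x \<le> y" for x y
    using fD(5)[OF that] pd[OF that] by (auto simp: N1_def N2_def)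
  have "\<exists>g. g \<in> borel_measurable borel \<and> (AE x in lborel. 0 \<le> g x \<and> g x \<le> 2 * h x) \<and>
    (\<forall>x y. x \<le> y \<longrightarrow> N1 y - N1 x = (LINT z:{x<..y}|lborel. g z))"
  proof (rule interval_measure_le_density)
    show "continuous_on UNIV N1" "continuous_on UNIV N2"
      unfolding N1_def[abs_def] N2_def[abs_def] by (intro continuous_intros cf ch)+
    show "(N1 y - N1 x) + (N2 y - N2 x) = (LINT z:{x<..y}|lborel. 2 * h z)" if "x \<le> y" for x y
      using pd[OF that] by (simp add: N1_def N2_def)
  qed (use mono fD sh in auto)
  then obtain g where g: "g \<in> borel_measurable borel" "AE x in lborel. 0 \<le> g x \<and> g x \<le> 2 * h x"
    "\<And>x y. x \<le> y \<Longrightarrow> N1 y - N1 x = (LINT z:{x<..y}|lborel. g z)" by blast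
  note [measurable] = g(1) fD(7)
  have sg: "set_integrable lborel {x<..y} g" for x y
    unfolding set_integrable_def
  proof (rule Bochner_Integration.integrable_bound)
    show "integrable lborel (\<lambda>z. 2 * (indicat_real {x<..y} z *\<^sub>R h z))"
      using sh[of x y] unfolding set_integrable_def by (rule integrable_mult_right)
    show "AE z in lborel. norm (indicat_real {x<..y} z *\<^sub>R g z) \<le> norm (2 * (indicat_real {x<..y} z *\<^sub>R h z))"
      using g(2) by eventually_elim (auto simp: indicator_def)
  qed simp
  show ?thesis
  proof (rule that[of "\<lambda>x. g x - h x"])
    show "AE x in lborel. \<bar>g x - h x\<bar> \<le> h x" using g(2) by eventually_elim auto
    show "f y - f x = (LINT z:{x<..y}|lborel. g z - h z)" if "x \<le> y" for x y
      using g(3)[OF that] pd[OF that] sg sh by (simp add: N1_def set_integral_diff)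
  qed simp
qed

text \<open>The bridge back to H^1. Passing from h to a true derivative can only lower the kinetic
  term, so a lower bound for the energy over \<open>Y\<close> also holds for upper-gradient
  pairs.\<close>

lemma upper_grad_imp_ac_pair:
  assumes f: "upper_grad f h"
  obtains g where "ac_pair (\<lambda>x. complex_of_real (f x)) g"
    "(LINT x|lborel. (cmod (g x))\<^sup>2) \<le> (LINT x|lborel. (h x)\<^sup>2)"
proof -
  obtain g where g: "g \<in> borel_measurable borel" "AE x in lborel. \<bar>g x\<bar> \<le> h x"
    "\<And>x y. x \<le> y \<Longrightarrow> f y - f x = (LINT z:{x<..y}|lborel. g z)"
    using upper_grad_derivative[OF f] by metis
  note fD = upper_gradD[OF f]
  note [measurable] = g(1) fD(6,7)
  have sq: "AE x in lborel. (g x)\<^sup>2 \<le> (h x)\<^sup>2"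
    using g(2) by eventually_elim (metis abs_ge_zero power2_abs power_mono)
  have ig: "integrable lborel (\<lambda>x. (g x)\<^sup>2)"
    by (rule Bochner_Integration.integrable_bound[OF fD(9)]) (use sq in auto)
  show ?thesis
  proof (rule that[of "\<lambda>x. complex_of_real (g x)"])
    show "ac_pair (\<lambda>x. complex_of_real (f x)) (\<lambda>x. complex_of_real (g x))"
      using fD(3) g(3) ig
      by (auto simp: ac_pair_def L2_iff sq_integrable_def set_integral_complex_of_real simp flip: of_real_diff)
    show "(LINT x|lborel. (cmod (complex_of_real (g x)))\<^sup>2) \<le> (LINT x|lborel. (h x)\<^sup>2)"
      using sq ig fD(9) by (auto intro!: integral_mono_AE)
  qed
qed

section \<open>Kinetic and potential energy\<close>

definition msq :: "(real \<Rightarrow> real) \<Rightarrow> real" where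
  "msq u = (LINT x|lborel. (u x)\<^sup>2)"

lemma msq_nonneg: "0 \<le> msq u"
  by (simp add: msq_def)

lemma msq_scale: "msq (\<lambda>x. c * u x) = c\<^sup>2 * msq u"
  by (simp add: msq_def power_mult_distrib)

lemma msq_hypot:
  assumes "sq_integrable u" "sq_integrable v"
  shows "msq (\<lambda>x. sqrt ((u x)\<^sup>2 + (v x)\<^sup>2)) = msq u + msq v"
  using assms by (simp add: msq_def sq_integrable_def)

lemma msq_shift: "sq_integrable u \<Longrightarrow> msq (\<lambda>x. u (x + c)) = msq u"
  unfolding msq_def by (rule sq_integrable_shift(2))

lemma msq_le_add:
  assumes "f \<in> L2" "g \<in> L2"
  shows "msq (\<lambda>x. cmod (f x + g x)) \<le> 2 * msq (\<lambda>x. cmod (f x)) + 2 * msq (\<lambda>x. cmod (g x))"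
proof -
  have i: "integrable lborel (\<lambda>x. (cmod (f x))\<^sup>2)" "integrable lborel (\<lambda>x. (cmod (g x))\<^sup>2)"
    "integrable lborel (\<lambda>x. (cmod (f x + g x))\<^sup>2)"
    using assms L2_add[OF assms] by (auto simp: L2_def)
  have "(cmod (f x + g x))\<^sup>2 \<le> 2 * (cmod (f x))\<^sup>2 + 2 * (cmod (g x))\<^sup>2" for x
  proof -
    have "(cmod (f x + g x))\<^sup>2 \<le> (cmod (f x) + cmod (g x))\<^sup>2"
      by (intro power_mono norm_triangle_ineq) simp
    also have "\<dots> \<le> 2 * (cmod (f x))\<^sup>2 + 2 * (cmod (g x))\<^sup>2"
      using sum_squares_bound[of "cmod (f x)" "cmod (g x)"] by (simp add: power2_sum)
    finally show ?thesis .
  qed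
  then have "msq (\<lambda>x. cmod (f x + g x)) \<le> (LINT x|lborel. 2 * (cmod (f x))\<^sup>2 + 2 * (cmod (g x))\<^sup>2)"
    unfolding msq_def using i by (intro integral_mono) auto
  also have "\<dots> = 2 * msq (\<lambda>x. cmod (f x)) + 2 * msq (\<lambda>x. cmod (g x))"
    using i by (simp add: msq_def)
  finally show ?thesis .
qed

text \<open>Factor the difference of squares, bound the difference of moduli by the modulus of the
  difference, and apply Cauchy-Schwarz.\<close>

lemma msq_cmod_diff_le:
  assumes f: "f \<in> L2" and g: "g \<in> L2"
  shows "\<bar>msq (\<lambda>x. cmod (f x)) - msq (\<lambda>x. cmod (g x))\<bar>
    \<le> sqrt (msq (\<lambda>x. cmod (f x - g x))) * sqrt (2 * msq (\<lambda>x. cmod (f x)) + 2 * msq (\<lambda>x. cmod (g x)))"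
proof -
  have [measurable]: "f \<in> borel_measurable borel" "g \<in> borel_measurable borel"
    using f g by (auto simp: L2_iff)
  have i: "integrable lborel (\<lambda>x. (cmod (f x))\<^sup>2)" "integrable lborel (\<lambda>x. (cmod (g x))\<^sup>2)"
    "integrable lborel (\<lambda>x. (cmod (f x - g x))\<^sup>2)"
    using f g L2_diff[OF f g] by (auto simp: L2_def)
  have isq: "integrable lborel (\<lambda>x. (cmod (f x) + cmod (g x))\<^sup>2)"
    using sq_integrable_add[of "\<lambda>x. cmod (f x)" "\<lambda>x. cmod (g x)"] f g
    by (simp add: L2_iff sq_integrable_def)
  have ip: "integrable lborel (\<lambda>x. cmod (f x - g x) * (cmod (f x) + cmod (g x)))"
    using i isq by (intro square_integrable_mult) auto
  have pt: "\<bar>(cmod (f x))\<^sup>2 - (cmod (g x))\<^sup>2\<bar> \<le> cmod (f x - g x) * (cmod (f x) + cmod (g x))" for x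
  proof -
    have "(cmod (f x))\<^sup>2 - (cmod (g x))\<^sup>2 = (cmod (f x) - cmod (g x)) * (cmod (f x) + cmod (g x))"
      by (simp add: power2_eq_square algebra_simps)
    then have "\<bar>(cmod (f x))\<^sup>2 - (cmod (g x))\<^sup>2\<bar> = \<bar>cmod (f x) - cmod (g x)\<bar> * (cmod (f x) + cmod (g x))"
      by (simp add: abs_mult)
    also have "\<dots> \<le> cmod (f x - g x) * (cmod (f x) + cmod (g x))"
      by (intro mult_right_mono norm_triangle_ineq3) simp
    finally show ?thesis .
  qed
  have "\<bar>msq (\<lambda>x. cmod (f x)) - msq (\<lambda>x. cmod (g x))\<bar> = \<bar>LINT x|lborel. (cmod (f x))\<^sup>2 - (cmod (g x))\<^sup>2\<bar>"
    using i by (simp add: msq_def)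
  also have "\<dots> \<le> (LINT x|lborel. \<bar>(cmod (f x))\<^sup>2 - (cmod (g x))\<^sup>2\<bar>)"
    by (rule integral_abs_bound)
  also have "\<dots> \<le> (LINT x|lborel. cmod (f x - g x) * (cmod (f x) + cmod (g x)))"
    using i ip pt by (intro integral_mono) auto
  also have "\<dots> \<le> sqrt (msq (\<lambda>x. cmod (f x - g x)) * msq (\<lambda>x. cmod (f x) + cmod (g x)))"
    using Cauchy_Schwarz_integral[of "\<lambda>x. cmod (f x - g x)" lborel "\<lambda>x. cmod (f x) + cmod (g x)"] i isq
    by (intro real_le_rsqrt) (auto simp: msq_def)
  also have "\<dots> \<le> sqrt (msq (\<lambda>x. cmod (f x - g x)) * (2 * msq (\<lambda>x. cmod (f x)) + 2 * msq (\<lambda>x. cmod (g x))))"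
  proof (intro real_sqrt_le_mono mult_left_mono msq_nonneg)
    have "(cmod (f x) + cmod (g x))\<^sup>2 \<le> 2 * (cmod (f x))\<^sup>2 + 2 * (cmod (g x))\<^sup>2" for x
      using sum_squares_bound[of "cmod (f x)" "cmod (g x)"] by (simp add: power2_sum)
    then have "msq (\<lambda>x. cmod (f x) + cmod (g x)) \<le> (LINT x|lborel. 2 * (cmod (f x))\<^sup>2 + 2 * (cmod (g x))\<^sup>2)"
      unfolding msq_def using i isq by (intro integral_mono) auto
    then show "msq (\<lambda>x. cmod (f x) + cmod (g x)) \<le> 2 * msq (\<lambda>x. cmod (f x)) + 2 * msq (\<lambda>x. cmod (g x))"
      using i by (simp add: msq_def)
  qed
  finally show ?thesis by (simp add: real_sqrt_mult)
qed

section \<open>Elementary inequalities for real powers\<close>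

lemma powr_le_linear:
  fixes x :: real
  assumes "0 \<le> x" "x \<le> S" "1 \<le> p" shows "x powr p \<le> S powr (p - 1) * x"
proof (cases "x = 0")
  case False
  then have "x powr p = x powr (p - 1) * x" using powr_mult_base[of x "p - 1"] assms by (simp add: mult.commute)
  also have "\<dots> \<le> S powr (p - 1) * x" using assms by (intro mult_right_mono powr_mono2) auto
  finally show ?thesis .
qed simp

lemma powr_diff_le:
  fixes x y :: real
  assumes "0 \<le> x" "x \<le> T" "0 \<le> y" "y \<le> T" "1 \<le> p"
  shows "\<bar>x powr p - y powr p\<bar> \<le> p * T powr (p - 1) * \<bar>x - y\<bar>"
proof -
  have *: "\<bar>x powr p - y powr p\<bar> \<le> p * T powr (p - 1) * \<bar>x - y\<bar>"
    if xy: "0 \<le> y" "y < x" "x \<le> T" for x y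
  \<comment> \<open>The derivative rule for \<open>powr\<close> holds only at positive arguments, so
    the mean value theorem is reserved for y > 0.\<close>
  proof (cases "y = 0")
    case True
    have "x powr p \<le> T powr (p - 1) * x" using powr_le_linear xy assms(5) by simp
    also have "\<dots> \<le> p * (T powr (p - 1) * x)"
      using mult_right_mono[of 1 p "T powr (p - 1) * x"] assms(5) xy by simp
    finally show ?thesis using True xy by (simp add: mult.assoc)
  next
    case False
    then have "0 < y" using xy by simp
    have "\<exists>z. y < z \<and> z < x \<and> x powr p - y powr p = (x - y) * (p * z powr (p - 1))"
      using \<open>0 < y\<close> xy
      by (intro MVT2) (auto intro!: has_real_derivative_powr)
    then obtain z where z: "y < z" "z < x" "x powr p - y powr p = (x - y) * (p * z powr (p - 1))"
      by blast
    have "z powr (p - 1) \<le> T powr (p - 1)" using z xy \<open>0 < y\<close> assms(5) by (intro powr_mono2) auto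
    then have "(x - y) * (p * z powr (p - 1)) \<le> (x - y) * (p * T powr (p - 1))"
      using xy assms(5) by (intro mult_left_mono) auto
    moreover have "0 \<le> (x - y) * (p * z powr (p - 1))" using xy assms(5) by simp
    ultimately show ?thesis using z(3) xy by (simp add: mult.commute)
  qed
  consider "y < x" | "x < y" | "x = y" by linarith
  then show ?thesis
  proof cases
    case 2
    then show ?thesis using *[of x y] assms by (simp add: abs_minus_commute)
  qed (use * assms in auto)
qed

text \<open>With r the root of the sum of squares, every z in [0, r] satisfies z^p \<le> r^(p-2) z^2
  because p \<ge> 2; adding the two cases z = x and z = y gives r^p.\<close>

lemma powr_add_le_hypot_powr:
  fixes x y :: real
  assumes "0 \<le> x" "0 \<le> y" "2 \<le> p"
  shows "x powr p + y powr p \<le> sqrt (x\<^sup>2 + y\<^sup>2) powr p"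
proof -
  define r where "r = sqrt (x\<^sup>2 + y\<^sup>2)"
  have r: "x \<le> r" "y \<le> r" "0 \<le> r" "r\<^sup>2 = x\<^sup>2 + y\<^sup>2"
    using assms by (auto simp: r_def real_le_rsqrt)
  have *: "z powr p \<le> r powr (p - 2) * z\<^sup>2" if "0 \<le> z" "z \<le> r" for z
  proof (cases "z = 0")
    case False
    then have "z powr p = z powr (p - 2) * z powr 2" by (simp flip: powr_add)
    also have "\<dots> = z powr (p - 2) * z\<^sup>2" using that False by simp
    also have "\<dots> \<le> r powr (p - 2) * z\<^sup>2" using that assms(3) by (intro mult_right_mono powr_mono2) auto
    finally show ?thesis .
  qed simp
  have "x powr p + y powr p \<le> r powr (p - 2) * x\<^sup>2 + r powr (p - 2) * y\<^sup>2"
    using * r assms by (intro add_mono) auto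
  also have "\<dots> = r powr (p - 2) * r\<^sup>2" by (simp add: r(4) algebra_simps)
  also have "\<dots> = r powr p"
  proof (cases "r = 0")
    case False
    then have "r\<^sup>2 = r powr 2" using r by simp
    then show ?thesis using False by (simp flip: powr_add)
  qed simp
  finally show ?thesis by (simp add: r_def)
qed

definition ug3 :: "(3 \<Rightarrow> real \<Rightarrow> real) \<Rightarrow> (3 \<Rightarrow> real \<Rightarrow> real) \<Rightarrow> bool" where
  "ug3 f h \<longleftrightarrow> (\<forall>j. upper_grad (f j) (h j))"

text \<open>Plays two roles: evaluated at upper gradients it is the kinetic energy, evaluated at the
  functions themselves it is the total mass.\<close>

definition kin :: "(3 \<Rightarrow> real \<Rightarrow> real) \<Rightarrow> real" where
  "kin h = (\<Sum>j\<in>UNIV. msq (h j))"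

lemma kin_nonneg: "0 \<le> kin h" by (simp add: kin_def sum_nonneg msq_nonneg)

lemma msq_le_kin: "msq (h j) \<le> kin h"
  unfolding kin_def by (rule member_le_sum) (auto simp: msq_nonneg)

lemma ug3_sup_bound:
  assumes "ug3 f h" "0 < l"
  shows "(f j x)\<^sup>2 \<le> 2 / l * kin f + 2 * l * kin h"
proof -
  have "(f j x)\<^sup>2 \<le> 2 / l * msq (f j) + 2 * l * msq (h j)"
    using upper_grad_sup_bound[of "f j" "h j" l x] assms by (simp add: ug3_def msq_def)
  also have "\<dots> \<le> 2 / l * kin f + 2 * l * kin h"
    using assms msq_le_kin[of f j] msq_le_kin[of h j] by (intro add_mono mult_left_mono) auto
  finally show ?thesis .
qed

section \<open>The potential energy and the a priori bound on derivatives\<close>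

locale nls_coefficients =
  fixes p :: real and a :: "3 \<Rightarrow> 3 \<Rightarrow> real"
  assumes p: "2 \<le> p" "p < 3" and a_pos: "\<And>k j. 0 < a k j"
begin

definition dens :: "(3 \<Rightarrow> real \<Rightarrow> real) \<Rightarrow> real \<Rightarrow> real" where
  "dens f x = (\<Sum>k\<in>UNIV. \<Sum>j\<in>UNIV. a k j * f k x powr p * f j x powr p)"

definition pot :: "(3 \<Rightarrow> real \<Rightarrow> real) \<Rightarrow> real" where
  "pot f = 1 / p * (LINT x|lborel. dens f x)"

definition Asum :: real where "Asum = (\<Sum>k\<in>UNIV. \<Sum>j\<in>UNIV. a k j)"

lemma Asum_pos: "0 < Asum"
  unfolding Asum_def by (intro sum_pos) (auto simp: a_pos)

lemma dens_nonneg: "0 \<le> dens f x"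
  unfolding dens_def using a_pos by (intro sum_nonneg) (simp add: less_imp_le)

text \<open>Of the p-th power of a product of two components, p - 1 powers are absorbed by the
  uniform bound and one is kept; the arithmetic-geometric mean turns the latter into mass
  density.\<close>

lemma dens_le:
  assumes "\<And>j. 0 \<le> f j x" "\<And>j. (f j x)\<^sup>2 \<le> S"
  shows "dens f x \<le> Asum * S powr (p - 1) * (\<Sum>j\<in>UNIV. (f j x)\<^sup>2)"
proof -
  let ?Q = "\<Sum>j\<in>UNIV. (f j x)\<^sup>2"
  have mem: "(f j x)\<^sup>2 \<le> ?Q" for j by (rule member_le_sum) auto
  have t: "a k j * f k x powr p * f j x powr p \<le> a k j * (S powr (p - 1) * ?Q)" for k j
  proof -
    have am: "f k x * f j x \<le> ((f k x)\<^sup>2 + (f j x)\<^sup>2) / 2"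
      using sum_squares_bound[of "f k x" "f j x"] by simp
    have "f k x powr p * f j x powr p = (f k x * f j x) powr p"
      using assms(1) by (simp add: powr_mult)
    also have "\<dots> \<le> S powr (p - 1) * (f k x * f j x)"
      using assms(1) assms(2)[of k] assms(2)[of j] am p by (intro powr_le_linear) auto
    also have "\<dots> \<le> S powr (p - 1) * ?Q"
      using am mem[of k] mem[of j] by (intro mult_left_mono) auto
    finally show ?thesis using a_pos[of k j] by (simp add: mult.assoc)
  qed
  have "dens f x \<le> (\<Sum>k\<in>UNIV. \<Sum>j\<in>UNIV. a k j * (S powr (p - 1) * ?Q))"
    unfolding dens_def by (intro sum_mono t)
  also have "\<dots> = Asum * (S powr (p - 1) * ?Q)"
    by (simp only: Asum_def sum_distrib_right)
  finally show ?thesis by (simp add: mult.assoc)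
qed

lemma dens_measurable:
  assumes "\<And>j. f j \<in> borel_measurable borel" shows "dens f \<in> borel_measurable borel"
proof -
  note [measurable] = assms
  show ?thesis unfolding dens_def[abs_def] by measurable
qed

lemma dens_integrable:
  assumes "ug3 f h" shows "integrable lborel (dens f)"
proof -
  have u: "upper_grad (f j) (h j)" for j using assms by (simp add: ug3_def)
  define S where "S = 2 / 1 * kin f + 2 * 1 * kin h"
  have le: "dens f x \<le> Asum * S powr (p - 1) * (\<Sum>j\<in>UNIV. (f j x)\<^sup>2)" for x
    unfolding S_def by (intro dens_le ug3_sup_bound[OF assms] upper_gradD(1)[OF u]) simp
  show ?thesis
  proof (rule Bochner_Integration.integrable_bound)
    show "integrable lborel (\<lambda>x. Asum * S powr (p - 1) * (\<Sum>j\<in>UNIV. (f j x)\<^sup>2))"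
      using upper_gradD(8)[OF u] by (intro integrable_mult_right Bochner_Integration.integrable_sum) auto
    show "AE x in lborel. norm (dens f x) \<le> norm (Asum * S powr (p - 1) * (\<Sum>j\<in>UNIV. (f j x)\<^sup>2))"
      using le dens_nonneg by (intro AE_I2) (metis abs_of_nonneg order_trans real_norm_def)
    show "dens f \<in> borel_measurable lborel"
      using dens_measurable[of f] upper_gradD(6)[OF u] by simp
  qed
qed

lemma pot_le:
  assumes "ug3 f h" "\<And>j x. (f j x)\<^sup>2 \<le> S"
  shows "pot f \<le> Asum * S powr (p - 1) * kin f"
proof -
  have u: "upper_grad (f j) (h j)" for j using assms by (simp add: ug3_def)
  have i: "integrable lborel (\<lambda>x. (f j x)\<^sup>2)" for j using upper_gradD(8)[OF u] .
  have "(LINT x|lborel. dens f x) \<le> (LINT x|lborel. Asum * S powr (p - 1) * (\<Sum>j\<in>UNIV. (f j x)\<^sup>2))"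
    using i by (intro integral_mono dens_integrable[OF assms(1)] dens_le upper_gradD(1)[OF u] assms(2)
        integrable_mult_right Bochner_Integration.integrable_sum)
  also have "\<dots> = Asum * S powr (p - 1) * kin f"
    using i by (simp add: kin_def msq_def)
  finally have I: "(LINT x|lborel. dens f x) \<le> Asum * S powr (p - 1) * kin f" .
  have "pot f \<le> 1 * (LINT x|lborel. dens f x)"
    unfolding pot_def using p dens_nonneg by (intro mult_right_mono integral_nonneg) auto
  then show ?thesis using I by simp
qed

text \<open>Telescoping the products leaves one difference of p-th powers, bounded uniformly through
  d, times one p-th power, of which a square is kept for integration. Uniform closeness and bounded
  mass thus suffice.\<close>

lemma pot_diff_le:
  assumes f: "ug3 f h" and g: "ug3 g k" and fT: "\<And>j x. f j x \<le> T" and gT: "\<And>j x. g j x \<le> T"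
    and d: "\<And>j x. \<bar>f j x - g j x\<bar> \<le> d"
  shows "\<bar>pot f - pot g\<bar> \<le> Asum * (T powr (p - 2) * T powr (p - 1)) * d * (kin f + kin g)"
proof -
  have uf: "upper_grad (f j) (h j)" and ug: "upper_grad (g j) (k j)" for j
    using f g by (simp_all add: ug3_def)
  note f0 = upper_gradD(1)[OF uf] and g0 = upper_gradD(1)[OF ug]
  have if2: "integrable lborel (\<lambda>x. (f j x)\<^sup>2)" "integrable lborel (\<lambda>x. (g j x)\<^sup>2)" for j
    using upper_gradD(8)[OF uf] upper_gradD(8)[OF ug] .
  define Q where "Q x = (\<Sum>j\<in>UNIV. (f j x)\<^sup>2) + (\<Sum>j\<in>UNIV. (g j x)\<^sup>2)" for x
  define C where "C = T powr (p - 2) * (p * T powr (p - 1) * d)"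
  have sq: "z powr p \<le> T powr (p - 2) * z\<^sup>2" if "0 \<le> z" "z \<le> T" for z
  proof (cases "z = 0")
    case False
    then have "z powr p = z powr (p - 2) * z powr 2" by (simp flip: powr_add)
    also have "\<dots> = z powr (p - 2) * z\<^sup>2" using that False by simp
    also have "\<dots> \<le> T powr (p - 2) * z\<^sup>2" using that p by (intro mult_right_mono powr_mono2) auto
    finally show ?thesis .
  qed simp
  have df: "\<bar>f j x powr p - g j x powr p\<bar> \<le> p * T powr (p - 1) * d" for j x
  proof -
    have "\<bar>f j x powr p - g j x powr p\<bar> \<le> p * T powr (p - 1) * \<bar>f j x - g j x\<bar>"
      using f0 g0 fT gT p by (intro powr_diff_le) auto
    also have "\<dots> \<le> p * T powr (p - 1) * d" using d p by (intro mult_left_mono) auto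
    finally show ?thesis .
  qed
  have t: "\<bar>f i x powr p * f j x powr p - g i x powr p * g j x powr p\<bar> \<le> C * Q x" for i j x
  proof -
    have "f i x powr p * f j x powr p - g i x powr p * g j x powr p
      = f i x powr p * (f j x powr p - g j x powr p) + g j x powr p * (f i x powr p - g i x powr p)"
      by (simp add: algebra_simps)
    then have "\<bar>f i x powr p * f j x powr p - g i x powr p * g j x powr p\<bar>
      \<le> \<bar>f i x powr p * (f j x powr p - g j x powr p)\<bar> + \<bar>g j x powr p * (f i x powr p - g i x powr p)\<bar>"
      by linarith
    also have "\<dots> = f i x powr p * \<bar>f j x powr p - g j x powr p\<bar> + g j x powr p * \<bar>f i x powr p - g i x powr p\<bar>"
      by (simp add: abs_mult)
    also have "\<dots> \<le> (T powr (p - 2) * (f i x)\<^sup>2) * (p * T powr (p - 1) * d) + (T powr (p - 2) * (g j x)\<^sup>2) * (p * T powr (p - 1) * d)"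
      using sq df f0 g0 fT gT by (intro add_mono mult_mono) auto
    also have "\<dots> = C * ((f i x)\<^sup>2 + (g j x)\<^sup>2)" by (simp add: C_def algebra_simps)
    also have "\<dots> \<le> C * Q x"
    proof (rule mult_left_mono)
      have "(f i x)\<^sup>2 \<le> (\<Sum>j\<in>UNIV. (f j x)\<^sup>2)" "(g j x)\<^sup>2 \<le> (\<Sum>j\<in>UNIV. (g j x)\<^sup>2)"
        by (rule member_le_sum; simp)+
      then show "(f i x)\<^sup>2 + (g j x)\<^sup>2 \<le> Q x" by (simp add: Q_def)
      \<comment> \<open>Any index and any point would do here; \<open>undefined\<close> merely
        instantiates the bound.\<close>
      have "0 \<le> d" using d[of undefined undefined] by linarith
      then show "0 \<le> C" using p by (simp add: C_def)
    qed
    finally show ?thesis .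
  qed
  have dens: "\<bar>dens f x - dens g x\<bar> \<le> Asum * (C * Q x)" for x
  proof -
    have "dens f x - dens g x = (\<Sum>i\<in>UNIV. \<Sum>j\<in>UNIV. a i j * (f i x powr p * f j x powr p - g i x powr p * g j x powr p))"
      by (simp add: dens_def sum_subtractf algebra_simps)
    then have "\<bar>dens f x - dens g x\<bar> \<le> (\<Sum>i\<in>UNIV. \<bar>\<Sum>j\<in>UNIV. a i j * (f i x powr p * f j x powr p - g i x powr p * g j x powr p)\<bar>)"
      by (simp only: sum_abs)
    also have "\<dots> \<le> (\<Sum>i\<in>UNIV. \<Sum>j\<in>UNIV. \<bar>a i j * (f i x powr p * f j x powr p - g i x powr p * g j x powr p)\<bar>)"
      by (intro sum_mono sum_abs)
    also have "\<dots> \<le> (\<Sum>i\<in>UNIV. \<Sum>j\<in>UNIV. a i j * (C * Q x))"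
      using t a_pos by (intro sum_mono) (auto simp: abs_mult less_imp_le)
    also have "\<dots> = Asum * (C * Q x)" by (simp only: Asum_def sum_distrib_right)
    finally show ?thesis .
  qed
  have iQ: "integrable lborel Q" unfolding Q_def[abs_def]
    by (intro Bochner_Integration.integrable_add Bochner_Integration.integrable_sum if2)
  have id: "integrable lborel (dens f)" "integrable lborel (dens g)"
    using dens_integrable f g by blast+
  have "\<bar>(LINT x|lborel. dens f x) - (LINT x|lborel. dens g x)\<bar> = \<bar>LINT x|lborel. dens f x - dens g x\<bar>"
    using id by simp
  also have "\<dots> \<le> (LINT x|lborel. \<bar>dens f x - dens g x\<bar>)" by (rule integral_abs_bound)
  also have "\<dots> \<le> (LINT x|lborel. Asum * (C * Q x))"
    using id iQ dens by (intro integral_mono) auto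
  also have "\<dots> = Asum * (C * (kin f + kin g))"
    using if2 by (simp add: Q_def kin_def msq_def)
  finally have "\<bar>(LINT x|lborel. dens f x) - (LINT x|lborel. dens g x)\<bar> \<le> Asum * (C * (kin f + kin g))" .
  then have "1 / p * \<bar>(LINT x|lborel. dens f x) - (LINT x|lborel. dens g x)\<bar> \<le> 1 / p * (Asum * (C * (kin f + kin g)))"
    using p by (intro mult_left_mono) auto
  moreover have "\<bar>pot f - pot g\<bar> = 1 / p * \<bar>(LINT x|lborel. dens f x) - (LINT x|lborel. dens g x)\<bar>"
    using p by (simp add: pot_def abs_mult flip: right_diff_distrib diff_divide_distrib)
  moreover have "1 / p * (Asum * (C * (kin f + kin g))) = Asum * (T powr (p - 2) * T powr (p - 1)) * d * (kin f + kin g)"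
    using p by (simp add: C_def)
  ultimately show ?thesis by simp
qed

text \<open>With y = 1 + \<open>kin h\<close>, the window length 1 / sqrt y in the sup bound yields
  f^2 of order sqrt y, hence a potential of order y^q with q = (p - 1) / 2. Since p < 3 gives q < 1,
  a bound on the energy bounds y.\<close>

lemma kin_bounded:
  "\<exists>C\<ge>0. \<forall>f h. ug3 f h \<longrightarrow> kin f \<le> M \<longrightarrow> kin h - pot f \<le> E \<longrightarrow> kin h \<le> C"
proof -
  define q where "q = (p - 1) / 2"
  have q: "0 < q" "q < 1" using p by (auto simp: q_def)
  define M' where "M' = \<bar>M\<bar>"
  define B where "B = Asum * (2 * M' + 2) powr (p - 1) * M'"
  have B: "0 \<le> B" using Asum_pos by (simp add: B_def M'_def)
  \<comment> \<open>From y \<le> (1 + \<bar>E\<bar>) + B y^q, either y is at most twice the first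
    term, or y \<le> 2 B y^q, which is solved for y.\<close>
  define C where "C = max (2 * (1 + \<bar>E\<bar>)) ((2 * B) powr (1 / (1 - q)))"
  have "kin h \<le> C" if u: "ug3 f h" and M: "kin f \<le> M" and E: "kin h - pot f \<le> E" for f h
  proof -
    define y where "y = 1 + kin h"
    have y: "1 \<le> y" using kin_nonneg by (simp add: y_def)
    have l: "0 < 1 / sqrt y" using y by simp
    have S: "(f j x)\<^sup>2 \<le> (2 * M' + 2) * sqrt y" for j x
    proof -
      have "(f j x)\<^sup>2 \<le> 2 / (1 / sqrt y) * kin f + 2 * (1 / sqrt y) * kin h"
        by (rule ug3_sup_bound[OF u l])
      also have "\<dots> \<le> 2 / (1 / sqrt y) * M' + 2 * (1 / sqrt y) * y"
        using M y by (intro add_mono mult_left_mono) (auto simp: M'_def y_def)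
      also have "2 * (1 / sqrt y) * y = 2 * sqrt y"
        using real_div_sqrt[of y] y by (simp flip: times_divide_eq_right)
      also have "2 / (1 / sqrt y) * M' + 2 * sqrt y = (2 * M' + 2) * sqrt y" by (simp add: algebra_simps)
      finally show ?thesis .
    qed
    have "pot f \<le> Asum * ((2 * M' + 2) * sqrt y) powr (p - 1) * kin f"
      by (rule pot_le[OF u S])
    also have "\<dots> \<le> Asum * ((2 * M' + 2) * sqrt y) powr (p - 1) * M'"
      using M Asum_pos by (intro mult_left_mono) (auto simp: M'_def)
    also have "((2 * M' + 2) * sqrt y) powr (p - 1) = (2 * M' + 2) powr (p - 1) * y powr q"
      using y by (simp add: powr_mult M'_def q_def powr_half_sqrt[symmetric] powr_powr)
    finally have P: "pot f \<le> B * y powr q" by (simp add: B_def algebra_simps)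
    have yb: "y \<le> (1 + \<bar>E\<bar>) + B * y powr q" using E P by (simp add: y_def)
    have "y \<le> C"
    proof (cases "y \<le> 2 * (1 + \<bar>E\<bar>)")
      case False
      then have "y \<le> 2 * B * y powr q" using yb by simp
      moreover have "y = y powr (1 - q) * y powr q" using y by (simp flip: powr_add)
      ultimately have "y powr (1 - q) * y powr q \<le> 2 * B * y powr q" by simp
      then have "y powr (1 - q) \<le> 2 * B" using y by simp
      then have "(y powr (1 - q)) powr (1 / (1 - q)) \<le> (2 * B) powr (1 / (1 - q))"
        using q by (intro powr_mono2) auto
      then have "y \<le> (2 * B) powr (1 / (1 - q))" using q y by (simp add: powr_powr)
      then show ?thesis by (simp add: C_def)
    qed (simp add: C_def)
    then show ?thesis by (simp add: y_def)
  qed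
  moreover have "0 \<le> C" by (simp add: C_def)
  ultimately show ?thesis by blast
qed

end

section \<open>Merging and cutting\<close>

definition combine3 :: "(3 \<Rightarrow> real \<Rightarrow> real) \<Rightarrow> (3 \<Rightarrow> real \<Rightarrow> real) \<Rightarrow> 3 \<Rightarrow> real \<Rightarrow> real" where
  "combine3 f g j x = sqrt ((f j x)\<^sup>2 + (g j x)\<^sup>2)"

lemma ug3_combine3:
  assumes "ug3 f h" "ug3 g k" shows "ug3 (combine3 f g) (combine3 h k)"
  using assms upper_grad_hypot unfolding ug3_def combine3_def[abs_def] by blast

lemma msq_combine3:
  assumes "sq_integrable (f j)" "sq_integrable (g j)"
  shows "msq (combine3 f g j) = msq (f j) + msq (g j)"
  using msq_hypot[OF assms] by (simp add: combine3_def[abs_def])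

lemma kin_combine3:
  assumes "\<And>j. sq_integrable (f j)" "\<And>j. sq_integrable (g j)"
  shows "kin (combine3 f g) = kin f + kin g"
  using msq_combine3[OF assms] by (simp add: kin_def sum.distrib)

section \<open>Tent profiles and cutoff functions\<close>

lemma lipschitz_compact_support_upper_grad:
  assumes lip: "\<And>x y. \<bar>f y - f x\<bar> \<le> L * \<bar>y - x\<bar>" and supp: "\<And>x. l \<le> \<bar>x\<bar> \<Longrightarrow> f x = 0"
    and nn: "\<And>x. 0 \<le> f x" and L: "0 \<le> L" and l: "0 < l"
  shows "upper_grad f (\<lambda>x. L * indicat_real {-l<..l} x)"
    and "msq (\<lambda>x. L * indicat_real {-l<..l} x) = L\<^sup>2 * (2 * l)"
proof -
  have sI: "sq_integrable (indicat_real {-l<..l})"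
    using square_integrable_indicator_Ioc(1)[of "-l" l] by (simp add: sq_integrable_def)
  have cont: "continuous_on UNIV f"
  proof (rule continuous_at_imp_continuous_on, intro ballI)
    fix x
    have "(f \<longlongrightarrow> f x) (at x)"
    proof (rule Lim_null[THEN iffD2], rule Lim_null_comparison)
      show "\<forall>\<^sub>F y in at x. norm (f y - f x) \<le> L * \<bar>y - x\<bar>" using lip by simp
      have "((\<lambda>y. L * \<bar>y - x\<bar>) \<longlongrightarrow> L * \<bar>x - x\<bar>) (at x)" by (intro tendsto_intros)
      then show "((\<lambda>y. L * \<bar>y - x\<bar>) \<longlongrightarrow> 0) (at x)" by simp
    qed
    then show "isCont f x" by (simp add: isCont_def)
  qed
  have fb: "\<bar>f x\<bar> \<le> (L * (2 * l)) * \<bar>indicat_real {-l<..l} x\<bar>" for x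
  proof (cases "l \<le> \<bar>x\<bar>")
    case False
    have "\<bar>f x - f l\<bar> \<le> L * \<bar>x - l\<bar>" by (rule lip)
    also have "\<dots> \<le> L * (2 * l)" using False L by (intro mult_left_mono) auto
    finally have "\<bar>f x\<bar> \<le> L * (2 * l)" using supp[of l] l by simp
    then show ?thesis using False by (auto simp: indicator_def)
  qed (use supp L l in \<open>simp add: zero_le_mult_iff\<close>)
  have sf: "sq_integrable f"
    using sq_integrable_bound[OF sI _ fb] borel_measurable_continuous_onI[OF cont] by blast
  have "\<bar>f y - f x\<bar> \<le> (LINT z:{x<..y}|lborel. L * indicat_real {-l<..l} z)" if xy: "x \<le> y" for x y
  proof -
    \<comment> \<open>Clamping to [-l, l] does not change the value of f, and the clamped increment
      is the length of the part of (x, y] that lies in (-l, l].\<close>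
    define c where "c z = max (-l) (min l z)" for z
    have fc: "f z = f (c z)" for z
      using supp[of z] supp[of "c z"] l by (cases "l \<le> \<bar>z\<bar>") (auto simp: c_def max_def min_def abs_if)
    have "\<bar>f y - f x\<bar> \<le> L * \<bar>c y - c x\<bar>" using lip[of "c y" "c x"] fc[of x] fc[of y] by simp
    also have "\<bar>c y - c x\<bar> = c y - c x" using xy by (auto simp: c_def)
    also have "L * (c y - c x) = (LINT z|lborel. L * indicat_real {c x<..c y} z)"
      using xy by (simp add: c_def)
    also have "\<dots> = (LINT z:{x<..y}|lborel. L * indicat_real {-l<..l} z)"
      unfolding set_lebesgue_integral_def
      by (intro Bochner_Integration.integral_cong) (auto simp: indicator_def c_def)
    finally show ?thesis .
  qed
  then show "upper_grad f (\<lambda>x. L * indicat_real {-l<..l} x)"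
    using nn L sf sq_integrable_cmult[OF sI] by (simp add: upper_grad_def)
  show "msq (\<lambda>x. L * indicat_real {-l<..l} x) = L\<^sup>2 * (2 * l)"
    using square_integrable_indicator_Ioc(2)[of "-l" l] l by (simp add: msq_def power_mult_distrib)
qed

definition tent :: "real \<Rightarrow> real" where "tent x = max 0 (1 - \<bar>x\<bar>)"

lemma tent_scaled_upper_grad:
  assumes "0 < l"
  shows "upper_grad (\<lambda>x. tent (x / l)) (\<lambda>x. 1 / l * indicat_real {-l<..l} x)"
    "msq (\<lambda>x. 1 / l * indicat_real {-l<..l} x) = 2 / l"
proof -
  have lip: "\<bar>tent (y / l) - tent (x / l)\<bar> \<le> 1 / l * \<bar>y - x\<bar>" for x y
  proof -
    have "\<bar>tent v - tent u\<bar> \<le> \<bar>v - u\<bar>" for u v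
      unfolding tent_def by linarith
    then have "\<bar>tent (y / l) - tent (x / l)\<bar> \<le> \<bar>y / l - x / l\<bar>" .
    also have "\<dots> = 1 / l * \<bar>y - x\<bar>" using assms by (simp add: abs_mult flip: diff_divide_distrib)
    finally show ?thesis .
  qed
  have supp: "tent (x / l) = 0" if "l \<le> \<bar>x\<bar>" for x
    using that assms by (simp add: tent_def)
  have nn: "0 \<le> tent (x / l)" for x by (simp add: tent_def)
  show "upper_grad (\<lambda>x. tent (x / l)) (\<lambda>x. 1 / l * indicat_real {-l<..l} x)"
    by (rule lipschitz_compact_support_upper_grad(1)[where f = "\<lambda>x. tent (x / l)", OF lip supp nn _ assms]) (use assms in auto)
  have "msq (\<lambda>x. 1 / l * indicat_real {-l<..l} x) = (1 / l)\<^sup>2 * (2 * l)"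
    by (rule lipschitz_compact_support_upper_grad(2)[where f = "\<lambda>x. tent (x / l)", OF lip supp nn _ assms]) (use assms in auto)
  then show "msq (\<lambda>x. 1 / l * indicat_real {-l<..l} x) = 2 / l"
    using assms by (simp add: power2_eq_square)
qed

text \<open>A quadratic partition of unity: as the squares sum to 1, cutting with c and s splits the
  mass of every component exactly. Both transitions take place in the annulus between R and
  2R.\<close>

definition is_cutoff_pair :: "real \<Rightarrow> (real \<Rightarrow> real) \<Rightarrow> (real \<Rightarrow> real) \<Rightarrow> bool" where
  "is_cutoff_pair R c s \<longleftrightarrow>
     (\<forall>x. 0 \<le> c x \<and> c x \<le> 1 \<and> 0 \<le> s x \<and> s x \<le> 1 \<and> (c x)\<^sup>2 + (s x)\<^sup>2 = 1) \<and>
     (\<forall>x. \<bar>x\<bar> \<le> R \<longrightarrow> c x = 1 \<and> s x = 0) \<and> (\<forall>x. 2 * R \<le> \<bar>x\<bar> \<longrightarrow> c x = 0 \<and> s x = 1) \<and>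
     (\<forall>x y. x \<le> y \<longrightarrow> \<bar>c y - c x\<bar> \<le> 2 / R * (y - x) \<and> \<bar>s y - s x\<bar> \<le> 2 / R * (y - x)) \<and>
     c \<in> borel_measurable borel \<and> s \<in> borel_measurable borel"

lemma cutoff_pair_exists:
  assumes R: "0 < R"
  shows "\<exists>c s. is_cutoff_pair R c s"
proof -
  \<comment> \<open>An angle rising from 0 to pi / 2 across the annulus; its cosine and sine form
    the pair. The slope pi / (2 R) is rounded up to 2 / R.\<close>
  define t where "t x = min 1 (max 0 ((\<bar>x\<bar> - R) / R)) * (pi / 2)" for x
  have t01: "0 \<le> t x" "t x \<le> pi / 2" for x
    using pi_gt_zero mult_right_mono[of "min 1 (max 0 ((\<bar>x\<bar> - R) / R))" 1 "pi / 2"] by (auto simp: t_def)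
  have tin: "t x = 0" if "\<bar>x\<bar> \<le> R" for x
  proof -
    have "(\<bar>x\<bar> - R) / R \<le> 0" using that R by (simp add: divide_le_0_iff)
    then show ?thesis by (simp add: t_def)
  qed
  have tout: "t x = pi / 2" if "2 * R \<le> \<bar>x\<bar>" for x
  proof -
    have "1 \<le> (\<bar>x\<bar> - R) / R" using that R by (simp add: le_divide_eq)
    then show ?thesis by (simp add: t_def)
  qed
  have tl: "\<bar>t y - t x\<bar> \<le> 2 / R * (y - x)" if "x \<le> y" for x y
  proof -
    have "\<bar>min 1 (max 0 v) - min 1 (max 0 u)\<bar> \<le> \<bar>v - u\<bar>" for u v :: real by linarith
    then have "\<bar>min 1 (max 0 ((\<bar>y\<bar> - R) / R)) - min 1 (max 0 ((\<bar>x\<bar> - R) / R))\<bar> \<le> \<bar>(\<bar>y\<bar> - R) / R - (\<bar>x\<bar> - R) / R\<bar>" .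
    also have "(\<bar>y\<bar> - R) / R - (\<bar>x\<bar> - R) / R = (\<bar>y\<bar> - \<bar>x\<bar>) / R" by (simp add: diff_divide_distrib)
    also have "\<bar>(\<bar>y\<bar> - \<bar>x\<bar>) / R\<bar> \<le> (y - x) / R"
    proof -
      have "\<bar>\<bar>y\<bar> - \<bar>x\<bar>\<bar> \<le> y - x" using that by linarith
      then have "\<bar>\<bar>y\<bar> - \<bar>x\<bar>\<bar> / R \<le> (y - x) / R" using R by (intro divide_right_mono) auto
      then show ?thesis using R by (simp only: abs_divide abs_of_pos)
    qed
    finally have *: "\<bar>min 1 (max 0 ((\<bar>y\<bar> - R) / R)) - min 1 (max 0 ((\<bar>x\<bar> - R) / R))\<bar> \<le> (y - x) / R" .
    have "\<bar>t y - t x\<bar> = \<bar>min 1 (max 0 ((\<bar>y\<bar> - R) / R)) - min 1 (max 0 ((\<bar>x\<bar> - R) / R))\<bar> * (pi / 2)"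
    proof -
      have "\<bar>pi / 2\<bar> = pi / 2" by simp
      then show ?thesis by (simp only: t_def left_diff_distrib[symmetric] abs_mult)
    qed
    also have "\<dots> \<le> (y - x) / R * 2"
    proof (rule mult_mono[OF *])
      show "pi / 2 \<le> 2" using pi_less_4 by linarith
      show "0 \<le> (y - x) / R" using that R by (intro divide_nonneg_pos) auto
      show "0 \<le> pi / 2" by simp
    qed
    also have "\<dots> = 2 / R * (y - x)" by simp
    finally show ?thesis .
  qed
  have lc: "\<bar>cos v - cos u\<bar> \<le> \<bar>v - u\<bar>" and ls: "\<bar>sin v - sin u\<bar> \<le> \<bar>v - u\<bar>" for u v :: real
    using field_differentiable_bound[of UNIV cos "\<lambda>x. - sin x" 1 v u]
      field_differentiable_bound[of UNIV sin cos 1 v u]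
    by (auto intro!: derivative_eq_intros)
  have [measurable]: "t \<in> borel_measurable borel" unfolding t_def[abs_def] by measurable
  show ?thesis
  proof (rule exI[of _ "\<lambda>x. cos (t x)"], rule exI[of _ "\<lambda>x. sin (t x)"])
    have "0 \<le> cos (t x)" "0 \<le> sin (t x)" for x
      using t01[of x] pi_gt_zero by (intro cos_ge_zero sin_ge_zero; simp)+
    moreover have "\<bar>cos (t y) - cos (t x)\<bar> \<le> 2 / R * (y - x)" if "x \<le> y" for x y
      using order_trans[OF lc tl[OF that]] .
    moreover have "\<bar>sin (t y) - sin (t x)\<bar> \<le> 2 / R * (y - x)" if "x \<le> y" for x y
      using order_trans[OF ls tl[OF that]] .
    moreover have "cos (t x) = 1" "sin (t x) = 0" if "\<bar>x\<bar> \<le> R" for x using tin[OF that] by simp_all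
    moreover have "cos (t x) = 0" "sin (t x) = 1" if "2 * R \<le> \<bar>x\<bar>" for x unfolding tout[OF that] by simp_all
    moreover have "(\<lambda>x. cos (t x)) \<in> borel_measurable borel" "(\<lambda>x. sin (t x)) \<in> borel_measurable borel"
      by measurable
    ultimately show "is_cutoff_pair R (\<lambda>x. cos (t x)) (\<lambda>x. sin (t x))"
      unfolding is_cutoff_pair_def by (intro conjI allI impI) (auto simp only: cos_le_one sin_le_one sin_cos_squared_add2)
  qed
qed

text \<open>The N dyadic annuli are disjoint, so they cannot all carry more than the fraction 1 / N
  of the integral. The radius found depends on Q but stays below \<open>R * 2 ^ N\<close>.\<close>

lemma annulus_pigeonhole:
  fixes Q :: "real \<Rightarrow> real"
  assumes Q: "integrable lborel Q" "\<And>x. 0 \<le> Q x" and R: "0 < R" and N: "0 < N"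
  obtains i where "i < N"
    "(LINT x:{x. R * 2 ^ i < \<bar>x\<bar> \<and> \<bar>x\<bar> < 2 * (R * 2 ^ i)}|lborel. Q x) \<le> (LINT x|lborel. Q x) / real N"
proof -
  define An where "An i = {x::real. R * 2 ^ i < \<bar>x\<bar> \<and> \<bar>x\<bar> < 2 * (R * 2 ^ i)}" for i :: nat
  have m: "An i \<in> sets lborel" for i unfolding An_def by measurable
  have si: "set_integrable lborel (An i) Q" for i
    unfolding set_integrable_def by (intro integrable_mult_indicator m Q(1))
  have lt: "An i \<inter> An j = {}" if "i < j" for i j
  proof -
    have "R * 2 ^ Suc i \<le> R * 2 ^ j" using that R by (intro mult_left_mono power_increasing) auto
    then show ?thesis by (auto simp: An_def)
  qed
  have disj: "disjoint_family_on An {..<N}"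
    unfolding disjoint_family_on_def using lt by (metis Int_commute nat_neq_iff)
  have "(\<Sum>i<N. LINT x:An i|lborel. Q x) = (LINT x:(\<Union>i<N. An i)|lborel. Q x)"
    by (rule set_integral_finite_Union[symmetric]) (use disj si m in auto)
  also have "\<dots> \<le> (LINT x|lborel. Q x)"
    unfolding set_lebesgue_integral_def using Q m
    by (intro integral_mono integrable_mult_indicator) (auto simp: indicator_def)
  finally have le: "(\<Sum>i<N. LINT x:An i|lborel. Q x) \<le> (LINT x|lborel. Q x)" .
  have "\<exists>i<N. (LINT x:An i|lborel. Q x) \<le> (LINT x|lborel. Q x) / real N"
  proof (rule ccontr)
    assume "\<not> ?thesis"
    then have "(\<Sum>i<N. (LINT x|lborel. Q x) / real N) < (\<Sum>i<N. LINT x:An i|lborel. Q x)"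
      using N by (intro sum_strict_mono) auto
    then show False using le N by simp
  qed
  then show ?thesis using that by (auto simp: An_def)
qed

section \<open>Effect of merging and cutting on the energy\<close>

context nls_coefficients
begin

text \<open>Expanding the product of (f^p + g^p) over two components gives both densities and two
  mixed terms. One kind is dropped; of the other only the pair (i, j) is kept, which is where the
  amplitudes are known to be large later.\<close>

lemma dens_combine3:
  assumes "\<And>j. 0 \<le> f j x" "\<And>j. 0 \<le> g j x"
  shows "dens f x + dens g x + a i j * (f i x powr p * g j x powr p) \<le> dens (combine3 f g) x"
proof -
  have t: "a k l * (f k x powr p * f l x powr p) + a k l * (g k x powr p * g l x powr p)
      + a k l * (f k x powr p * g l x powr p)
    \<le> a k l * (combine3 f g k x powr p * combine3 f g l x powr p)" for k l
  proof -
    have "(f k x powr p + g k x powr p) * (f l x powr p + g l x powr p)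
      \<le> combine3 f g k x powr p * combine3 f g l x powr p"
      unfolding combine3_def using assms p by (intro mult_mono powr_add_le_hypot_powr) auto
    moreover have "0 \<le> g k x powr p * f l x powr p" by simp
    ultimately have "f k x powr p * f l x powr p + g k x powr p * g l x powr p + f k x powr p * g l x powr p
      \<le> combine3 f g k x powr p * combine3 f g l x powr p"
      unfolding distrib_left distrib_right by linarith
    then show ?thesis
      using mult_left_mono[OF _ less_imp_le[OF a_pos[of k l]]] by (metis distrib_left)
  qed
  have "a i j * (f i x powr p * g j x powr p) \<le> (\<Sum>l\<in>UNIV. a i l * (f i x powr p * g l x powr p))"
    by (rule member_le_sum[where f = "\<lambda>l. a i l * (f i x powr p * g l x powr p)"])
      (auto intro!: mult_nonneg_nonneg simp: less_imp_le[OF a_pos])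
  also have "\<dots> \<le> (\<Sum>k\<in>UNIV. \<Sum>l\<in>UNIV. a k l * (f k x powr p * g l x powr p))"
    by (rule member_le_sum[where f = "\<lambda>k. \<Sum>l\<in>UNIV. a k l * (f k x powr p * g l x powr p)"])
      (auto intro!: sum_nonneg mult_nonneg_nonneg simp: less_imp_le[OF a_pos])
  finally have "dens f x + dens g x + a i j * (f i x powr p * g j x powr p)
    \<le> dens f x + dens g x + (\<Sum>k\<in>UNIV. \<Sum>l\<in>UNIV. a k l * (f k x powr p * g l x powr p))" by simp
  also have "\<dots> = (\<Sum>k\<in>UNIV. \<Sum>l\<in>UNIV. a k l * (f k x powr p * f l x powr p) + a k l * (g k x powr p * g l x powr p)
      + a k l * (f k x powr p * g l x powr p))"
    by (simp add: dens_def sum.distrib mult.assoc)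
  also have "\<dots> \<le> (\<Sum>k\<in>UNIV. \<Sum>l\<in>UNIV. a k l * (combine3 f g k x powr p * combine3 f g l x powr p))"
    by (intro sum_mono t)
  also have "\<dots> = dens (combine3 f g) x" by (simp add: dens_def mult.assoc)
  finally show ?thesis .
qed

lemma pot_combine3:
  assumes f: "ug3 f h" and g: "ug3 g k"
  shows "integrable lborel (\<lambda>x. f i x powr p * g j x powr p)"
    and "pot f + pot g + 1 / p * a i j * (LINT x|lborel. f i x powr p * g j x powr p) \<le> pot (combine3 f g)"
proof -
  have uf: "upper_grad (f j) (h j)" and ug: "upper_grad (g j) (k j)" for j
    using f g by (simp_all add: ug3_def)
  note [measurable] = upper_gradD(6)[OF uf] upper_gradD(6)[OF ug]
  have id: "integrable lborel (dens f)" "integrable lborel (dens g)" "integrable lborel (dens (combine3 f g))"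
    using dens_integrable ug3_combine3[OF f g] f g by blast+
  have D: "dens f x + dens g x + a i j * (f i x powr p * g j x powr p) \<le> dens (combine3 f g) x" for x
    by (rule dens_combine3; rule upper_gradD(1)[OF uf] upper_gradD(1)[OF ug])
  show i: "integrable lborel (\<lambda>x. f i x powr p * g j x powr p)"
  proof (rule Bochner_Integration.integrable_bound)
    show "integrable lborel (\<lambda>x. 1 / a i j * dens (combine3 f g) x)" using id by simp
    have "f i x powr p * g j x powr p \<le> 1 / a i j * dens (combine3 f g) x" for x
    proof -
      have "a i j * (f i x powr p * g j x powr p) \<le> dens (combine3 f g) x"
        using D[of x] dens_nonneg[of f x] dens_nonneg[of g x] by linarith
      then show ?thesis using a_pos[of i j] by (simp add: field_simps)
    qed
    then show "AE x in lborel. norm (f i x powr p * g j x powr p) \<le> norm (1 / a i j * dens (combine3 f g) x)"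
      using dens_nonneg a_pos[of i j] by (auto simp: abs_mult)
  qed simp
  have "(LINT x|lborel. dens f x) + (LINT x|lborel. dens g x) + a i j * (LINT x|lborel. f i x powr p * g j x powr p)
    = (LINT x|lborel. dens f x + dens g x + a i j * (f i x powr p * g j x powr p))"
    using id i by simp
  also have "\<dots> \<le> (LINT x|lborel. dens (combine3 f g) x)"
    using id i D by (intro integral_mono) auto
  finally have "1 / p * ((LINT x|lborel. dens f x) + (LINT x|lborel. dens g x) + a i j * (LINT x|lborel. f i x powr p * g j x powr p))
    \<le> 1 / p * (LINT x|lborel. dens (combine3 f g) x)" using p by (intro mult_left_mono) auto
  then show "pot f + pot g + 1 / p * a i j * (LINT x|lborel. f i x powr p * g j x powr p) \<le> pot (combine3 f g)"
    by (simp add: pot_def distrib_left mult.assoc)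
qed

lemma energy_combine3:
  assumes f: "ug3 f h" and g: "ug3 g k"
  shows "kin (combine3 h k) - pot (combine3 f g)
    \<le> (kin h - pot f) + (kin k - pot g) - 1 / p * a i j * (LINT x|lborel. f i x powr p * g j x powr p)"
proof -
  have "sq_integrable (h j)" "sq_integrable (k j)" for j
    using f g upper_gradD(4) unfolding ug3_def by blast+
  then show ?thesis using pot_combine3(2)[OF f g, of i j] kin_combine3[of h k] by simp
qed

text \<open>A height c at the origin persists as c / 2 up to distance c^2 / (4 K), by the Hoelder
  estimate with derivative bound K; both functions are therefore large on a common interval of
  length c^2 / (2 K).\<close>

lemma cross_lower_bound:
  assumes f: "ug3 f h" and g: "ug3 g k" and K: "msq (h i) \<le> K" "msq (k j) \<le> K" "0 < K"
    and c: "0 < c" "c \<le> f i 0" "c \<le> g j 0"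
  shows "c\<^sup>2 / (2 * K) * ((c / 2) powr p * (c / 2) powr p) \<le> (LINT x|lborel. f i x powr p * g j x powr p)"
proof -
  have uf: "upper_grad (f j) (h j)" and ug: "upper_grad (g j) (k j)" for j
    using f g by (simp_all add: ug3_def)
  define d where "d = c\<^sup>2 / (4 * K)"
  have d: "0 < d" using c K by (simp add: d_def)
  have half: "c / 2 \<le> u x" if u: "upper_grad u v" "msq v \<le> K" "c \<le> u 0" and x: "\<bar>x\<bar> \<le> d" for u v x
  proof -
    have "(u x - u 0)\<^sup>2 \<le> \<bar>x - 0\<bar> * msq v"
      using upper_grad_increment_sq[OF u(1), where x = 0 and y = x] by (simp add: msq_def)
    also have "\<dots> \<le> d * K" using x u(2) d by (intro mult_mono) (auto simp: msq_nonneg)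
    also have "\<dots> = (c / 2)\<^sup>2" using K by (simp add: d_def power2_eq_square)
    finally have "\<bar>u x - u 0\<bar> \<le> c / 2" using c by (simp add: abs_le_square_iff[symmetric] flip: abs_le_square_iff)
    then show ?thesis using u(3) by linarith
  qed
  let ?v = "(c / 2) powr p * (c / 2) powr p"
  have "c\<^sup>2 / (2 * K) * ?v = ?v * (d - (- d))" by (simp add: d_def)
  also have "\<dots> = (LINT x|lborel. ?v * indicat_real {-d<..d} x)" using d by simp
  also have "\<dots> \<le> (LINT x|lborel. f i x powr p * g j x powr p)"
  proof (rule integral_mono)
    show "integrable lborel (\<lambda>x. ?v * indicat_real {-d<..d} x)"
      using d by (intro integrable_mult_right) (simp add: integrable_indicator_iff)
    show "integrable lborel (\<lambda>x. f i x powr p * g j x powr p)" by (rule pot_combine3(1)[OF f g])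
    fix x
    show "?v * indicat_real {-d<..d} x \<le> f i x powr p * g j x powr p"
    proof (cases "\<bar>x\<bar> \<le> d")
      case True
      have "?v \<le> f i x powr p * g j x powr p"
        using half[OF uf K(1) c(2) True] half[OF ug K(2) c(3) True] c p
        by (intro mult_mono powr_mono2) auto
      moreover have "?v * indicat_real {-d<..d} x \<le> ?v" by (simp add: indicator_def)
      ultimately show ?thesis by linarith
    next
      case False
      then have "indicat_real {-d<..d} x = 0" by (auto simp: indicator_def)
      then show ?thesis by simp
    qed
  qed
  finally show ?thesis .
qed

text \<open>The cutoffs have slope l = 2 / R. Since their squares sum to 1, the kinetic term is
  reproduced up to cross terms of size 4 l = 8 / R. Potential energy can be lost only on the
  annulus, for elsewhere one of the two parts coincides with f.\<close>

lemma energy_cutoff_split: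
  assumes f: "ug3 f h" and R: "2 \<le> R" and S: "\<And>j x. (f j x)\<^sup>2 \<le> S"
  shows "\<exists>A hA B hB. ug3 A hA \<and> ug3 B hB \<and> (\<forall>j. msq (A j) + msq (B j) = msq (f j)) \<and>
    kin hA + kin hB \<le> kin h + 8 / R * (kin f + kin h) \<and>
    (kin hA - pot A) + (kin hB - pot B) \<le> kin h - pot f + 8 / R * (kin f + kin h)
      + Asum * S powr (p - 1) * (LINT x:{x. R < \<bar>x\<bar> \<and> \<bar>x\<bar> < 2 * R}|lborel. \<Sum>j\<in>UNIV. (f j x)\<^sup>2) \<and>
    (\<forall>j x. \<bar>x\<bar> \<le> R \<longrightarrow> A j x = f j x) \<and> (\<forall>j x. 2 * R \<le> \<bar>x\<bar> \<longrightarrow> B j x = f j x)"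
proof -
  have u: "upper_grad (f j) (h j)" for j using f by (simp add: ug3_def)
  have R0: "0 < R" using R by simp
  obtain c s where cp: "is_cutoff_pair R c s" using cutoff_pair_exists[OF R0] by blast
  note cp' = cp[unfolded is_cutoff_pair_def]
  have c: "\<And>x. 0 \<le> c x" "\<And>x. c x \<le> 1" and s: "\<And>x. 0 \<le> s x" "\<And>x. s x \<le> 1"
    and cs: "\<And>x. (c x)\<^sup>2 + (s x)\<^sup>2 = 1"
    using conjunct1[OF cp'] by blast+
  have inn: "c x = 1" "s x = 0" if "\<bar>x\<bar> \<le> R" for x
    using conjunct1[OF conjunct2[OF cp']] that by blast+
  have out: "c x = 0" "s x = 1" if "2 * R \<le> \<bar>x\<bar>" for x
    using conjunct1[OF conjunct2[OF conjunct2[OF cp']]] that by blast+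
  have lip: "\<bar>c y - c x\<bar> \<le> 2 / R * (y - x)" "\<bar>s y - s x\<bar> \<le> 2 / R * (y - x)" if "x \<le> y" for x y
    using conjunct1[OF conjunct2[OF conjunct2[OF conjunct2[OF cp']]]] that by blast+
  have m: "c \<in> borel_measurable borel" "s \<in> borel_measurable borel"
    using conjunct2[OF conjunct2[OF conjunct2[OF conjunct2[OF cp']]]] by blast+
  define l where "l = 2 / R"
  have l: "0 \<le> l" "l \<le> 1" using R by (auto simp: l_def)
  define A hA B hB where "A j x = c x * f j x" and "hA j x = c x * h j x + l * f j x"
    and "B j x = s x * f j x" and "hB j x = s x * h j x + l * f j x" for j x
  have uA: "upper_grad (A j) (hA j)" for j
    unfolding A_def[abs_def] hA_def[abs_def] l_def
    by (rule upper_grad_cutoff[OF u c lip(1) _ m(1)]) (use R in auto)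
  have uB: "upper_grad (B j) (hB j)" for j
    unfolding B_def[abs_def] hB_def[abs_def] l_def
    by (rule upper_grad_cutoff[OF u s lip(2) _ m(2)]) (use R in auto)
  have A3: "ug3 A hA" and B3: "ug3 B hB" using uA uB by (auto simp: ug3_def)
  have mass: "msq (A j) + msq (B j) = msq (f j)" for j
  proof -
    have "msq (A j) + msq (B j) = (LINT x|lborel. (A j x)\<^sup>2 + (B j x)\<^sup>2)"
      using upper_gradD(8)[OF uA] upper_gradD(8)[OF uB] by (simp add: msq_def)
    also have "\<dots> = msq (f j)"
      unfolding msq_def
    proof (intro Bochner_Integration.integral_cong refl)
      fix x
      have "(A j x)\<^sup>2 + (B j x)\<^sup>2 = ((c x)\<^sup>2 + (s x)\<^sup>2) * (f j x)\<^sup>2"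
        by (simp add: A_def B_def power_mult_distrib algebra_simps)
      then show "(A j x)\<^sup>2 + (B j x)\<^sup>2 = (f j x)\<^sup>2" using cs by simp
    qed
    finally show ?thesis .
  qed
  have kj: "msq (hA j) + msq (hB j) \<le> msq (h j) + 4 * l * (msq (f j) + msq (h j))" for j
  proof -
    note i = upper_gradD(8)[OF u, of j] upper_gradD(9)[OF u, of j]
    have "msq (hA j) + msq (hB j) = (LINT x|lborel. (hA j x)\<^sup>2 + (hB j x)\<^sup>2)"
      using upper_gradD(9)[OF uA] upper_gradD(9)[OF uB] by (simp add: msq_def)
    also have "\<dots> \<le> (LINT x|lborel. (h j x)\<^sup>2 + 4 * l * ((f j x)\<^sup>2 + (h j x)\<^sup>2))"
    proof (rule integral_mono)
      show "integrable lborel (\<lambda>x. (hA j x)\<^sup>2 + (hB j x)\<^sup>2)"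
        using upper_gradD(9)[OF uA] upper_gradD(9)[OF uB] by simp
      show "integrable lborel (\<lambda>x. (h j x)\<^sup>2 + 4 * l * ((f j x)\<^sup>2 + (h j x)\<^sup>2))" using i by simp
      fix x
      let ?f = "f j x" and ?h = "h j x"
      have fh: "0 \<le> ?f * ?h" "2 * (?f * ?h) \<le> ?f\<^sup>2 + ?h\<^sup>2"
        using upper_gradD(1)[OF u, of j x] upper_gradD(2)[OF u, of j x] sum_squares_bound[of ?f ?h] by auto
      have "(hA j x)\<^sup>2 + (hB j x)\<^sup>2 = ((c x)\<^sup>2 + (s x)\<^sup>2) * ?h\<^sup>2 + 2 * l * (c x + s x) * (?f * ?h) + 2 * (l * l) * ?f\<^sup>2"
        by (simp add: hA_def hB_def power2_eq_square algebra_simps)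
      also have "\<dots> = ?h\<^sup>2 + 2 * l * (c x + s x) * (?f * ?h) + 2 * (l * l) * ?f\<^sup>2"
        by (simp add: cs)
      also have "2 * l * (c x + s x) * (?f * ?h) \<le> 2 * l * 2 * (?f * ?h)"
        using c[of x] s[of x] l fh by (intro mult_right_mono mult_left_mono) auto
      also have "2 * l * 2 * (?f * ?h) = 2 * l * (2 * (?f * ?h))" by simp
      also have "\<dots> \<le> 2 * l * (?f\<^sup>2 + ?h\<^sup>2)" using fh l by (intro mult_left_mono) auto
      also have "2 * (l * l) * ?f\<^sup>2 \<le> 2 * (l * 1) * (?f\<^sup>2 + ?h\<^sup>2)"
        using l by (intro mult_mono mult_left_mono) auto
      finally show "(hA j x)\<^sup>2 + (hB j x)\<^sup>2 \<le> ?h\<^sup>2 + 4 * l * (?f\<^sup>2 + ?h\<^sup>2)" by (simp add: algebra_simps)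
    qed
    also have "\<dots> = msq (h j) + 4 * l * (msq (f j) + msq (h j))" using i by (simp add: msq_def)
    finally show ?thesis .
  qed
  have k: "kin hA + kin hB \<le> kin h + 8 / R * (kin f + kin h)"
  proof -
    have "kin hA + kin hB = (\<Sum>j\<in>UNIV. msq (hA j) + msq (hB j))" by (simp add: kin_def sum.distrib)
    also have "\<dots> \<le> (\<Sum>j\<in>UNIV. msq (h j) + 4 * l * (msq (f j) + msq (h j)))" by (intro sum_mono kj)
    also have "\<dots> = kin h + 4 * l * (kin f + kin h)"
      by (simp add: kin_def sum.distrib flip: sum_distrib_left)
    finally show ?thesis by (simp add: l_def)
  qed
  let ?An = "{x. R < \<bar>x\<bar> \<and> \<bar>x\<bar> < 2 * R}"
  let ?Q = "\<lambda>x. \<Sum>j\<in>UNIV. (f j x)\<^sup>2"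
  define C where "C = Asum * S powr (p - 1)"
  have C: "0 \<le> C" using Asum_pos by (simp add: C_def)
  have ann: "?An \<in> sets lborel" by measurable
  have iQ: "integrable lborel (\<lambda>x. indicat_real ?An x *\<^sub>R ?Q x)"
    by (intro integrable_mult_indicator ann Bochner_Integration.integrable_sum upper_gradD(8)[OF u])
  have dA: "integrable lborel (dens A)" "integrable lborel (dens B)" "integrable lborel (dens f)"
    using dens_integrable A3 B3 f by blast+
  have dl: "dens f x \<le> dens A x + dens B x + C * (indicat_real ?An x *\<^sub>R ?Q x)" for x
  proof -
    consider "\<bar>x\<bar> \<le> R" | "2 * R \<le> \<bar>x\<bar>" | "x \<in> ?An" by force
    then show ?thesis
    proof cases
      case 1
      then have "dens A x = dens f x" by (simp add: dens_def A_def inn)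
      then show ?thesis using dens_nonneg[of B x] C by (simp add: sum_nonneg)
    next
      case 2
      then have "dens B x = dens f x" by (simp add: dens_def B_def out)
      then show ?thesis using dens_nonneg[of A x] C by (simp add: sum_nonneg)
    next
      case 3
      have "dens f x \<le> C * ?Q x"
        unfolding C_def by (rule dens_le) (use upper_gradD(1)[OF u] S in auto)
      then show ?thesis using 3 dens_nonneg[of A x] dens_nonneg[of B x] by simp
    qed
  qed
  have "(LINT x|lborel. dens f x) \<le> (LINT x|lborel. dens A x + dens B x + C * (indicat_real ?An x *\<^sub>R ?Q x))"
    using dA iQ dl by (intro integral_mono) auto
  also have "\<dots> = (LINT x|lborel. dens A x) + (LINT x|lborel. dens B x) + C * (LINT x:?An|lborel. ?Q x)"
    using dA iQ by (simp add: set_lebesgue_integral_def)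
  finally have I: "(LINT x|lborel. dens f x) \<le> (LINT x|lborel. dens A x) + (LINT x|lborel. dens B x) + C * (LINT x:?An|lborel. ?Q x)" .
  have Qn: "0 \<le> (LINT x:?An|lborel. ?Q x)"
    unfolding set_lebesgue_integral_def by (rule integral_nonneg_AE) (auto simp: sum_nonneg)
  have "pot f \<le> 1 / p * ((LINT x|lborel. dens A x) + (LINT x|lborel. dens B x) + C * (LINT x:?An|lborel. ?Q x))"
    unfolding pot_def using I p by (intro mult_left_mono) auto
  also have "\<dots> = pot A + pot B + 1 / p * (C * (LINT x:?An|lborel. ?Q x))"
    by (simp add: pot_def distrib_left)
  also have "1 / p * (C * (LINT x:?An|lborel. ?Q x)) \<le> 1 * (C * (LINT x:?An|lborel. ?Q x))"
    using p C Qn by (intro mult_right_mono) auto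
  finally have P: "pot f \<le> pot A + pot B + C * (LINT x:?An|lborel. ?Q x)" by simp
  have "kin hA - pot A + (kin hB - pot B) \<le> kin h - pot f + 8 / R * (kin f + kin h)
      + Asum * S powr (p - 1) * (LINT x:?An|lborel. ?Q x)"
    using k P unfolding C_def by linarith
  moreover have "A j x = f j x" if "\<bar>x\<bar> \<le> R" for j x using inn(1)[OF that] by (simp add: A_def)
  moreover have "B j x = f j x" if "2 * R \<le> \<bar>x\<bar>" for j x using out(2)[OF that] by (simp add: B_def)
  ultimately show ?thesis
    using A3 B3 mass k by (intro exI[of _ A] exI[of _ hA] exI[of _ B] exI[of _ hB] conjI allI impI)
qed

end

section \<open>Tightness of almost minimizers\<close>

lemma integral_dilate:
  fixes u :: "real \<Rightarrow> real"
  assumes "0 < l"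
  shows "(LINT x|lborel. u (x / l)) = l * (LINT x|lborel. u x)"
  using lborel_integral_real_affine[of l "\<lambda>x. u (x / l)" 0] assms by simp

lemma tent_lower: "\<bar>x\<bar> \<le> 1 / 2 \<Longrightarrow> 1 / 2 \<le> tent x"
  by (auto simp: tent_def)

lemma (in nls_coefficients) tent_integrals_pos:
  shows "0 < msq tent" "integrable lborel (\<lambda>x. tent x powr p * tent x powr p)"
    "0 < (LINT x|lborel. tent x powr p * tent x powr p)"
proof -
  have u: "upper_grad tent (\<lambda>x. 1 / 1 * indicat_real {-1<..1} x)"
    using tent_scaled_upper_grad(1)[of 1] by simp
  then have "ug3 (\<lambda>_. tent) (\<lambda>_ x. 1 / 1 * indicat_real {-1<..1} x)" by (simp add: ug3_def)
  from pot_combine3(1)[OF this this]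
  show i: "integrable lborel (\<lambda>x. tent x powr p * tent x powr p)" by simp
  have iI: "integrable lborel (\<lambda>x. c * indicat_real {-1/2<..1/2::real} x)" for c :: real
    by (intro integrable_mult_right) (simp add: integrable_indicator_iff)
  have I: "(LINT x|lborel. c * indicat_real {-1/2<..1/2::real} x) = c" for c :: real by simp
  have in2: "\<bar>x\<bar> \<le> 1 / 2" if "x \<in> {-1/2<..1/2::real}" for x :: real using that by auto
  have "1 / 4 = (LINT x|lborel. 1 / 4 * indicat_real {-1/2<..1/2::real} x)" by (rule I[symmetric])
  also have "\<dots> \<le> msq tent"
    unfolding msq_def
  proof (rule integral_mono[OF iI upper_gradD(8)[OF u]])
    fix x
    show "1 / 4 * indicat_real {-1/2<..1/2::real} x \<le> (tent x)\<^sup>2"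
      using power_mono[OF tent_lower[OF in2], of x 2]
      by (cases "x \<in> {-1/2<..1/2::real}") (simp_all add: power2_eq_square)
  qed
  finally show "0 < msq tent" by simp
  let ?v = "(1 / 2) powr p * (1 / 2) powr p :: real"
  have "?v = (LINT x|lborel. ?v * indicat_real {-1/2<..1/2::real} x)" by (rule I[symmetric])
  also have "\<dots> \<le> (LINT x|lborel. tent x powr p * tent x powr p)"
  proof (rule integral_mono[OF iI i])
    fix x
    show "?v * indicat_real {-1/2<..1/2::real} x \<le> tent x powr p * tent x powr p"
    proof (cases "x \<in> {-1/2<..1/2::real}")
      case True
      have "?v \<le> tent x powr p * tent x powr p"
        using tent_lower[OF in2[OF True]] p by (intro mult_mono powr_mono2) auto
      then show ?thesis using True by simp
    qed simp
  qed
  finally show "0 < (LINT x|lborel. tent x powr p * tent x powr p)"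
    by (rule less_le_trans[rotated]) simp
qed

text \<open>
  A profile of width \<open>l\<close> and fixed mass has kinetic energy of order \<open>l\<^sup>-\<^sup>2\<close> and potential energy of
  order \<open>l\<^sup>1\<^sup>-\<^sup>p\<close>; since \<open>p < 3\<close>, the latter wins for large \<open>l\<close>.
\<close>

lemma (in nls_coefficients) exists_negative_energy:
  assumes "0 < \<beta>" "0 \<le> C"
  shows "\<exists>\<kappa>>0. \<forall>M. (\<forall>i. 0 \<le> M i \<and> M i \<le> C) \<longrightarrow> \<beta> \<le> M j \<longrightarrow>
     (\<exists>f h. ug3 f h \<and> (\<forall>i. msq (f i) = M i) \<and> kin h - pot f \<le> - \<kappa>)"
proof -
  define t0 where "t0 = msq tent"
  define P0 where "P0 = (LINT x|lborel. tent x powr p * tent x powr p)"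
  have t0: "0 < t0" and P0: "0 < P0" using tent_integrals_pos by (simp_all add: t0_def P0_def)
  \<comment> \<open>The coefficients of 1 / l^2 in the kinetic bound for three tents of width l and
    of l^(1-p) in the potential bound. For the potential only the self-interaction of component j is
    counted, the one whose mass is bounded below.\<close>
  define c1 where "c1 = 3 * (2 * C / t0)"
  define c2 where "c2 = 1 / p * a j j * (\<beta> / t0) powr p * P0"
  have c1: "0 \<le> c1" using assms t0 by (simp add: c1_def)
  have c2: "0 < c2" using assms t0 P0 a_pos[of j j] p by (simp add: c2_def)
  \<comment> \<open>Solves c2 l^(3-p) = c1 + 1, so the potential exceeds the kinetic bound by
    exactly 1 / l^2.\<close>
  define l where "l = ((c1 + 1) / c2) powr (1 / (3 - p))"
  have l: "0 < l" using c1 c2 by (simp add: l_def)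
  have lp: "l powr (3 - p) = (c1 + 1) / c2" using p c1 c2 by (simp add: l_def powr_powr)
  have key: "\<exists>f h. ug3 f h \<and> (\<forall>i. msq (f i) = M i) \<and> kin h - pot f \<le> - (1 / l\<^sup>2)"
    if M: "\<And>i. 0 \<le> M i" "\<And>i. M i \<le> C" and Mj: "\<beta> \<le> M j" for M
  proof -
    \<comment> \<open>Normalises the mass: the tent of width l has mass
      \<open>l * t0\<close>.\<close>
    define b where "b i = sqrt (M i / (l * t0))" for i
    have b: "0 \<le> b i" "(b i)\<^sup>2 = M i / (l * t0)" for i using M[of i] l t0 by (auto simp: b_def)
    define f where "f i x = b i * tent (x / l)" for i x
    define h where "h i x = b i * (1 / l * indicat_real {-l<..l} x)" for i x
    have u: "ug3 f h"
      unfolding ug3_def f_def[abs_def] h_def[abs_def]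
      by (intro allI upper_grad_scale tent_scaled_upper_grad(1) l b)
    have mt: "msq (\<lambda>x. tent (x / l)) = l * t0"
      using integral_dilate[OF l, of "\<lambda>x. (tent x)\<^sup>2"] by (simp add: msq_def t0_def)
    have mf: "msq (f i) = M i" for i
      using l t0 by (simp add: f_def[abs_def] msq_scale mt b)
    have mh: "msq (h i) \<le> 2 * C / t0 * (1 / l\<^sup>2)" for i
    proof -
      have "msq (h i) = M i / (l * t0) * (2 / l)"
        unfolding h_def[abs_def] msq_scale[of "b i"] tent_scaled_upper_grad(2)[OF l] b(2) ..
      also have "\<dots> = 2 * M i / t0 * (1 / l\<^sup>2)"
        by (simp add: power2_eq_square mult.commute mult.left_commute)
      also have "\<dots> \<le> 2 * C / t0 * (1 / l\<^sup>2)"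
        using M(2)[of i] t0 by (intro mult_right_mono divide_right_mono) auto
      finally show ?thesis .
    qed
    have "kin h \<le> (\<Sum>i\<in>(UNIV::3 set). 2 * C / t0 * (1 / l\<^sup>2))"
      unfolding kin_def by (intro sum_mono mh)
    also have "\<dots> = c1 * (1 / l\<^sup>2)" by (simp add: c1_def)
    finally have K: "kin h \<le> c1 * (1 / l\<^sup>2)" .
    have ptw: "a j j * (M j / (l * t0)) powr p * (tent (x / l) powr p * tent (x / l) powr p) \<le> dens f x" for x
    proof -
      have e: "f j x powr p * f j x powr p = (M j / (l * t0)) powr p * (tent (x / l) powr p * tent (x / l) powr p)"
      proof -
        have "f j x powr p * f j x powr p = (b j powr p * b j powr p) * (tent (x / l) powr p * tent (x / l) powr p)"
          using b(1)[of j] by (simp add: f_def powr_mult tent_def)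
        also have "b j powr p * b j powr p = ((b j)\<^sup>2) powr p"
          using b(1)[of j] by (simp add: power2_eq_square powr_mult)
        finally show ?thesis by (simp add: b(2))
      qed
      have nn: "0 \<le> a k i * f k x powr p * f i x powr p" for k i
        using less_imp_le[OF a_pos[of k i]] by simp
      have "a j j * f j x powr p * f j x powr p \<le> (\<Sum>i\<in>UNIV. a j i * f j x powr p * f i x powr p)"
        by (rule member_le_sum[where f = "\<lambda>i. a j i * f j x powr p * f i x powr p"]) (use nn in auto)
      also have "\<dots> \<le> dens f x"
        unfolding dens_def
        by (rule member_le_sum[where f = "\<lambda>k. \<Sum>i\<in>UNIV. a k i * f k x powr p * f i x powr p"])
          (use nn in \<open>auto intro: sum_nonneg\<close>)
      finally show ?thesis by (simp add: mult.assoc e)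
    qed
    have it: "integrable lborel (\<lambda>x. tent (x / l) powr p * tent (x / l) powr p)"
      using lborel_integrable_real_affine[OF tent_integrals_pos(2), of "1 / l" 0] l by simp
    have "a j j * (M j / (l * t0)) powr p * (l * P0)
      = (LINT x|lborel. a j j * (M j / (l * t0)) powr p * (tent (x / l) powr p * tent (x / l) powr p))"
      using integral_dilate[OF l, of "\<lambda>x. tent x powr p * tent x powr p"] by (simp add: P0_def)
    also have "\<dots> \<le> (LINT x|lborel. dens f x)"
      using it dens_integrable[OF u] ptw by (intro integral_mono) auto
    finally have "1 / p * (a j j * (M j / (l * t0)) powr p * (l * P0)) \<le> pot f"
      unfolding pot_def using p by (intro mult_left_mono) auto
    moreover have "(\<beta> / t0 / l) powr p \<le> (M j / (l * t0)) powr p"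
      using Mj assms t0 l p by (intro powr_mono2) (auto simp: field_simps)
    then have "1 / p * (a j j * (\<beta> / t0 / l) powr p * (l * P0)) \<le> 1 / p * (a j j * (M j / (l * t0)) powr p * (l * P0))"
      using p l P0 a_pos[of j j] by (intro mult_left_mono mult_right_mono) auto
    moreover have "1 / p * (a j j * (\<beta> / t0 / l) powr p * (l * P0)) = c2 * (l powr (3 - p) * (1 / l\<^sup>2))"
    proof -
      have e1: "(\<beta> / t0 / l) powr p = (\<beta> / t0) powr p * l powr (- p)"
        using assms t0 l by (simp add: powr_divide powr_minus powr_mult field_simps)
      have e2: "l powr (- p) * l = l powr (3 - p) * (1 / l\<^sup>2)"
      proof -
        have "l powr (- p) * l = l powr (- p) * l powr 1" using l by simp
        also have "\<dots> = l powr (3 - p) * l powr (- 2)" by (simp only: powr_add[symmetric]) simp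
        also have "l powr (- 2) = 1 / l\<^sup>2" using l by (simp add: powr_minus divide_inverse)
        finally show ?thesis .
      qed
      have "1 / p * (a j j * (\<beta> / t0 / l) powr p * (l * P0)) = c2 * (l powr (- p) * l)"
        unfolding e1 c2_def by (simp only: mult_ac)
      then show ?thesis unfolding e2 .
    qed
    moreover have "c2 * (l powr (3 - p) * (1 / l\<^sup>2)) = (c1 + 1) * (1 / l\<^sup>2)"
      using c2 by (simp add: lp)
    ultimately have "(c1 + 1) * (1 / l\<^sup>2) \<le> pot f" by linarith
    then have "kin h - pot f \<le> - (1 / l\<^sup>2)" using K unfolding distrib_right by linarith
    then show ?thesis using u mf by blast
  qed
  show ?thesis
  proof (rule exI[of _ "1 / l\<^sup>2"], intro conjI allI impI)
    show "0 < 1 / l\<^sup>2" using l by simp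
    fix M :: "3 \<Rightarrow> real" assume "\<forall>i. 0 \<le> M i \<and> M i \<le> C" "\<beta> \<le> M j"
    then show "\<exists>f h. ug3 f h \<and> (\<forall>i. msq (f i) = M i) \<and> kin h - pot f \<le> - (1 / l\<^sup>2)"
      using key[of M] by simp
  qed
qed

text \<open>\<open>L\<close> enters as a lower bound over upper-gradient pairs with the prescribed
  masses. It is later instantiated with the energy of a given minimizer, where
  \<open>energy_ge\<close> holds because every such pair dominates a genuine element of
  \<open>Y\<close>.\<close>

locale minimization = nls_coefficients +
  fixes m :: "3 \<Rightarrow> real" and L :: real
  assumes m_pos: "\<And>j. 0 < m j"
    and energy_ge: "\<And>f h. ug3 f h \<Longrightarrow> (\<And>j. msq (f j) = m j) \<Longrightarrow> L \<le> kin h - pot f"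
begin

definition mtot :: real where "mtot = (\<Sum>j\<in>UNIV. m j)"

lemma m_le_mtot: "m j \<le> mtot"
  unfolding mtot_def by (rule member_le_sum) (auto simp: less_imp_le[OF m_pos])

lemma mtot_pos: "0 < mtot"
  using m_pos[of 1] m_le_mtot[of 1] by linarith

lemma kin_eq_mtot: "(\<And>j. msq (f j) = m j) \<Longrightarrow> kin f = mtot"
  by (simp add: kin_def mtot_def)

lemma L_neg: "L < 0"
proof -
  obtain \<kappa> where "0 < \<kappa>" and k: "\<And>M. (\<forall>i. 0 \<le> M i \<and> M i \<le> mtot) \<Longrightarrow> m 1 \<le> M 1 \<Longrightarrow>
     (\<exists>f h. ug3 f h \<and> (\<forall>i. msq (f i) = M i) \<and> kin h - pot f \<le> - \<kappa>)"
    using exists_negative_energy[OF m_pos[of 1] less_imp_le[OF mtot_pos], of 1] by blast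
  obtain f h where "ug3 f h" "\<forall>i. msq (f i) = m i" "kin h - pot f \<le> - \<kappa>"
    using k[of m] m_le_mtot less_imp_le[OF m_pos] by blast
  then show ?thesis using energy_ge[of f h] \<open>0 < \<kappa>\<close> by simp
qed

lemma small_amplitude:
  assumes "0 < \<kappa>"
  obtains c where "0 < c" "c \<le> 1"
    "\<And>f h. ug3 f h \<Longrightarrow> kin f \<le> mtot \<Longrightarrow> (\<And>j x. f j x \<le> c) \<Longrightarrow> pot f \<le> \<kappa>"
proof -
  \<comment> \<open>For c \<le> 1 and p \<ge> 2 the power (c^2)^(p-1) is at most c, so the potential
    is at most \<open>Asum * c * mtot\<close>.\<close>
  define c where "c = min 1 (\<kappa> / (Asum * mtot))"
  have AM: "0 < Asum * mtot" using Asum_pos mtot_pos by simp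
  have c: "0 < c" "c \<le> 1" using assms AM by (auto simp: c_def)
  have "pot f \<le> \<kappa>" if u: "ug3 f h" and M: "kin f \<le> mtot" and fc: "\<And>j x. f j x \<le> c" for f h
  proof -
    have f0: "0 \<le> f j x" for j x
      using upper_gradD(1)[of "f j" "h j" x] u by (simp add: ug3_def)
    have "pot f \<le> Asum * (c\<^sup>2) powr (p - 1) * kin f"
      using fc f0 by (intro pot_le[OF u] power_mono) auto
    also have "\<dots> \<le> Asum * c * mtot"
    proof (intro mult_mono M)
      have "c\<^sup>2 \<le> c" using c by (simp add: power2_eq_square mult_le_one)
      have "(c\<^sup>2) powr (p - 1) \<le> (c\<^sup>2) powr 1"
        using c p by (intro powr_mono') (auto simp: power_le_one)
      then show "(c\<^sup>2) powr (p - 1) \<le> c" using \<open>c\<^sup>2 \<le> c\<close> c by simp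
    qed (use Asum_pos mtot_pos c kin_nonneg in auto)
    also have "\<dots> \<le> \<kappa>"
    proof -
      have "c \<le> \<kappa> / (Asum * mtot)" by (simp add: c_def)
      then show ?thesis using AM by (simp add: le_divide_eq mult.commute mult.left_commute)
    qed
    finally show ?thesis .
  qed
  then show ?thesis using that c by blast
qed

text \<open>Energy at most L / 2 < 0 requires potential energy at least -L / 2, whereas uniformly
  small amplitude would keep it below -L / 4.\<close>

lemma nonvanishing:
  obtains c where "0 < c"
    "\<And>f h. ug3 f h \<Longrightarrow> (\<And>j. msq (f j) = m j) \<Longrightarrow> kin h - pot f \<le> L / 2 \<Longrightarrow> \<exists>j x. c \<le> f j x"
proof -
  obtain c where c: "0 < c"
    "\<And>f h. ug3 f h \<Longrightarrow> kin f \<le> mtot \<Longrightarrow> (\<And>j x. f j x \<le> c) \<Longrightarrow> pot f \<le> - L / 4"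
    using small_amplitude[of "- L / 4"] L_neg by (metis divide_pos_pos neg_0_less_iff_less zero_less_numeral)
  have "\<exists>j x. c \<le> f j x" if u: "ug3 f h" and M: "\<And>j. msq (f j) = m j" and E: "kin h - pot f \<le> L / 2" for f h
  proof (rule ccontr)
    assume "\<not> ?thesis"
    then have "f j x \<le> c" for j x by (meson linear)
    then have "pot f \<le> - L / 4" using c(2)[OF u] kin_eq_mtot[OF M] by simp
    then show False using E kin_nonneg[of h] L_neg by linarith
  qed
  then show ?thesis using that c(1) by blast
qed

text \<open>
  Cut \<open>f\<close> at an annulus carrying little mass into an inner part \<open>A\<close> and an outer part \<open>B\<close>. If \<open>B\<close> is not
  small in amplitude, translating it on top of \<open>A\<close> and merging both by \<open>\<surd>(A\<^sup>2 + B\<^sup>2)\<close> keeps the masses and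
  lowers the energy by a fixed amount. If \<open>B\<close> is small in amplitude but carries mass, replacing it by a
  wide tent of the same mass lowers the energy as well. Both contradict almost minimality.
\<close>

lemma tightness:
  assumes \<beta>: "0 < \<beta>" and c0: "0 < c0" and CK: "0 \<le> CK"
  shows "\<exists>\<delta>>0. \<exists>R. \<forall>f h. ug3 f h \<longrightarrow> (\<forall>i. msq (f i) = m i) \<longrightarrow> kin h \<le> CK \<longrightarrow>
    kin h - pot f \<le> L + \<delta> \<longrightarrow> (\<exists>i. c0 \<le> f i 0) \<longrightarrow>
    (LINT x:{x. R < \<bar>x\<bar>}|lborel. (f j x)\<^sup>2) \<le> \<beta>"
proof -
  obtain \<kappa>1 where k1: "0 < \<kappa>1" and neg: "\<And>M. (\<forall>i. 0 \<le> M i \<and> M i \<le> mtot) \<Longrightarrow> \<beta> \<le> M j \<Longrightarrow>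
     (\<exists>f h. ug3 f h \<and> (\<forall>i. msq (f i) = M i) \<and> kin h - pot f \<le> - \<kappa>1)"
    using exists_negative_energy[OF \<beta> less_imp_le[OF mtot_pos], of j] by blast
  obtain c1 where c1: "0 < c1" "c1 \<le> 1"
    and small: "\<And>f h. ug3 f h \<Longrightarrow> kin f \<le> mtot \<Longrightarrow> (\<And>j x. f j x \<le> c1) \<Longrightarrow> pot f \<le> \<kappa>1 / 4"
    using small_amplitude[of "\<kappa>1 / 4"] k1 by (metis divide_pos_pos zero_less_numeral)
  define c where "c = min c0 c1"
  have c: "0 < c" "c \<le> c0" "c \<le> c1" using c0 c1 by (auto simp: c_def)
  \<comment> \<open>Bounds the kinetic energies of the two parts after cutting: the cut adds at most
    8 / R \<le> 4 times the total of mass and kinetic energy.\<close>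
  define K where "K = 5 * (mtot + CK)"
  have K: "0 < K" using mtot_pos CK by (simp add: K_def)
  define amin where "amin = Min (range (\<lambda>(k, i). a k i))"
  have amin: "0 < amin" unfolding amin_def by (subst Min_gr_iff) (auto simp: a_pos)
  have amin_le: "amin \<le> a k i" for k i
  proof -
    have "a k i \<in> range (\<lambda>(k, i). a k i)" by (rule range_eqI[of _ _ "(k, i)"]) simp
    then show ?thesis unfolding amin_def by (intro Min_le) auto
  qed
  define v where "v = c\<^sup>2 / (2 * K) * ((c / 2) powr p * (c / 2) powr p)"
  have v: "0 < v" using c K by (simp add: v_def)
  \<comment> \<open>The energy gained by merging two parts of amplitude c, whichever components are
    the large ones; hence the smallest coefficient \<open>amin\<close>.\<close>
  define \<kappa>2 where "\<kappa>2 = 1 / p * amin * v"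
  have k2: "0 < \<kappa>2" using p amin v by (simp add: \<kappa>2_def)
  \<comment> \<open>After the cut the two energies sum to at most L + 2 \<kappa>. Merging gains
    \<open>\<kappa>2\<close>, at least 8 \<kappa>; replacing a flat outer part of energy at least
    -\<open>\<kappa>1\<close>/4 by one of energy at most -\<open>\<kappa>1\<close> gains 3/4 of
    \<open>\<kappa>1\<close>, at least 6 \<kappa>. Either way the result would lie below L.\<close>
  define \<kappa> where "\<kappa> = min \<kappa>1 \<kappa>2 / 8"
  have k: "0 < \<kappa>" "8 * \<kappa> \<le> \<kappa>1" "8 * \<kappa> \<le> \<kappa>2" using k1 k2 by (auto simp: \<kappa>_def)
  define S where "S = 2 * mtot + 2 * CK"
  \<comment> \<open>Each cutting error is allowed \<kappa> / 2: \<open>R0\<close> makes the slope of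
    the cutoffs small enough for the kinetic error, N makes the mass in the chosen annulus small
    enough for the potential error.\<close>
  define R0 where "R0 = max 2 (16 * (mtot + CK) / \<kappa>)"
  have R0: "2 \<le> R0" by (simp add: R0_def)
  define N :: nat where "N = nat \<lceil>2 * (Asum * S powr (p - 1) * mtot) / \<kappa>\<rceil> + 1"
  have N: "0 < N" by (simp add: N_def)
  have N': "Asum * S powr (p - 1) * (mtot / real N) \<le> \<kappa> / 2"
  proof -
    have "2 * (Asum * S powr (p - 1) * mtot) / \<kappa> \<le> real N" unfolding N_def by linarith
    then have "2 * (Asum * S powr (p - 1) * mtot) \<le> \<kappa> * real N"
      using k(1) by (simp add: divide_le_eq mult.commute)
    then show ?thesis using N by (simp add: field_simps)
  qed
  \<comment> \<open>The cutting radius depends on f, but it never exceeds \<open>R0 * 2 ^ N\<close>;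
    outside twice this radius f coincides with its outer part, so one radius serves all f.\<close>
  have "(LINT x:{x. 2 * (R0 * 2 ^ N) < \<bar>x\<bar>}|lborel. (f j x)\<^sup>2) \<le> \<beta>"
    if f: "ug3 f h" and M: "\<And>i. msq (f i) = m i" and kh: "kin h \<le> CK"
      and E: "kin h - pot f \<le> L + \<kappa>" and ex: "c0 \<le> f k 0" for f h k
  proof -
    have u: "upper_grad (f i) (h i)" for i using f by (simp add: ug3_def)
    have kf: "kin f = mtot" using kin_eq_mtot[OF M] .
    have Sb: "(f i x)\<^sup>2 \<le> S" for i x
      using ug3_sup_bound[OF f, of 1 i x] kf kh by (simp add: S_def)
    let ?Q = "\<lambda>x. \<Sum>i\<in>UNIV. (f i x)\<^sup>2"
    have iQ: "integrable lborel ?Q" by (intro Bochner_Integration.integrable_sum upper_gradD(8)[OF u])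
    have IQ: "(LINT x|lborel. ?Q x) = mtot"
      using upper_gradD(8)[OF u] kf by (simp add: kin_def msq_def)
    have "0 < R0" using R0 by simp
    obtain n where n: "n < N" and
      "(LINT x:{x. R0 * 2 ^ n < \<bar>x\<bar> \<and> \<bar>x\<bar> < 2 * (R0 * 2 ^ n)}|lborel. ?Q x) \<le> (LINT x|lborel. ?Q x) / real N"
      by (rule annulus_pigeonhole[OF iQ sum_nonneg \<open>0 < R0\<close> N]) auto
    define R where "R = R0 * 2 ^ n"
    have An: "(LINT x:{x. R < \<bar>x\<bar> \<and> \<bar>x\<bar> < 2 * R}|lborel. ?Q x) \<le> mtot / real N"
      using \<open>(LINT x:{x. R0 * 2 ^ n < \<bar>x\<bar> \<and> \<bar>x\<bar> < 2 * (R0 * 2 ^ n)}|lborel. ?Q x) \<le> (LINT x|lborel. ?Q x) / real N\<close>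
      unfolding R_def IQ .
    have "R0 * 1 \<le> R" unfolding R_def using R0 by (intro mult_left_mono) auto
    then have R: "R0 \<le> R" "2 \<le> R" using R0 by auto
    have err1: "8 / R * (kin f + kin h) \<le> \<kappa> / 2"
    proof -
      have "16 * (mtot + CK) / \<kappa> \<le> R" using R(1) by (simp add: R0_def)
      then have "16 * (mtot + CK) \<le> \<kappa> * R" using k(1) by (simp add: divide_le_eq mult.commute)
      then have "16 * (kin f + kin h) \<le> \<kappa> * R" using kf kh by simp
      then show ?thesis using R(2) by (simp add: field_simps)
    qed
    have err2: "Asum * S powr (p - 1) * (LINT x:{x. R < \<bar>x\<bar> \<and> \<bar>x\<bar> < 2 * R}|lborel. ?Q x) \<le> \<kappa> / 2"
      by (rule order_trans[OF mult_left_mono[OF An] N']) (use Asum_pos in simp)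
    obtain A hA B hB where A: "ug3 A hA" and B: "ug3 B hB" and AB': "\<forall>j. msq (A j) + msq (B j) = msq (f j)"
      and kAB: "kin hA + kin hB \<le> kin h + 8 / R * (kin f + kin h)"
      and EAB: "(kin hA - pot A) + (kin hB - pot B) \<le> kin h - pot f + 8 / R * (kin f + kin h)
        + Asum * S powr (p - 1) * (LINT x:{x. R < \<bar>x\<bar> \<and> \<bar>x\<bar> < 2 * R}|lborel. ?Q x)"
      and Af': "\<forall>j x. \<bar>x\<bar> \<le> R \<longrightarrow> A j x = f j x" and Bf': "\<forall>j x. 2 * R \<le> \<bar>x\<bar> \<longrightarrow> B j x = f j x"
      using energy_cutoff_split[OF f R(2) Sb] by (elim exE conjE) (rule that; assumption)
    have AB: "msq (A j) + msq (B j) = msq (f j)" for j using AB' by blast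
    have Af: "A j x = f j x" if "\<bar>x\<bar> \<le> R" for j x using Af' that by blast
    have Bf: "B j x = f j x" if "2 * R \<le> \<bar>x\<bar>" for j x using Bf' that by blast
    have uA: "upper_grad (A i) (hA i)" and uB: "upper_grad (B i) (hB i)" for i
      using A B by (simp_all add: ug3_def)
    have EAB': "(kin hA - pot A) + (kin hB - pot B) \<le> L + 2 * \<kappa>"
      using EAB err1 err2 E by linarith
    have "8 / R * (kin f + kin h) \<le> 4 * (kin f + kin h)"
      using R(2) kin_nonneg[of f] kin_nonneg[of h] by (intro mult_right_mono) (auto simp: divide_le_eq)
    with kAB have "kin hA + kin hB \<le> kin h + 4 * (kin f + kin h)" by linarith
    also have "\<dots> \<le> K" using kf kh mtot_pos unfolding K_def by simp
    finally have KAB: "kin hA \<le> K" "kin hB \<le> K"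
      using kin_nonneg[of hA] kin_nonneg[of hB] by linarith+
    have mB: "0 \<le> msq (B i)" "msq (B i) \<le> mtot" for i
      using AB[of i] msq_nonneg[of "A i"] msq_nonneg[of "B i"] M[of i] m_le_mtot[of i] by linarith+
    have kB: "kin B \<le> mtot"
    proof -
      have "kin B \<le> kin f" unfolding kin_def
        by (intro sum_mono) (use AB msq_nonneg in \<open>metis le_add_same_cancel2\<close>)
      then show ?thesis using kf by simp
    qed
    have A0: "c \<le> A k 0" using Af[of 0 k] ex c R(2) by simp
    have Bsmall: "B i x \<le> c" for i x
    proof (rule ccontr)
      assume "\<not> B i x \<le> c"
      then have Bx: "c \<le> B i x" by simp
      \<comment> \<open>The large value of the outer part is moved to the origin, where component k
        of \<open>A\<close> is large as well.\<close>
      define B' hB' where "B' j z = B j (z + x)" and "hB' j z = hB j (z + x)" for j z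
      have B': "ug3 B' hB'"
        unfolding ug3_def B'_def[abs_def] hB'_def[abs_def] by (intro allI upper_grad_shift uB)
      have mB': "msq (B' j) = msq (B j)" and mhB': "msq (hB' j) = msq (hB j)" for j
        unfolding B'_def[abs_def] hB'_def[abs_def] by (intro msq_shift upper_gradD(3,4)[OF uB])+
      have kB': "kin hB' = kin hB" unfolding kin_def mhB' ..
      have pB': "pot B' = pot B"
        using lborel_integral_real_affine[of 1 "dens B" x]
        by (simp add: pot_def dens_def B'_def add.commute)
      have "L \<le> kin (combine3 hA hB') - pot (combine3 A B')"
      proof (rule energy_ge[OF ug3_combine3[OF A B']])
        show "msq (combine3 A B' j) = m j" for j
          using msq_combine3[OF upper_gradD(3)[OF uA], of B' j] mB' AB M
            upper_gradD(3)[of "B' j" "hB' j"] B' by (simp add: ug3_def)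
      qed
      also have "\<dots> \<le> (kin hA - pot A) + (kin hB' - pot B') - 1 / p * a k i * (LINT x|lborel. A k x powr p * B' i x powr p)"
        by (rule energy_combine3[OF A B'])
      also have "\<dots> \<le> L + 2 * \<kappa> - \<kappa>2"
      proof -
        have "v \<le> (LINT x|lborel. A k x powr p * B' i x powr p)"
          unfolding v_def
          by (rule cross_lower_bound[OF A B' _ _ K c(1) A0])
            (use KAB msq_le_kin[of hA k] msq_le_kin[of hB i] mhB' Bx in \<open>auto simp: B'_def\<close>)
        then have "1 / p * amin * v \<le> 1 / p * a k i * (LINT x|lborel. A k x powr p * B' i x powr p)"
          using p amin amin_le[of k i] v by (intro mult_mono) auto
        then show ?thesis using EAB' unfolding kB' pB' \<kappa>2_def by linarith
      qed
      finally show False using k by linarith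
    qed
    have EB: "- (\<kappa>1 / 4) \<le> kin hB - pot B"
    proof -
      have "pot B \<le> \<kappa>1 / 4" using Bsmall c(3) by (intro small[OF B kB]) (meson order_trans)
      then show ?thesis using kin_nonneg[of hB] by linarith
    qed
    have "msq (B j) \<le> \<beta>"
    proof (rule ccontr)
      assume "\<not> msq (B j) \<le> \<beta>"
      then obtain g h' where g: "ug3 g h'" "\<forall>i. msq (g i) = msq (B i)" "kin h' - pot g \<le> - \<kappa>1"
        using neg[of "\<lambda>i. msq (B i)"] mB by force
      have "L \<le> kin (combine3 hA h') - pot (combine3 A g)"
      proof (rule energy_ge[OF ug3_combine3[OF A g(1)]])
        show "msq (combine3 A g i) = m i" for i
          using msq_combine3[OF upper_gradD(3)[OF uA], of g i] g(2) AB M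
            upper_gradD(3)[of "g i" "h' i"] g(1) by (simp add: ug3_def)
      qed
      also have "\<dots> \<le> (kin hA - pot A) + (kin h' - pot g) - 1 / p * a k k * (LINT x|lborel. A k x powr p * g k x powr p)"
        by (rule energy_combine3[OF A g(1)])
      also have "\<dots> \<le> (kin hA - pot A) + (kin h' - pot g)"
      proof -
        have "0 \<le> (LINT x|lborel. A k x powr p * g k x powr p)" by (rule integral_nonneg_AE) simp
        then have "0 \<le> 1 / p * a k k * (LINT x|lborel. A k x powr p * g k x powr p)"
          using p less_imp_le[OF a_pos[of k k]] by (intro mult_nonneg_nonneg) auto
        then show ?thesis by linarith
      qed
      finally show False using EAB' EB g(3) k k1 by linarith
    qed
    moreover have "(LINT x:{x. 2 * (R0 * 2 ^ N) < \<bar>x\<bar>}|lborel. (f j x)\<^sup>2) \<le> msq (B j)"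
      unfolding set_lebesgue_integral_def msq_def
    proof (rule integral_mono)
      show "integrable lborel (\<lambda>x. indicat_real {x. 2 * (R0 * 2 ^ N) < \<bar>x\<bar>} x *\<^sub>R (f j x)\<^sup>2)"
        by (intro integrable_mult_indicator upper_gradD(8)[OF u]) measurable
      show "integrable lborel (\<lambda>x. (B j x)\<^sup>2)" by (rule upper_gradD(8)[OF uB])
      have "R \<le> R0 * 2 ^ N" unfolding R_def using n R0 by (intro mult_left_mono power_increasing) auto
      then show "indicat_real {x. 2 * (R0 * 2 ^ N) < \<bar>x\<bar>} x *\<^sub>R (f j x)\<^sup>2 \<le> (B j x)\<^sup>2" for x
        using Bf[of x j] by (cases "2 * (R0 * 2 ^ N) < \<bar>x\<bar>") auto
    qed
    ultimately show ?thesis by linarith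
  qed
  then show ?thesis using k(1) by blast
qed

end

section \<open>Compactness in the square-integrable functions\<close>

lemma nn_integral_cmod_sq:
  assumes "u \<in> L2"
  shows "(\<integral>\<^sup>+x. ennreal ((cmod (u x))\<^sup>2) \<partial>lborel) = ennreal (msq (\<lambda>x. cmod (u x)))"
  unfolding msq_def using assms by (intro nn_integral_eq_integral) (auto simp: L2_def)

lemma L2_Fatou:
  assumes u: "\<And>k. u k \<in> L2" and lim: "AE x in lborel. (\<lambda>k. u k x) \<longlonglongrightarrow> v x"
    and v: "v \<in> borel_measurable borel" and e: "eventually (\<lambda>k. msq (\<lambda>x. cmod (u k x)) \<le> e) sequentially"
  shows "v \<in> L2" "msq (\<lambda>x. cmod (v x)) \<le> e"
proof -
  have [measurable]: "u k \<in> borel_measurable borel" for k using u by (simp add: L2_iff)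
  note [measurable] = v
  obtain k0 where "msq (\<lambda>x. cmod (u k0 x)) \<le> e" using e by (auto simp: eventually_sequentially)
  then have e0: "0 \<le> e" using msq_nonneg[of "\<lambda>x. cmod (u k0 x)"] by linarith
  have "(\<integral>\<^sup>+x. ennreal ((cmod (v x))\<^sup>2) \<partial>lborel) = (\<integral>\<^sup>+x. liminf (\<lambda>k. ennreal ((cmod (u k x))\<^sup>2)) \<partial>lborel)"
  proof (rule nn_integral_cong_AE)
    show "AE x in lborel. ennreal ((cmod (v x))\<^sup>2) = liminf (\<lambda>k. ennreal ((cmod (u k x))\<^sup>2))"
      using lim
    proof eventually_elim
      case (elim x)
      have "(\<lambda>k. ennreal ((cmod (u k x))\<^sup>2)) \<longlonglongrightarrow> ennreal ((cmod (v x))\<^sup>2)"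
        by (intro tendsto_intros elim)
      then show ?case using lim_imp_Liminf[OF sequentially_bot] by metis
    qed
  qed
  also have "\<dots> \<le> liminf (\<lambda>k. \<integral>\<^sup>+x. ennreal ((cmod (u k x))\<^sup>2) \<partial>lborel)"
    by (rule nn_integral_liminf) simp
  also have "\<dots> \<le> ennreal e"
  proof (rule Liminf_le)
    show "\<forall>\<^sub>F k in sequentially. (\<integral>\<^sup>+x. ennreal ((cmod (u k x))\<^sup>2) \<partial>lborel) \<le> ennreal e"
      using e by eventually_elim (simp add: nn_integral_cmod_sq[OF u] ennreal_leI)
  qed simp
  finally have le: "(\<integral>\<^sup>+x. ennreal ((cmod (v x))\<^sup>2) \<partial>lborel) \<le> ennreal e" .
  have "integrable lborel (\<lambda>x. (cmod (v x))\<^sup>2)"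
  proof (rule integrableI_bounded)
    show "(\<integral>\<^sup>+x. ennreal (norm ((cmod (v x))\<^sup>2)) \<partial>lborel) < \<infinity>"
      using le_less_trans[OF le] by simp
  qed simp
  then show vL: "v \<in> L2" using v by (simp add: L2_def)
  show "msq (\<lambda>x. cmod (v x)) \<le> e" using le e0 by (simp add: nn_integral_cmod_sq[OF vL])
qed

text \<open>Riesz-Fischer: a rapidly Cauchy subsequence converges almost everywhere, and Fatou turns
  the Cauchy bounds into convergence in norm of the whole sequence.\<close>

lemma L2_complete:
  fixes F :: "nat \<Rightarrow> real \<Rightarrow> complex"
  assumes F: "\<And>n. F n \<in> L2"
    and Cauchy: "\<And>e. 0 < e \<Longrightarrow> \<exists>N. \<forall>k\<ge>N. \<forall>n\<ge>N. msq (\<lambda>x. cmod (F k x - F n x)) \<le> e"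
  shows "\<exists>G. G \<in> L2 \<and> (\<lambda>n. msq (\<lambda>x. cmod (F n x - G x))) \<longlonglongrightarrow> 0"
proof -
  have [measurable]: "F n \<in> borel_measurable borel" for n using F by (simp add: L2_iff)
  have "\<exists>N. \<forall>k. \<forall>i\<ge>N k. \<forall>n\<ge>N k. msq (\<lambda>x. cmod (F i x - F n x)) \<le> (1/4) ^ k"
    by (rule choice) (use Cauchy in simp)
  then obtain N where N: "\<forall>k. \<forall>i\<ge>N k. \<forall>n\<ge>N k. msq (\<lambda>x. cmod (F i x - F n x)) \<le> (1/4) ^ k" by blast
  \<comment> \<open>Indices that dominate both N k and k and never decrease; consecutive ones are
    then within (1/4)^k of each other.\<close>
  define r where "r k = (\<Sum>i\<le>k. N i) + k" for k
  have rN: "N k \<le> r k" for k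
    unfolding r_def by (intro trans_le_add1 member_le_sum) auto
  have r_Suc: "r k \<le> r (Suc k)" for k by (simp add: r_def)
  have rk: "k \<le> r k" for k by (simp add: r_def)
  define d where "d k x = F (r (Suc k)) x - F (r k) x" for k x
  have dL: "d k \<in> L2" for k unfolding d_def using L2_diff F by blast
  have [measurable]: "d k \<in> borel_measurable borel" for k using dL by (simp add: L2_iff)
  have md: "msq (\<lambda>x. cmod (d k x)) \<le> (1/4) ^ k" for k
    unfolding d_def using N rN[of k] order_trans[OF rN r_Suc] by blast
  \<comment> \<open>With weights 2^k the sum of squared increments still has finite integral. Almost
    everywhere the increments are thus bounded by a constant times a geometric sequence, hence
    summable.\<close>
  have "(\<integral>\<^sup>+x. (\<Sum>k. ennreal (2 ^ k * (cmod (d k x))\<^sup>2)) \<partial>lborel) = (\<Sum>k. \<integral>\<^sup>+x. ennreal (2 ^ k * (cmod (d k x))\<^sup>2) \<partial>lborel)"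
    by (rule nn_integral_suminf) simp
  also have "\<dots> \<le> (\<Sum>k. ennreal ((1/2) ^ k))"
  proof (rule suminf_le)
    fix k
    have "(\<integral>\<^sup>+x. ennreal (2 ^ k * (cmod (d k x))\<^sup>2) \<partial>lborel) = ennreal (2 ^ k) * ennreal (msq (\<lambda>x. cmod (d k x)))"
      by (simp add: ennreal_mult nn_integral_cmult nn_integral_cmod_sq[OF dL])
    also have "\<dots> = ennreal (2 ^ k * msq (\<lambda>x. cmod (d k x)))" by (simp add: ennreal_mult msq_nonneg)
    also have "\<dots> \<le> ennreal (2 ^ k * (1/4) ^ k)" by (intro ennreal_leI mult_left_mono md) simp
    also have "(2::real) ^ k * (1/4) ^ k = (1/2) ^ k" by (simp flip: power_mult_distrib)
    finally show "(\<integral>\<^sup>+x. ennreal (2 ^ k * (cmod (d k x))\<^sup>2) \<partial>lborel) \<le> ennreal ((1/2) ^ k)" .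
  qed simp_all
  also have "\<dots> = ennreal (\<Sum>k. (1/2) ^ k)"
    by (rule suminf_ennreal2) (auto intro: summable_geometric)
  also have "\<dots> < \<infinity>" by simp
  finally have "(\<integral>\<^sup>+x. (\<Sum>k. ennreal (2 ^ k * (cmod (d k x))\<^sup>2)) \<partial>lborel) \<noteq> \<infinity>" by simp
  then have fin: "AE x in lborel. (\<Sum>k. ennreal (2 ^ k * (cmod (d k x))\<^sup>2)) \<noteq> \<infinity>"
    by (intro nn_integral_noteq_infinite) simp_all
  define G where "G x = lim (\<lambda>k. F (r k) x)" for x
  have Gm: "G \<in> borel_measurable borel" unfolding G_def by (rule borel_measurable_lim_metric) simp
  have conv: "AE x in lborel. (\<lambda>k. F (r k) x) \<longlonglongrightarrow> G x"
    using fin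
  proof eventually_elim
    case (elim x)
    define T where "T = enn2real (\<Sum>k. ennreal (2 ^ k * (cmod (d k x))\<^sup>2))"
    have T: "2 ^ k * (cmod (d k x))\<^sup>2 \<le> T" for k
    proof -
      have "ennreal (2 ^ k * (cmod (d k x))\<^sup>2) \<le> (\<Sum>k. ennreal (2 ^ k * (cmod (d k x))\<^sup>2))"
        using ennreal_suminf_lessD[of "\<lambda>k. ennreal (2 ^ k * (cmod (d k x))\<^sup>2)" _ k] less_irrefl not_le
        by blast
      also have "\<dots> = ennreal T" using elim unfolding T_def by (simp add: less_top)
      finally show ?thesis by (simp add: T_def ennreal_le_iff)
    qed
    have "summable (\<lambda>k. d k x)"
    proof (rule summable_comparison_test')
      show "summable (\<lambda>k. sqrt T * (sqrt (1/2)) ^ k)"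
        by (intro summable_mult summable_geometric) (simp add: real_sqrt_divide)
      fix k
      have "(cmod (d k x))\<^sup>2 \<le> T * (1/2) ^ k"
        using T[of k] by (simp add: power_one_over field_simps)
      then have "cmod (d k x) \<le> sqrt (T * (1/2) ^ k)" by (rule real_le_rsqrt)
      also have "\<dots> = sqrt T * (sqrt (1/2)) ^ k" by (simp only: real_sqrt_mult real_sqrt_power)
      finally show "norm (d k x) \<le> sqrt T * (sqrt (1/2)) ^ k" by simp
    qed
    then have "(\<lambda>n. \<Sum>k<n. d k x) \<longlonglongrightarrow> (\<Sum>k. d k x)" by (rule summable_LIMSEQ)
    then have "(\<lambda>n. F (r 0) x + (\<Sum>k<n. d k x)) \<longlonglongrightarrow> F (r 0) x + (\<Sum>k. d k x)" by (intro tendsto_intros)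
    moreover have "F (r 0) x + (\<Sum>k<n. d k x) = F (r n) x" for n
      unfolding d_def by (subst sum_lessThan_telescope) simp
    ultimately have "convergent (\<lambda>n. F (r n) x)" by (auto simp: convergent_def)
    then show ?case by (simp add: G_def convergent_LIMSEQ_iff)
  qed
  have main: "\<exists>N. \<forall>n\<ge>N. G \<in> L2 \<and> msq (\<lambda>x. cmod (F n x - G x)) \<le> e" if e: "0 < e" for e
  proof -
    obtain N where N: "\<forall>k\<ge>N. \<forall>n\<ge>N. msq (\<lambda>x. cmod (F k x - F n x)) \<le> e" using Cauchy[OF e] by blast
    have "G \<in> L2 \<and> msq (\<lambda>x. cmod (F n x - G x)) \<le> e" if n: "n \<ge> N" for n
    proof -
      have u: "(\<lambda>x. F n x - F (r k) x) \<in> L2" for k using L2_diff F by blast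
      have l: "AE x in lborel. (\<lambda>k. F n x - F (r k) x) \<longlonglongrightarrow> F n x - G x"
        using conv by eventually_elim (intro tendsto_intros)
      have ev: "\<forall>\<^sub>F k in sequentially. msq (\<lambda>x. cmod (F n x - F (r k) x)) \<le> e"
        unfolding eventually_sequentially using N n rk order_trans by blast
      have m: "(\<lambda>x. F n x - G x) \<in> borel_measurable borel" using Gm by simp
      note * = L2_Fatou[OF u l m ev]
      have "(\<lambda>x. F n x - (F n x - G x)) \<in> L2" by (rule L2_diff[OF F *(1)])
      then show ?thesis using *(2) by simp
    qed
    then show ?thesis by blast
  qed
  have "G \<in> L2" using main[of 1] by auto
  moreover have "(\<lambda>n. msq (\<lambda>x. cmod (F n x - G x))) \<longlonglongrightarrow> 0"
  proof (rule LIMSEQ_I)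
    fix e :: real assume "0 < e"
    then obtain N where "\<forall>n\<ge>N. msq (\<lambda>x. cmod (F n x - G x)) \<le> e / 2" using main[of "e / 2"] by auto
    then have "\<forall>n\<ge>N. norm (msq (\<lambda>x. cmod (F n x - G x)) - 0) < e"
      using \<open>0 < e\<close> msq_nonneg by (auto simp: abs_of_nonneg)
    then show "\<exists>N. \<forall>n\<ge>N. norm (msq (\<lambda>x. cmod (F n x - G x)) - 0) < e" by blast
  qed
  ultimately show ?thesis by blast
qed

text \<open>A diagonal subsequence converges at all rational points in all components; the uniform
  Hoelder bound makes it Cauchy at every other point. Pointwise convergence is enough because
  tightness and domination supply the rest.\<close>

lemma equicontinuous_pointwise_subsequence:
  fixes V :: "nat \<Rightarrow> 3 \<Rightarrow> real \<Rightarrow> complex"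
  assumes bdd: "\<And>n j x. cmod (V n j x) \<le> B"
    and eq: "\<And>n j x y. (cmod (V n j y - V n j x))\<^sup>2 \<le> \<bar>y - x\<bar> * K"
  obtains r w where "strict_mono (r :: nat \<Rightarrow> nat)" "\<And>j x. (\<lambda>n. V (r n) j x) \<longlonglongrightarrow> w j x"
proof -
  let ?S = "(UNIV :: 3 set) \<times> \<rat>"
  have "countable ?S" by (intro countable_SIGMA countable_rat) simp
  then obtain r :: "nat \<Rightarrow> nat" where r: "strict_mono r"
    and lim: "\<And>z. z \<in> ?S \<Longrightarrow> \<exists>l. (\<lambda>n. (\<lambda>n (j, x). V n j x) (r n) z) \<longlonglongrightarrow> l"
    by (rule function_convergent_subsequence[where f = "\<lambda>n (j, x). V n j x" and M = B])
      (use bdd in auto)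
  have K: "0 \<le> K" using eq[of 0 undefined 1 0] by (auto intro: order_trans[OF zero_le_power2])
  have "Cauchy (\<lambda>n. V (r n) j x)" for j x
  proof (rule metric_CauchyI)
    fix e :: real assume e: "0 < e"
    define t where "t = (e / 3)\<^sup>2 / (K + 1)"
    have t: "0 < t" using e K by (simp add: t_def)
    obtain q where q: "q \<in> \<rat>" "x < q" "q < x + t" using Rats_dense_in_real[of x "x + t"] t by auto
    have close: "cmod (V n j q - V n j x) < e / 3" for n
    proof -
      have "(cmod (V n j q - V n j x))\<^sup>2 \<le> \<bar>q - x\<bar> * K" by (rule eq)
      also have "\<dots> \<le> \<bar>q - x\<bar> * (K + 1)" by (intro mult_left_mono) auto
      also have "\<dots> < t * (K + 1)" using q K by (intro mult_strict_right_mono) auto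
      also have "\<dots> = (e / 3)\<^sup>2" using K by (simp add: t_def)
      finally show ?thesis using e by (intro power2_less_imp_less[of _ "e / 3"]) auto
    qed
    obtain l where "(\<lambda>n. V (r n) j q) \<longlonglongrightarrow> l" using lim[of "(j, q)"] q by auto
    then have "Cauchy (\<lambda>n. V (r n) j q)" by (rule LIMSEQ_imp_Cauchy)
    then obtain N where N: "\<And>k n. k \<ge> N \<Longrightarrow> n \<ge> N \<Longrightarrow> dist (V (r k) j q) (V (r n) j q) < e / 3"
      using metric_CauchyD[of _ "e / 3"] e by (metis divide_pos_pos zero_less_numeral)
    have "dist (V (r k) j x) (V (r n) j x) < e" if "k \<ge> N" "n \<ge> N" for k n
    proof -
      have "V (r k) j x - V (r n) j x = (V (r k) j q - V (r n) j q) - (V (r k) j q - V (r k) j x) + (V (r n) j q - V (r n) j x)"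
        by simp
      then have "cmod (V (r k) j x - V (r n) j x) \<le> cmod (V (r k) j q - V (r n) j q) + cmod (V (r k) j q - V (r k) j x) + cmod (V (r n) j q - V (r n) j x)"
        by (metis (no_types, lifting) add_right_mono norm_triangle_ineq norm_triangle_ineq4 order_trans)
      then show ?thesis using N[OF that] close[of "r k"] close[of "r n"] by (simp add: dist_norm)
    qed
    then show "\<exists>N. \<forall>k\<ge>N. \<forall>n\<ge>N. dist (V (r k) j x) (V (r n) j x) < e" by blast
  qed
  then have "(\<lambda>n. V (r n) j x) \<longlonglongrightarrow> lim (\<lambda>n. V (r n) j x)" for j x
    using Cauchy_convergent convergent_LIMSEQ_iff by blast
  then show ?thesis using that[OF r, of "\<lambda>j x. lim (\<lambda>n. V (r n) j x)"] by blast
qed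

text \<open>On a bounded interval the uniform bound permits dominated convergence. Outside it the
  sequence has small mass, and by Fatou so does the limit.\<close>

lemma tight_pointwise_imp_L2_convergent:
  fixes u :: "nat \<Rightarrow> real \<Rightarrow> complex"
  assumes u: "\<And>n. u n \<in> L2" and B: "\<And>n x. cmod (u n x) \<le> B" and M: "\<And>n. msq (\<lambda>x. cmod (u n x)) \<le> M"
    and lim: "\<And>x. (\<lambda>n. u n x) \<longlonglongrightarrow> w x"
    and tight: "\<And>\<beta>. 0 < \<beta> \<Longrightarrow> \<exists>R N. \<forall>n\<ge>N. (LINT x:{x. R < \<bar>x\<bar>}|lborel. (cmod (u n x))\<^sup>2) \<le> \<beta>"
  shows "w \<in> L2" "(\<lambda>n. msq (\<lambda>x. cmod (u n x - w x))) \<longlonglongrightarrow> 0"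
proof -
  have [measurable]: "u n \<in> borel_measurable borel" for n using u by (simp add: L2_iff)
  have wm[measurable]: "w \<in> borel_measurable borel"
    by (rule borel_measurable_LIMSEQ_metric[of u]) (use lim in auto)
  show wL: "w \<in> L2"
    by (rule L2_Fatou(1)[of u w M]) (use u lim M in auto)
  have wB: "cmod (w x) \<le> B" for x
    by (rule LIMSEQ_le_const2[OF tendsto_norm[OF lim[of x]]]) (use B in auto)
  have dL: "(\<lambda>x. u n x - w x) \<in> L2" for n by (rule L2_diff[OF u wL])
  show "(\<lambda>n. msq (\<lambda>x. cmod (u n x - w x))) \<longlonglongrightarrow> 0"
  proof (rule LIMSEQ_I)
    fix e :: real assume e: "0 < e"
    \<comment> \<open>Two tails of mass at most e / 8 give at most e / 2 through the inequality for
      the square of a sum; the bounded part contributes less than e / 4.\<close>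
    obtain R0 N0 where N0: "\<forall>n\<ge>N0. (LINT x:{x. R0 < \<bar>x\<bar>}|lborel. (cmod (u n x))\<^sup>2) \<le> e / 8"
      using tight[of "e / 8"] e by auto
    define O1 where "O1 = {x::real. R0 < \<bar>x\<bar>}"
    have O1m[measurable]: "O1 \<in> sets borel" unfolding O1_def by measurable
    define v where "v n x = indicat_real O1 x *\<^sub>R u n x" for n x
    have v_eq: "(cmod (v n x))\<^sup>2 = indicat_real O1 x *\<^sub>R (cmod (u n x))\<^sup>2" for n x
      by (simp add: v_def indicator_def)
    have iu: "integrable lborel (\<lambda>x. indicat_real O1 x *\<^sub>R (cmod (u n x))\<^sup>2)" for n
      using u by (intro integrable_mult_indicator) (auto simp: L2_def)
    have "v n \<in> borel_measurable borel" for n unfolding v_def[abs_def] by measurable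
    then have vL: "v n \<in> L2" for n
      unfolding L2_def using iu[of n] by (simp add: v_eq)
    have vm: "msq (\<lambda>x. cmod (v n x)) \<le> e / 8" if "n \<ge> N0" for n
      using N0 that by (simp add: msq_def v_eq set_lebesgue_integral_def O1_def)
    define wv where "wv x = indicat_real O1 x *\<^sub>R w x" for x
    have wvF: "wv \<in> L2" "msq (\<lambda>x. cmod (wv x)) \<le> e / 8"
    proof -
      have 1: "AE x in lborel. (\<lambda>k. v k x) \<longlonglongrightarrow> wv x"
        unfolding v_def wv_def by (intro AE_I2 tendsto_intros lim)
      have 2: "wv \<in> borel_measurable borel" unfolding wv_def by measurable
      have 3: "\<forall>\<^sub>F k in sequentially. msq (\<lambda>x. cmod (v k x)) \<le> e / 8"
        using vm eventually_sequentially by blast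
      show "wv \<in> L2" "msq (\<lambda>x. cmod (wv x)) \<le> e / 8" using L2_Fatou[OF vL 1 2 3] by auto
    qed
    let ?I = "{-\<bar>R0\<bar>-1<..\<bar>R0\<bar>+1}"
    have "(\<lambda>n. LINT x|lborel. indicat_real ?I x * (cmod (u n x - w x))\<^sup>2) \<longlonglongrightarrow> (LINT x|(lborel :: real measure). 0)"
    proof (rule integral_dominated_convergence[where w = "\<lambda>x. (2 * B)\<^sup>2 * indicat_real ?I x"])
      show "integrable lborel (\<lambda>x. (2 * B)\<^sup>2 * indicat_real ?I x)"
        by (intro integrable_mult_right) (simp add: integrable_indicator_iff)
      show "AE x in lborel. (\<lambda>n. indicat_real ?I x * (cmod (u n x - w x))\<^sup>2) \<longlonglongrightarrow> 0"
      proof (intro AE_I2)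
        fix x
        have "(\<lambda>n. indicat_real ?I x * (cmod (u n x - w x))\<^sup>2) \<longlonglongrightarrow> indicat_real ?I x * (cmod (w x - w x))\<^sup>2"
          by (intro tendsto_intros lim)
        then show "(\<lambda>n. indicat_real ?I x * (cmod (u n x - w x))\<^sup>2) \<longlonglongrightarrow> 0" by simp
      qed
      show "AE x in lborel. norm (indicat_real ?I x * (cmod (u n x - w x))\<^sup>2) \<le> (2 * B)\<^sup>2 * indicat_real ?I x" for n
      proof (intro AE_I2)
        fix x
        have "cmod (u n x - w x) \<le> 2 * B" using norm_triangle_ineq4[of "u n x" "w x"] B[of n x] wB[of x] by linarith
        then have "(cmod (u n x - w x))\<^sup>2 \<le> (2 * B)\<^sup>2" by (intro power_mono) auto
        then show "norm (indicat_real ?I x * (cmod (u n x - w x))\<^sup>2) \<le> (2 * B)\<^sup>2 * indicat_real ?I x"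
          by (simp add: indicator_def)
      qed
    qed measurable
    then have "(\<lambda>n. LINT x|lborel. indicat_real ?I x * (cmod (u n x - w x))\<^sup>2) \<longlonglongrightarrow> 0" by simp
    from LIMSEQ_D[OF this, of "e / 4"] e obtain N1 where
      N1: "\<And>n. n \<ge> N1 \<Longrightarrow> \<bar>LINT x|lborel. indicat_real ?I x * (cmod (u n x - w x))\<^sup>2\<bar> < e / 4" by auto
    have "norm (msq (\<lambda>x. cmod (u n x - w x)) - 0) < e" if n: "n \<ge> max N0 N1" for n
    proof -
      have i1: "integrable lborel (\<lambda>x. indicat_real ?I x * (cmod (u n x - w x))\<^sup>2)"
        using dL[of n] integrable_mult_indicator[of ?I lborel "\<lambda>x. (cmod (u n x - w x))\<^sup>2"] by (simp add: L2_def)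
      have i2: "integrable lborel (\<lambda>x. (cmod (v n x - wv x))\<^sup>2)"
        using L2_diff[OF vL[of n] wvF(1)] by (simp add: L2_def)
      have "msq (\<lambda>x. cmod (u n x - w x)) \<le> (LINT x|lborel. indicat_real ?I x * (cmod (u n x - w x))\<^sup>2 + (cmod (v n x - wv x))\<^sup>2)"
        unfolding msq_def
      proof (rule integral_mono)
        show "integrable lborel (\<lambda>x. (cmod (u n x - w x))\<^sup>2)" using dL by (simp add: L2_def)
        show "integrable lborel (\<lambda>x. indicat_real ?I x * (cmod (u n x - w x))\<^sup>2 + (cmod (v n x - wv x))\<^sup>2)"
          using i1 i2 by simp
        show "(cmod (u n x - w x))\<^sup>2 \<le> indicat_real ?I x * (cmod (u n x - w x))\<^sup>2 + (cmod (v n x - wv x))\<^sup>2" for x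
        proof (cases "x \<in> O1")
          case True
          then show ?thesis by (simp add: v_def wv_def)
        next
          case False
          then have "indicat_real ?I x = 1" by (auto simp: O1_def indicator_def)
          then show ?thesis by simp
        qed
      qed
      also have "\<dots> = (LINT x|lborel. indicat_real ?I x * (cmod (u n x - w x))\<^sup>2) + msq (\<lambda>x. cmod (v n x - wv x))"
        using i1 i2 by (simp add: msq_def)
      also have "msq (\<lambda>x. cmod (v n x - wv x)) \<le> 2 * msq (\<lambda>x. cmod (v n x)) + 2 * msq (\<lambda>x. cmod (wv x))"
        using msq_le_add[OF vL[of n] L2_cmult[OF wvF(1), of "-1"]] by (simp add: norm_mult)
      finally show ?thesis using N1[of n] vm[of n] wvF(2) n e msq_nonneg[of "\<lambda>x. cmod (u n x - w x)"] by simp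
    qed
    then show "\<exists>N. \<forall>n\<ge>N. norm (msq (\<lambda>x. cmod (u n x - w x)) - 0) < e" by blast
  qed
qed

section \<open>Continuity of the energy\<close>

lemma ac_pair_diff:
  assumes F: "ac_pair F G" and F': "ac_pair F' G'"
  shows "ac_pair (\<lambda>x. F x - F' x) (\<lambda>x. G x - G' x)"
proof -
  have "F y - F' y - (F x - F' x) = (LINT z:{x<..y}|lborel. G z - G' z)" if "x \<le> y" for x y
  proof -
    have "F y - F' y - (F x - F' x) = (F y - F x) - (F' y - F' x)" by simp
    also have "\<dots> = (LINT z:{x<..y}|lborel. G z) - (LINT z:{x<..y}|lborel. G' z)"
      unfolding ac_pairD(3)[OF F that] ac_pairD(3)[OF F' that] ..
    also have "\<dots> = (LINT z:{x<..y}|lborel. G z - G' z)"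
      by (rule set_integral_diff(2)[OF L2_set_integrable[OF ac_pairD(2)[OF F]]
            L2_set_integrable[OF ac_pairD(2)[OF F']], symmetric])
    finally show ?thesis .
  qed
  then show ?thesis
    using ac_pairD(1,2)[OF F] ac_pairD(1,2)[OF F'] by (simp add: ac_pair_def L2_diff)
qed

lemma ac_pair_cmult:
  assumes F: "ac_pair F G" shows "ac_pair (\<lambda>x. c * F x) (\<lambda>x. c * G x)"
  using assms by (simp add: ac_pair_def L2_cmult flip: right_diff_distrib)

lemma ac_pair_add:
  assumes F: "ac_pair F G" and F': "ac_pair F' G'"
  shows "ac_pair (\<lambda>x. F x + F' x) (\<lambda>x. G x + G' x)"
  using ac_pair_diff[OF F ac_pair_cmult[OF F', of "-1"]] by simp

lemma ac_pair_shift: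
  assumes "ac_pair F G" shows "ac_pair (\<lambda>x. F (x + c)) (\<lambda>x. G (x + c))"
  using assms by (simp add: ac_pair_def L2_shift integral_Ioc_shift)

lemma ac_pair_increment_sq:
  fixes x y :: real
  assumes "ac_pair F G"
  shows "(cmod (F y - F x))\<^sup>2 \<le> \<bar>y - x\<bar> * msq (\<lambda>x. cmod (G x))"
proof -
  have "(cmod (F y - F x))\<^sup>2 \<le> (y - x) * msq (\<lambda>x. cmod (G x))" if "x \<le> y" for x y
    using increment_sq_le(1)[OF ac_pairD(2)[OF assms] that] ac_pairD(3)[OF assms that] by (simp add: msq_def)
  from this[of x y] this[of y x] show ?thesis
    by (cases "x \<le> y") (auto simp: norm_minus_commute)
qed

lemma L2_parallelogram:
  assumes f: "f \<in> L2" and g: "g \<in> L2"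
  shows "msq (\<lambda>x. cmod ((f x + g x) / 2)) + msq (\<lambda>x. cmod (f x - g x)) / 4
    = msq (\<lambda>x. cmod (f x)) / 2 + msq (\<lambda>x. cmod (g x)) / 2"
proof -
  have i: "integrable lborel (\<lambda>x. (cmod (f x))\<^sup>2)" "integrable lborel (\<lambda>x. (cmod (g x))\<^sup>2)"
    "integrable lborel (\<lambda>x. (cmod (f x - g x))\<^sup>2)" "integrable lborel (\<lambda>x. (cmod ((f x + g x) / 2))\<^sup>2)"
    using f g L2_diff[OF f g] L2_cmult[OF L2_add[OF f g], of "1/2"] by (auto simp: L2_def)
  have pt: "(cmod ((z + w) / 2))\<^sup>2 + (cmod (z - w))\<^sup>2 / 4 = (cmod z)\<^sup>2 / 2 + (cmod w)\<^sup>2 / 2" for z w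
    unfolding cmod_power2 by (simp add: power2_eq_square field_simps)
  have "msq (\<lambda>x. cmod ((f x + g x) / 2)) + msq (\<lambda>x. cmod (f x - g x)) / 4
    = (LINT x|lborel. (cmod ((f x + g x) / 2))\<^sup>2 + (cmod (f x - g x))\<^sup>2 / 4)"
    using i by (simp add: msq_def)
  also have "\<dots> = (LINT x|lborel. (cmod (f x))\<^sup>2 / 2 + (cmod (g x))\<^sup>2 / 2)"
    by (simp only: pt)
  also have "\<dots> = msq (\<lambda>x. cmod (f x)) / 2 + msq (\<lambda>x. cmod (g x)) / 2"
    using i by (simp add: msq_def)
  finally show ?thesis .
qed

section \<open>Complex triples: squared distance and continuity of the energy\<close>

definition ac3 :: "triple \<Rightarrow> triple \<Rightarrow> bool" where
  "ac3 F G \<longleftrightarrow> (\<forall>j. ac_pair (F j) (G j))"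

definition kinc :: "triple \<Rightarrow> real" where
  "kinc G = kin (\<lambda>j x. cmod (G j x))"

definition diff3 :: "triple \<Rightarrow> triple \<Rightarrow> triple" where
  "diff3 F G j x = F j x - G j x"

text \<open>The square of the distance in \<open>Y\<close>, computed from representatives and their
  derivatives. Its triangle inequality therefore carries a factor 2.\<close>

definition dist3 :: "triple \<Rightarrow> triple \<Rightarrow> triple \<Rightarrow> triple \<Rightarrow> real" where
  "dist3 F G F' G' = kinc (diff3 F F') + kinc (diff3 G G')"

lemma kinc_nonneg: "0 \<le> kinc G" by (simp add: kinc_def kin_nonneg)

lemma kinc_eq: "kinc G = (\<Sum>j\<in>UNIV. msq (\<lambda>x. cmod (G j x)))"
  by (simp add: kinc_def kin_def)

lemma msq_le_kinc: "msq (\<lambda>x. cmod (G j x)) \<le> kinc G"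
  unfolding kinc_def using msq_le_kin[of "\<lambda>j x. cmod (G j x)" j] .

lemma ac3_ug3: "ac3 F G \<Longrightarrow> ug3 (\<lambda>j x. cmod (F j x)) (\<lambda>j x. cmod (G j x))"
  by (simp add: ac3_def ug3_def ac_pair_upper_grad)

lemma ac3_diff3: "ac3 F G \<Longrightarrow> ac3 F' G' \<Longrightarrow> ac3 (diff3 F F') (diff3 G G')"
  unfolding ac3_def diff3_def[abs_def] by (simp add: ac_pair_diff)

lemma ac3_L2: "ac3 F G \<Longrightarrow> F j \<in> L2" "ac3 F G \<Longrightarrow> G j \<in> L2"
  by (auto simp: ac3_def ac_pair_def)

lemma ac3_sup_bound:
  assumes "ac3 F G" "0 < l"
  shows "(cmod (F j x))\<^sup>2 \<le> 2 / l * kinc F + 2 * l * kinc G"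
  using ug3_sup_bound[OF ac3_ug3[OF assms(1)] assms(2), of j x] by (simp add: kinc_def)

lemma kinc_diff3_le:
  assumes "\<And>j. F j \<in> L2" "\<And>j. G j \<in> L2"
  shows "kinc (diff3 F G) \<le> 2 * kinc F + 2 * kinc G"
proof -
  have "msq (\<lambda>x. cmod (diff3 F G j x)) \<le> 2 * msq (\<lambda>x. cmod (F j x)) + 2 * msq (\<lambda>x. cmod (G j x))" for j
    using msq_le_add[OF assms(1)[of j] L2_cmult[OF assms(2)[of j], of "-1"]] by (simp add: norm_mult diff3_def)
  then have "kinc (diff3 F G) \<le> (\<Sum>j\<in>UNIV. 2 * msq (\<lambda>x. cmod (F j x)) + 2 * msq (\<lambda>x. cmod (G j x)))"
    unfolding kinc_eq by (rule sum_mono)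
  then show ?thesis by (simp add: kinc_eq sum.distrib sum_distrib_left)
qed

lemma dist3_triangle:
  assumes "ac3 A A'" "ac3 B B'" "ac3 C C'"
  shows "dist3 A A' C C' \<le> 2 * dist3 A A' B B' + 2 * dist3 B B' C C'"
proof -
  have *: "kinc (diff3 A C) \<le> 2 * kinc (diff3 A B) + 2 * kinc (diff3 B C)"
    if "\<And>j. A j \<in> L2" "\<And>j. B j \<in> L2" "\<And>j. C j \<in> L2" for A B C
  proof -
    have L: "(\<lambda>x. A j x - B j x) \<in> L2" "(\<lambda>x. B j x - C j x) \<in> L2" for j using that L2_diff by blast+
    have "msq (\<lambda>x. cmod (diff3 A C j x)) \<le> 2 * msq (\<lambda>x. cmod (diff3 A B j x)) + 2 * msq (\<lambda>x. cmod (diff3 B C j x))" for j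
      using msq_le_add[OF L, of j j] by (simp add: diff3_def)
    then have "kinc (diff3 A C) \<le> (\<Sum>j\<in>UNIV. 2 * msq (\<lambda>x. cmod (diff3 A B j x)) + 2 * msq (\<lambda>x. cmod (diff3 B C j x)))"
      unfolding kinc_eq by (rule sum_mono)
    then show ?thesis by (simp add: kinc_eq sum.distrib sum_distrib_left)
  qed
  show ?thesis
    using *[of A B C] *[of A' B' C'] ac3_L2[OF assms(1)] ac3_L2[OF assms(2)] ac3_L2[OF assms(3)]
    by (simp add: dist3_def)
qed

context nls_coefficients
begin

definition potc :: "triple \<Rightarrow> real" where
  "potc F = pot (\<lambda>j x. cmod (F j x))"

definition En :: "triple \<Rightarrow> triple \<Rightarrow> real" where
  "En F G = kinc G - potc F"

text \<open>Closeness in L^2 of the functions alone suffices, with derivatives merely bounded: the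
  sup bound over a short window converts it into uniform closeness. The midpoint argument needs this
  form, as closeness of derivatives is its conclusion.\<close>

lemma potc_continuous:
  assumes C: "0 \<le> C" and \<epsilon>: "0 < \<epsilon>"
  shows "\<exists>\<delta>>0. \<forall>F G F' G'. ac3 F G \<longrightarrow> ac3 F' G' \<longrightarrow> kinc F + kinc G \<le> C \<longrightarrow> kinc F' + kinc G' \<le> C \<longrightarrow>
    kinc (diff3 F F') \<le> \<delta> \<longrightarrow> \<bar>potc F - potc F'\<bar> \<le> \<epsilon>"
proof -
  define T where "T = sqrt (2 * C)"
  define B where "B = Asum * (T powr (p - 2) * T powr (p - 1)) * (2 * C)"
  have B: "0 \<le> B" using Asum_pos C by (simp add: B_def)
  define d where "d = \<epsilon> / (B + 1)"
  have d: "0 < d" using B \<epsilon> by (simp add: d_def)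
  \<comment> \<open>The derivatives differ by at most 4 C in squared norm; this window makes their
    contribution at most d^2 / 2. The choice of \<delta> below spends the other half on the L^2
    distance.\<close>
  define l where "l = d\<^sup>2 / (16 * (C + 1))"
  have l: "0 < l" using d C by (simp add: l_def)
  have lC: "2 * l * (4 * C) \<le> d\<^sup>2 / 2"
  proof -
    have "2 * l * (4 * C) \<le> 2 * l * (4 * (C + 1))" using l by (intro mult_left_mono) auto
    also have "\<dots> = l * (16 * (C + 1)) / 2" by simp
    also have "l * (16 * (C + 1)) = d\<^sup>2" using C unfolding l_def by (intro nonzero_eq_divide_eq[THEN iffD1]) auto
    finally show ?thesis .
  qed
  define \<delta> where "\<delta> = l * d\<^sup>2 / 4"
  have \<delta>: "0 < \<delta>" using l d by (simp add: \<delta>_def)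
  have "\<bar>potc F - potc F'\<bar> \<le> \<epsilon>"
    if F: "ac3 F G" and F': "ac3 F' G'" and b: "kinc F + kinc G \<le> C" "kinc F' + kinc G' \<le> C"
      and D: "kinc (diff3 F F') \<le> \<delta>" for F G F' G'
  proof -
    have T: "cmod (H j x) \<le> T" if "ac3 H K" "kinc H + kinc K \<le> C" for H K j x
      using ac3_sup_bound[OF that(1), of 1 j x] that(2) unfolding T_def by (intro real_le_rsqrt) simp
    have dd: "\<bar>cmod (F j x) - cmod (F' j x)\<bar> \<le> d" for j x
    proof -
      have "kinc (diff3 G G') \<le> 4 * C"
        using kinc_diff3_le[of G G', OF ac3_L2(2)[OF F] ac3_L2(2)[OF F']] b kinc_nonneg[of F] kinc_nonneg[of F'] by linarith
      then have "2 / l * kinc (diff3 F F') + 2 * l * kinc (diff3 G G') \<le> 2 / l * \<delta> + 2 * l * (4 * C)"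
        using D l by (intro add_mono mult_left_mono) auto
      also have "\<dots> \<le> d\<^sup>2" using lC l by (simp add: \<delta>_def)
      finally have "(cmod (diff3 F F' j x))\<^sup>2 \<le> d\<^sup>2"
        using ac3_sup_bound[OF ac3_diff3[OF F F'] l, of j x] by linarith
      then have "cmod (diff3 F F' j x) \<le> d" by (rule power2_le_imp_le) (use d in simp)
      then show ?thesis using norm_triangle_ineq3[of "F j x" "F' j x"] by (simp add: diff3_def)
    qed
    have "\<bar>potc F - potc F'\<bar> \<le> Asum * (T powr (p - 2) * T powr (p - 1)) * d * (kinc F + kinc F')"
      unfolding potc_def kinc_def
      by (rule pot_diff_le[OF ac3_ug3[OF F] ac3_ug3[OF F']]) (use T[OF F b(1)] T[OF F' b(2)] dd in auto)
    also have "\<dots> \<le> Asum * (T powr (p - 2) * T powr (p - 1)) * d * (2 * C)"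
      using b kinc_nonneg[of G] kinc_nonneg[of G'] Asum_pos d by (intro mult_left_mono) auto
    also have "\<dots> = B * d" by (simp add: B_def)
    also have "\<dots> \<le> (B + 1) * d" using d by simp
    also have "\<dots> = \<epsilon>" using B by (simp add: d_def)
    finally show ?thesis .
  qed
  then show ?thesis using \<delta> by blast
qed

lemma kinc_diff_le:
  assumes G: "\<And>j. G j \<in> L2" and G': "\<And>j. G' j \<in> L2" and "kinc G \<le> C" "kinc G' \<le> C"
  shows "\<bar>kinc G - kinc G'\<bar> \<le> 3 * (sqrt (kinc (diff3 G G')) * sqrt (4 * C))"
proof -
  have t: "\<bar>msq (\<lambda>x. cmod (G j x)) - msq (\<lambda>x. cmod (G' j x))\<bar> \<le> sqrt (kinc (diff3 G G')) * sqrt (4 * C)" for j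
  proof -
    have "\<bar>msq (\<lambda>x. cmod (G j x)) - msq (\<lambda>x. cmod (G' j x))\<bar>
      \<le> sqrt (msq (\<lambda>x. cmod (G j x - G' j x))) * sqrt (2 * msq (\<lambda>x. cmod (G j x)) + 2 * msq (\<lambda>x. cmod (G' j x)))"
      by (rule msq_cmod_diff_le[OF G G'])
    also have "\<dots> \<le> sqrt (kinc (diff3 G G')) * sqrt (4 * C)"
    proof (intro mult_mono real_sqrt_le_mono)
      show "msq (\<lambda>x. cmod (G j x - G' j x)) \<le> kinc (diff3 G G')"
        using msq_le_kinc[of "diff3 G G'" j] by (simp add: diff3_def)
      show "2 * msq (\<lambda>x. cmod (G j x)) + 2 * msq (\<lambda>x. cmod (G' j x)) \<le> 4 * C"
        using msq_le_kinc[of G j] msq_le_kinc[of G' j] assms(3,4) by linarith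
    qed (auto simp: kinc_nonneg msq_nonneg)
    finally show ?thesis .
  qed
  have "\<bar>kinc G - kinc G'\<bar> = \<bar>\<Sum>j\<in>UNIV. msq (\<lambda>x. cmod (G j x)) - msq (\<lambda>x. cmod (G' j x))\<bar>"
    by (simp add: kinc_eq sum_subtractf)
  also have "\<dots> \<le> (\<Sum>j\<in>UNIV. \<bar>msq (\<lambda>x. cmod (G j x)) - msq (\<lambda>x. cmod (G' j x))\<bar>)" by (rule sum_abs)
  also have "\<dots> \<le> (\<Sum>j\<in>(UNIV::3 set). sqrt (kinc (diff3 G G')) * sqrt (4 * C))" by (intro sum_mono t)
  finally show ?thesis by simp
qed

lemma En_continuous:
  assumes C: "0 \<le> C" and \<epsilon>: "0 < \<epsilon>"
  shows "\<exists>\<delta>>0. \<forall>F G F' G'. ac3 F G \<longrightarrow> ac3 F' G' \<longrightarrow> kinc F + kinc G \<le> C \<longrightarrow> kinc F' + kinc G' \<le> C \<longrightarrow>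
    dist3 F G F' G' \<le> \<delta> \<longrightarrow> \<bar>En F G - En F' G'\<bar> \<le> \<epsilon>"
proof -
  obtain \<delta>1 where d1: "0 < \<delta>1" and P: "\<forall>F G F' G'. ac3 F G \<longrightarrow> ac3 F' G' \<longrightarrow> kinc F + kinc G \<le> C \<longrightarrow>
    kinc F' + kinc G' \<le> C \<longrightarrow> kinc (diff3 F F') \<le> \<delta>1 \<longrightarrow> \<bar>potc F - potc F'\<bar> \<le> \<epsilon> / 2"
    using potc_continuous[OF C, of "\<epsilon> / 2"] \<epsilon> by auto
  define Q where "Q = 3 * sqrt (4 * C) + 1"
  define s where "s = \<epsilon> / (2 * Q)"
  have q: "0 < Q" using C by (simp add: Q_def add_nonneg_pos)
  have s: "0 < s" using \<epsilon> q by (simp add: s_def)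
  have "\<bar>En F G - En F' G'\<bar> \<le> \<epsilon>"
    if F: "ac3 F G" and F': "ac3 F' G'" and b: "kinc F + kinc G \<le> C" "kinc F' + kinc G' \<le> C"
      and D: "dist3 F G F' G' \<le> min \<delta>1 (s\<^sup>2)" for F G F' G'
  proof -
    have D1: "kinc (diff3 F F') \<le> \<delta>1" "kinc (diff3 G G') \<le> s\<^sup>2"
      using D kinc_nonneg[of "diff3 F F'"] kinc_nonneg[of "diff3 G G'"] by (auto simp: dist3_def)
    have "\<bar>kinc G - kinc G'\<bar> \<le> 3 * (sqrt (kinc (diff3 G G')) * sqrt (4 * C))"
      using kinc_diff_le[OF ac3_L2(2)[OF F] ac3_L2(2)[OF F']] b kinc_nonneg[of F] kinc_nonneg[of F'] by simp
    also have "\<dots> \<le> 3 * (s * sqrt (4 * C))"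
      using D1(2) s C by (intro mult_left_mono mult_right_mono real_le_lsqrt) (auto simp: kinc_nonneg)
    also have "\<dots> \<le> s * Q" using s by (simp add: Q_def algebra_simps)
    also have "\<dots> = \<epsilon> / 2" using q by (simp add: s_def)
    finally have K: "\<bar>kinc G - kinc G'\<bar> \<le> \<epsilon> / 2" .
    have "\<bar>potc F - potc F'\<bar> \<le> \<epsilon> / 2" using P F F' b D1(1) by blast
    then show ?thesis using K unfolding En_def by linarith
  qed
  moreover have "0 < min \<delta>1 (s\<^sup>2)" using d1 s by simp
  ultimately show ?thesis by blast
qed

lemma potc_mono_scale:
  assumes F: "ac3 F G" and \<theta>: "\<And>j. 1 \<le> \<theta> j"
  shows "potc F \<le> pot (\<lambda>j x. \<theta> j * cmod (F j x))"
  unfolding potc_def pot_def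
proof (rule mult_left_mono)
  have u: "ug3 (\<lambda>j x. \<theta> j * cmod (F j x)) (\<lambda>j x. \<theta> j * cmod (G j x))"
    using ac3_ug3[OF F] \<theta> unfolding ug3_def
    by (intro allI upper_grad_scale) (auto intro: order_trans[OF zero_le_one])
  show "(LINT x|lborel. dens (\<lambda>j x. cmod (F j x)) x) \<le> (LINT x|lborel. dens (\<lambda>j x. \<theta> j * cmod (F j x)) x)"
  proof (rule integral_mono[OF dens_integrable[OF ac3_ug3[OF F]] dens_integrable[OF u]])
    fix x
    have le: "cmod (F j x) powr p \<le> (\<theta> j * cmod (F j x)) powr p" for j
      using p mult_right_mono[OF \<theta>[of j] norm_ge_zero[of "F j x"]] by (intro powr_mono2) auto
    show "dens (\<lambda>j x. cmod (F j x)) x \<le> dens (\<lambda>j x. \<theta> j * cmod (F j x)) x"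
      unfolding dens_def using le less_imp_le[OF a_pos] by (intro sum_mono mult_mono) auto
  qed
  show "0 \<le> 1 / p" using p by simp
qed

end

context minimization
begin

lemma En_ge:
  assumes "ac3 F G" "\<And>j. msq (\<lambda>x. cmod (F j x)) = m j" shows "L \<le> En F G"
  unfolding En_def kinc_def potc_def using energy_ge[OF ac3_ug3[OF assms(1)]] assms(2) by blast

lemma kinc_mtot: "(\<And>j. msq (\<lambda>x. cmod (F j x)) = m j) \<Longrightarrow> kinc F = mtot"
  by (simp add: kinc_eq mtot_def)

text \<open>Scaling each component up to its exact mass multiplies the kinetic energy by at most 1 +
  \<eta> and does not decrease the potential energy, after which the lower bound \<open>L\<close>
  applies.\<close>

lemma rescaled_energy_lower_bound:
  assumes F: "ac3 F G" and M: "\<And>j. msq (\<lambda>x. cmod (F j x)) \<le> m j"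
    "\<And>j. m j \<le> (1 + \<eta>) * msq (\<lambda>x. cmod (F j x))" and \<eta>: "0 \<le> \<eta>"
  shows "L \<le> (1 + \<eta>) * kinc G - potc F"
proof -
  have Mp: "0 < msq (\<lambda>x. cmod (F j x))" for j
    using M(2)[of j] m_pos[of j] \<eta> msq_nonneg[of "\<lambda>x. cmod (F j x)"]
    by (metis less_eq_real_def mult_zero_right not_le order_less_le_trans)
  define \<theta> where "\<theta> j = sqrt (m j / msq (\<lambda>x. cmod (F j x)))" for j
  have t1: "1 \<le> \<theta> j" for j using M(1)[of j] Mp[of j] by (simp add: \<theta>_def)
  have t2: "(\<theta> j)\<^sup>2 = m j / msq (\<lambda>x. cmod (F j x))" for j
    using Mp[of j] m_pos[of j] by (simp add: \<theta>_def)
  have t3: "(\<theta> j)\<^sup>2 \<le> 1 + \<eta>" for j using M(2)[of j] Mp[of j] by (simp add: t2 divide_le_eq)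
  have u: "ug3 (\<lambda>j x. \<theta> j * cmod (F j x)) (\<lambda>j x. \<theta> j * cmod (G j x))"
    using ac3_ug3[OF F] t1 unfolding ug3_def
    by (intro allI upper_grad_scale) (auto intro: order_trans[OF zero_le_one])
  have "L \<le> kin (\<lambda>j x. \<theta> j * cmod (G j x)) - pot (\<lambda>j x. \<theta> j * cmod (F j x))"
  proof (rule energy_ge[OF u])
    show "msq (\<lambda>x. \<theta> j * cmod (F j x)) = m j" for j using Mp[of j] by (simp add: msq_scale t2)
  qed
  moreover have "kin (\<lambda>j x. \<theta> j * cmod (G j x)) \<le> (1 + \<eta>) * kinc G"
    unfolding kin_def kinc_eq sum_distrib_left msq_scale
    by (intro sum_mono mult_right_mono t3 msq_nonneg)
  moreover have "potc F \<le> pot (\<lambda>j x. \<theta> j * cmod (F j x))" by (rule potc_mono_scale[OF F t1])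
  ultimately show ?thesis by linarith
qed

text \<open>
  The midpoint of two almost minimizers that are close in \<open>L\<^sup>2\<close> has almost the right masses, so its
  energy is almost at least \<open>L\<close>; the parallelogram identity then makes the derivatives close.
\<close>

lemma almost_minimizers_close:
  assumes CK: "0 \<le> CK" and \<epsilon>: "0 < \<epsilon>"
  shows "\<exists>\<delta>>0. \<forall>X A Y B. ac3 X A \<longrightarrow> ac3 Y B \<longrightarrow> (\<forall>j. msq (\<lambda>x. cmod (X j x)) = m j) \<longrightarrow>
    (\<forall>j. msq (\<lambda>x. cmod (Y j x)) = m j) \<longrightarrow> kinc A \<le> CK \<longrightarrow> kinc B \<le> CK \<longrightarrow>
    En X A \<le> L + \<delta> \<longrightarrow> En Y B \<le> L + \<delta> \<longrightarrow> kinc (diff3 X Y) \<le> \<delta> \<longrightarrow> kinc (diff3 A B) \<le> \<epsilon>"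
proof -
  define C where "C = mtot + CK"
  have C: "0 \<le> C" using mtot_pos CK by (simp add: C_def)
  obtain \<delta>1 where d1: "0 < \<delta>1" and P: "\<forall>F G F' G'. ac3 F G \<longrightarrow> ac3 F' G' \<longrightarrow> kinc F + kinc G \<le> C \<longrightarrow>
    kinc F' + kinc G' \<le> C \<longrightarrow> kinc (diff3 F F') \<le> \<delta>1 \<longrightarrow> \<bar>potc F - potc F'\<bar> \<le> \<epsilon> / 16"
    using potc_continuous[OF C, of "\<epsilon> / 16"] \<epsilon> by auto
  \<comment> \<open>Relative mass deficit tolerated for the midpoint: the kinetic price of
    rescaling, \<eta> times \<open>CK\<close>, stays below \<epsilon> / 16. Below, \<open>mm\<close>
    turns it into an absolute deficit valid for all three components.\<close>
  define \<eta> where "\<eta> = min 1 (\<epsilon> / (16 * (CK + 1)))"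
  have \<eta>: "0 < \<eta>" "\<eta> \<le> 1" using \<epsilon> CK by (auto simp: \<eta>_def)
  have \<eta>K: "\<eta> * CK \<le> \<epsilon> / 16"
  proof -
    have "\<eta> * CK \<le> \<epsilon> / (16 * (CK + 1)) * (CK + 1)" using CK \<epsilon> by (intro mult_mono) (auto simp: \<eta>_def)
    also have "\<dots> = \<epsilon> / 16 / (CK + 1) * (CK + 1)" by (simp add: divide_divide_eq_left)
    also have "\<dots> = \<epsilon> / 16" using CK by (intro nonzero_divide_mult_cancel_right nonzero_eq_divide_eq[THEN iffD1]) auto
    finally show ?thesis .
  qed
  define mm where "mm = Min (range m)"
  have mm: "0 < mm" "\<And>j. mm \<le> m j" unfolding mm_def by (subst Min_gr_iff) (auto simp: m_pos)
  define \<delta> where "\<delta> = min (\<epsilon> / 16) (min \<delta>1 (\<eta> * mm))"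
  have \<delta>: "0 < \<delta>" "\<delta> \<le> \<epsilon> / 16" "\<delta> \<le> \<delta>1" "\<delta> \<le> \<eta> * mm" using \<epsilon> d1 \<eta> mm by (auto simp: \<delta>_def)
  have "kinc (diff3 A B) \<le> \<epsilon>"
    if X: "ac3 X A" and Y: "ac3 Y B" and mX: "\<forall>j. msq (\<lambda>x. cmod (X j x)) = m j"
      and mY: "\<forall>j. msq (\<lambda>x. cmod (Y j x)) = m j" and KA: "kinc A \<le> CK" and KB: "kinc B \<le> CK"
      and EX: "En X A \<le> L + \<delta>" and EY: "En Y B \<le> L + \<delta>" and D: "kinc (diff3 X Y) \<le> \<delta>" for X A Y B
  proof -
    define Z H where "Z j x = (X j x + Y j x) / 2" and "H j x = (A j x + B j x) / 2" for j x
    have Z: "ac3 Z H"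
      unfolding ac3_def
    proof
      fix j
      have "ac_pair (X j) (A j)" "ac_pair (Y j) (B j)" using X Y by (auto simp: ac3_def)
      from ac_pair_cmult[OF ac_pair_add[OF this], of "1/2"] show "ac_pair (Z j) (H j)"
        unfolding Z_def[abs_def] H_def[abs_def] by simp
    qed
    have Zm: "msq (\<lambda>x. cmod (Z j x)) = m j - msq (\<lambda>x. cmod (diff3 X Y j x)) / 4" for j
      using L2_parallelogram[OF ac3_L2(1)[OF X] ac3_L2(1)[OF Y], of j j] mX mY
      by (simp add: Z_def diff3_def)
    have KH: "kinc H = kinc A / 2 + kinc B / 2 - kinc (diff3 A B) / 4"
    proof -
      have "msq (\<lambda>x. cmod (H j x)) = msq (\<lambda>x. cmod (A j x)) / 2 + msq (\<lambda>x. cmod (B j x)) / 2 - msq (\<lambda>x. cmod (diff3 A B j x)) / 4" for j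
        using L2_parallelogram[OF ac3_L2(2)[OF X] ac3_L2(2)[OF Y], of j j] by (simp add: H_def diff3_def)
      then show ?thesis by (simp add: kinc_eq sum.distrib sum_subtractf sum_divide_distrib)
    qed
    have dj: "msq (\<lambda>x. cmod (diff3 X Y j x)) \<le> \<delta>" for j using msq_le_kinc[of "diff3 X Y" j] D by linarith
    have KH': "kinc H \<le> CK" using KH KA KB kinc_nonneg[of "diff3 A B"] by linarith
    have "L \<le> (1 + \<eta>) * kinc H - potc Z"
    proof (rule rescaled_energy_lower_bound[OF Z _ _ less_imp_le[OF \<eta>(1)]])
      show "msq (\<lambda>x. cmod (Z j x)) \<le> m j" for j
        using Zm[of j] msq_nonneg[of "\<lambda>x. cmod (diff3 X Y j x)"] by linarith
      show "m j \<le> (1 + \<eta>) * msq (\<lambda>x. cmod (Z j x))" for j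
      proof -
        have "\<delta> \<le> \<eta> * m j" using \<delta>(4) mult_left_mono[OF mm(2)[of j] less_imp_le[OF \<eta>(1)]] by linarith
        have "(1 + \<eta>) * (\<delta> / 4) \<le> 2 * (\<delta> / 4)" using \<eta> \<delta> by (intro mult_right_mono) auto
        moreover have "(1 + \<eta>) * (m j - \<delta> / 4) = m j + \<eta> * m j - (1 + \<eta>) * (\<delta> / 4)"
          by (simp add: algebra_simps)
        ultimately have "m j \<le> (1 + \<eta>) * (m j - \<delta> / 4)" using \<open>\<delta> \<le> \<eta> * m j\<close> \<delta>(1) by linarith
        also have "\<dots> \<le> (1 + \<eta>) * msq (\<lambda>x. cmod (Z j x))"
          using Zm[of j] dj[of j] \<eta> by (intro mult_left_mono) auto
        finally show ?thesis .
      qed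
    qed
    moreover have "\<eta> * kinc H \<le> \<epsilon> / 16" using mult_left_mono[OF KH' less_imp_le[OF \<eta>(1)]] \<eta>K by linarith
    ultimately have LZ: "L \<le> kinc H + \<epsilon> / 16 - potc Z" by (simp add: algebra_simps)
    have kX: "kinc X = mtot" "kinc Y = mtot" using kinc_mtot mX mY by blast+
    have kZ: "kinc Z \<le> mtot"
      unfolding kinc_eq mtot_def by (intro sum_mono) (simp add: Zm msq_nonneg)
    have half: "kinc (diff3 V Z) \<le> \<delta>1" if "V = X \<or> V = Y" for V
    proof -
      have "cmod (diff3 V Z j x) = 1 / 2 * cmod (diff3 X Y j x)" for j x
      proof -
        have "X j x - Z j x = (1 / 2) * (X j x - Y j x)" "Y j x - Z j x = (- 1 / 2) * (X j x - Y j x)"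
          by (simp_all add: Z_def field_simps)
        then have "cmod (X j x - Z j x) = 1 / 2 * cmod (X j x - Y j x)" "cmod (Y j x - Z j x) = 1 / 2 * cmod (X j x - Y j x)"
          by (simp_all only: norm_mult) simp_all
        then show ?thesis using that by (auto simp: diff3_def)
      qed
      then have "kinc (diff3 V Z) = (\<Sum>j\<in>UNIV. (1 / 2)\<^sup>2 * msq (\<lambda>x. cmod (diff3 X Y j x)))"
        by (simp only: kinc_eq msq_scale)
      also have "\<dots> = kinc (diff3 X Y) / 4"
        by (simp add: kinc_eq sum_divide_distrib power2_eq_square)
      finally show ?thesis using D \<delta> kinc_nonneg[of "diff3 X Y"] by linarith
    qed
    have "\<bar>potc X - potc Z\<bar> \<le> \<epsilon> / 16" "\<bar>potc Y - potc Z\<bar> \<le> \<epsilon> / 16"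
      using P[rule_format, OF X Z _ _ half] P[rule_format, OF Y Z _ _ half] kX kZ KA KB KH'
      by (auto simp: C_def)
    \<comment> \<open>The midpoint has kinetic energy (A + B) / 2 - D / 4, with D the quantity to be
      bounded. Its lower bound and these two upper bounds share \<open>potc Z\<close>, leaving D / 4
      \<le> \<delta> + 2 \<epsilon> / 16 \<le> 3 \<epsilon> / 16.\<close>
    then have "kinc A \<le> L + \<delta> + potc Z + \<epsilon> / 16" "kinc B \<le> L + \<delta> + potc Z + \<epsilon> / 16"
      using EX EY unfolding En_def by linarith+
    then show ?thesis using KH LZ \<delta>(2) \<epsilon> by linarith
  qed
  then show ?thesis using \<delta>(1) by blast
qed

end

section \<open>Compactness of minimizing sequences\<close>

definition shift3 :: "real \<Rightarrow> triple \<Rightarrow> triple" where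
  "shift3 c F j x = F j (x + c)"

lemma ac3_shift3: "ac3 F G \<Longrightarrow> ac3 (shift3 c F) (shift3 c G)"
  unfolding ac3_def shift3_def[abs_def] by (simp add: ac_pair_shift)

lemma msq_shift3:
  assumes "F j \<in> L2" shows "msq (\<lambda>x. cmod (shift3 c F j x)) = msq (\<lambda>x. cmod (F j x))"
  unfolding shift3_def using msq_shift[of "\<lambda>x. cmod (F j x)" c] assms by (simp add: L2_iff)

lemma kinc_shift3: "(\<And>j. F j \<in> L2) \<Longrightarrow> kinc (shift3 c F) = kinc F"
  by (simp add: kinc_eq msq_shift3)

lemma diff3_shift3: "diff3 (shift3 c F) (shift3 c G) = shift3 c (diff3 F G)"
  by (simp add: fun_eq_iff diff3_def shift3_def)

lemma shift3_shift3: "shift3 c (shift3 (- c) F) = F" "shift3 (- c) (shift3 c F) = F"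
  by (simp_all add: fun_eq_iff shift3_def)

lemma dist3_shift3:
  assumes "ac3 F G" "ac3 F' G'"
  shows "dist3 (shift3 c F) (shift3 c G) (shift3 c F') (shift3 c G') = dist3 F G F' G'"
  using ac3_L2[OF ac3_diff3[OF assms]] by (simp add: dist3_def diff3_shift3 kinc_shift3)

context nls_coefficients
begin

lemma potc_shift3: "potc (shift3 c F) = potc F"
  using lborel_integral_real_affine[of 1 "dens (\<lambda>j x. cmod (F j x))" c]
  by (simp add: potc_def pot_def dens_def shift3_def add.commute)

lemma En_shift3: "ac3 F G \<Longrightarrow> En (shift3 c F) (shift3 c G) = En F G"
  using ac3_L2(2) by (simp add: En_def potc_shift3 kinc_shift3)

end

text \<open>The increments converge pointwise, and L^2 convergence of the derivatives gives
  convergence of their integrals over bounded intervals by Cauchy-Schwarz.\<close>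

lemma ac_pair_limit:
  assumes V: "\<And>n. ac_pair (V n) (H n)" and w: "w \<in> L2" and g: "g \<in> L2"
    and lw: "\<And>x. (\<lambda>n. V n x) \<longlonglongrightarrow> w x"
    and lg: "(\<lambda>n. msq (\<lambda>x. cmod (H n x - g x))) \<longlonglongrightarrow> 0"
  shows "ac_pair w g"
proof -
  have "w y - w x = (LINT z:{x<..y}|lborel. g z)" if xy: "x \<le> y" for x y
  proof -
    let ?I = "\<lambda>h. LINT z:{x<..y}|lborel. h z"
    have HL: "H n \<in> L2" for n using ac_pairD(2)[OF V] .
    have "(\<lambda>n. V n y - V n x - ?I g) \<longlonglongrightarrow> 0"
    proof (rule Lim_null_comparison)
      have "cmod (V n y - V n x - ?I g) \<le> sqrt ((y - x) * msq (\<lambda>x. cmod (H n x - g x)))" for n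
      proof -
        have "V n y - V n x - ?I g = ?I (\<lambda>z. H n z - g z)"
          using ac_pairD(3)[OF V xy] set_integral_diff(2)[OF L2_set_integrable[OF HL] L2_set_integrable[OF g]] by simp
        then show ?thesis
          using increment_sq_le(1)[OF L2_diff[OF HL g] xy, of n] by (intro real_le_rsqrt) (simp add: msq_def)
      qed
      then show "\<forall>\<^sub>F n in sequentially. norm (V n y - V n x - ?I g) \<le> sqrt ((y - x) * msq (\<lambda>x. cmod (H n x - g x)))"
        by simp
      have "(\<lambda>n. sqrt ((y - x) * msq (\<lambda>x. cmod (H n x - g x)))) \<longlonglongrightarrow> sqrt ((y - x) * 0)"
        by (intro tendsto_intros lg)
      then show "(\<lambda>n. sqrt ((y - x) * msq (\<lambda>x. cmod (H n x - g x)))) \<longlonglongrightarrow> 0" by simp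
    qed
    moreover have "(\<lambda>n. V n y - V n x - ?I g) \<longlonglongrightarrow> w y - w x - ?I g"
      by (intro tendsto_intros lw)
    ultimately have "w y - w x - ?I g = 0" by (rule LIMSEQ_unique[rotated])
    then show ?thesis by simp
  qed
  then show ?thesis using w g by (simp add: ac_pair_def)
qed

context minimization
begin

definition is_minimizer :: "triple \<Rightarrow> triple \<Rightarrow> bool" where
  "is_minimizer w g \<longleftrightarrow> ac3 w g \<and> (\<forall>j. msq (\<lambda>x. cmod (w j x)) = m j) \<and> En w g = L"

lemma is_minimizer_shift3:
  assumes "is_minimizer w g" shows "is_minimizer (shift3 c w) (shift3 c g)"
proof -
  have "ac3 w g" using assms by (simp add: is_minimizer_def)
  from ac3_shift3[OF this] En_shift3[OF this] msq_shift3[OF ac3_L2(1)[OF this]] show ?thesis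
    using assms by (simp add: is_minimizer_def)
qed

text \<open>The lower bound at the origin fixes the translation, since tightness controls mass away
  from 0. A pointwise limit then becomes an L^2 limit. Derivatives converge strongly because almost
  minimizers that are close in L^2 have close derivatives, so the energy passes to the
  limit.\<close>

lemma minimizing_sequence_converges:
  fixes V H :: "nat \<Rightarrow> triple"
  assumes ac: "\<And>n. ac3 (V n) (H n)" and mass: "\<And>n j. msq (\<lambda>x. cmod (V n j x)) = m j"
    and E: "(\<lambda>n. En (V n) (H n)) \<longlonglongrightarrow> L" and CK: "\<And>n. kinc (H n) \<le> CK"
    and c: "0 < c" "\<And>n. \<exists>i. c \<le> cmod (V n i 0)"
  obtains r w g where "strict_mono (r :: nat \<Rightarrow> nat)" "is_minimizer w g"
    "(\<lambda>n. dist3 (V (r n)) (H (r n)) w g) \<longlonglongrightarrow> 0"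
proof -
  have CK0: "0 \<le> CK" using CK[of 0] kinc_nonneg[of "H 0"] by linarith
  have kV: "kinc (V n) = mtot" for n using kinc_mtot mass by blast
  have acj: "ac_pair (V n j) (H n j)" for n j using ac by (simp add: ac3_def)
  have bdd: "cmod (V n j x) \<le> sqrt (2 * mtot + 2 * CK)" for n j x
    using ac3_sup_bound[OF ac, of 1 n j x] kV[of n] CK[of n] by (intro real_le_rsqrt) simp
  have eqc: "(cmod (V n j y - V n j x))\<^sup>2 \<le> \<bar>y - x\<bar> * CK" for n j x y
  proof -
    have "(cmod (V n j y - V n j x))\<^sup>2 \<le> \<bar>y - x\<bar> * msq (\<lambda>x. cmod (H n j x))"
      by (rule ac_pair_increment_sq[OF acj])
    also have "\<dots> \<le> \<bar>y - x\<bar> * CK"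
      using msq_le_kinc[of "H n" j] CK[of n] by (intro mult_left_mono) auto
    finally show ?thesis .
  qed
  obtain r w where r: "strict_mono (r :: nat \<Rightarrow> nat)" and lim: "\<And>j x. (\<lambda>n. V (r n) j x) \<longlonglongrightarrow> w j x"
    using equicontinuous_pointwise_subsequence[of V "sqrt (2 * mtot + 2 * CK)" CK, OF bdd eqc] by metis
  have Er: "(\<lambda>n. En (V (r n)) (H (r n))) \<longlonglongrightarrow> L" using LIMSEQ_subseq_LIMSEQ[OF E r] by (simp add: o_def)
  have Eev: "\<exists>N. \<forall>n\<ge>N. En (V (r n)) (H (r n)) \<le> L + \<delta>" if "0 < \<delta>" for \<delta>
  proof -
    have "\<forall>\<^sub>F n in sequentially. En (V (r n)) (H (r n)) < L + \<delta>"
      by (rule order_tendstoD(2)[OF Er]) (use that in simp)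
    then show ?thesis unfolding eventually_sequentially by (meson less_imp_le)
  qed
  have tight: "\<exists>R N. \<forall>n\<ge>N. (LINT x:{x. R < \<bar>x\<bar>}|lborel. (cmod (V (r n) j x))\<^sup>2) \<le> \<beta>"
    if \<beta>: "0 < \<beta>" for \<beta> j
  proof -
    obtain \<delta> R where d: "0 < \<delta>" and T: "\<forall>f h. ug3 f h \<longrightarrow> (\<forall>i. msq (f i) = m i) \<longrightarrow> kin h \<le> CK \<longrightarrow>
      kin h - pot f \<le> L + \<delta> \<longrightarrow> (\<exists>i. c \<le> f i 0) \<longrightarrow>
      (LINT x:{x. R < \<bar>x\<bar>}|lborel. (f j x)\<^sup>2) \<le> \<beta>"
      using tightness[OF \<beta> c(1) CK0, of j] by blast
    obtain N where N: "\<forall>n\<ge>N. En (V (r n)) (H (r n)) \<le> L + \<delta>" using Eev[OF d] by blast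
    have "(LINT x:{x. R < \<bar>x\<bar>}|lborel. (cmod (V (r n) j x))\<^sup>2) \<le> \<beta>" if "n \<ge> N" for n
    proof (rule T[rule_format, OF ac3_ug3[OF ac]])
      show "kin (\<lambda>j x. cmod (H (r n) j x)) - pot (\<lambda>j x. cmod (V (r n) j x)) \<le> L + \<delta>"
        using N that by (simp add: En_def kinc_def potc_def)
    qed (use mass CK c(2) in \<open>auto simp: kinc_def\<close>)
    then show ?thesis by blast
  qed
  note conv = tight_pointwise_imp_L2_convergent[of "\<lambda>n. V (r n) j" "sqrt (2 * mtot + 2 * CK)" "m j" "w j" for j,
      OF ac3_L2(1)[OF ac] bdd eq_refl[OF mass] lim tight]
  have wL: "w j \<in> L2" for j by (rule conv(1))
  have lw: "(\<lambda>n. msq (\<lambda>x. cmod (V (r n) j x - w j x))) \<longlonglongrightarrow> 0" for j by (rule conv(2))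
  have kw: "(\<lambda>n. kinc (diff3 (V (r n)) w)) \<longlonglongrightarrow> 0"
  proof -
    have "(\<lambda>n. \<Sum>j\<in>UNIV. msq (\<lambda>x. cmod (V (r n) j x - w j x))) \<longlonglongrightarrow> (\<Sum>j\<in>(UNIV::3 set). 0)"
      by (intro tendsto_sum lw)
    then show ?thesis by (simp add: kinc_eq diff3_def)
  qed
  have cauchy: "\<exists>N. \<forall>k\<ge>N. \<forall>n\<ge>N. kinc (diff3 (H (r k)) (H (r n))) \<le> e" if e: "0 < e" for e
  proof -
    obtain \<delta> where d: "0 < \<delta>" and P: "\<forall>X A Y B. ac3 X A \<longrightarrow> ac3 Y B \<longrightarrow> (\<forall>j. msq (\<lambda>x. cmod (X j x)) = m j) \<longrightarrow>
      (\<forall>j. msq (\<lambda>x. cmod (Y j x)) = m j) \<longrightarrow> kinc A \<le> CK \<longrightarrow> kinc B \<le> CK \<longrightarrow>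
      En X A \<le> L + \<delta> \<longrightarrow> En Y B \<le> L + \<delta> \<longrightarrow> kinc (diff3 X Y) \<le> \<delta> \<longrightarrow> kinc (diff3 A B) \<le> e"
      using almost_minimizers_close[OF CK0 e] by blast
    obtain N1 where N1: "\<forall>n\<ge>N1. En (V (r n)) (H (r n)) \<le> L + \<delta>" using Eev[OF d] by blast
    have "\<forall>\<^sub>F n in sequentially. kinc (diff3 (V (r n)) w) < \<delta> / 4"
      by (rule order_tendstoD(2)[OF kw]) (use d in simp)
    then obtain N2 where N2: "\<forall>n\<ge>N2. kinc (diff3 (V (r n)) w) < \<delta> / 4"
      unfolding eventually_sequentially by blast
    have "kinc (diff3 (H (r k)) (H (r n))) \<le> e" if "k \<ge> max N1 N2" "n \<ge> max N1 N2" for k n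
    proof (rule P[rule_format, OF ac ac])
      have "diff3 (V (r k)) (V (r n)) = diff3 (diff3 (V (r k)) w) (diff3 (V (r n)) w)"
        by (simp add: fun_eq_iff diff3_def)
      moreover have "kinc (diff3 (diff3 (V (r k)) w) (diff3 (V (r n)) w)) \<le> 2 * kinc (diff3 (V (r k)) w) + 2 * kinc (diff3 (V (r n)) w)"
        by (rule kinc_diff3_le) (simp_all add: diff3_def[abs_def] L2_diff[OF ac3_L2(1)[OF ac] wL])
      moreover have "kinc (diff3 (V (r k)) w) < \<delta> / 4" "kinc (diff3 (V (r n)) w) < \<delta> / 4"
        using N2 that by auto
      ultimately show "kinc (diff3 (V (r k)) (V (r n))) \<le> \<delta>" by simp
    qed (use mass CK N1 that in auto)
    then show ?thesis by blast
  qed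
  have "\<exists>g. g \<in> L2 \<and> (\<lambda>n. msq (\<lambda>x. cmod (H (r n) j x - g x))) \<longlonglongrightarrow> 0" for j
  proof -
    have "\<exists>N. \<forall>k\<ge>N. \<forall>n\<ge>N. msq (\<lambda>x. cmod (H (r k) j x - H (r n) j x)) \<le> e" if "0 < e" for e
    proof -
      have "msq (\<lambda>x. cmod (H (r k) j x - H (r n) j x)) \<le> kinc (diff3 (H (r k)) (H (r n)))" for k n
        using msq_le_kinc[of "diff3 (H (r k)) (H (r n))" j] by (simp add: diff3_def)
      then show ?thesis using cauchy[OF that] order_trans by meson
    qed
    then show ?thesis by (rule L2_complete[of "\<lambda>n. H (r n) j", OF ac3_L2(2)[OF ac]])
  qed
  then have "\<exists>g. \<forall>j. g j \<in> L2 \<and> (\<lambda>n. msq (\<lambda>x. cmod (H (r n) j x - g j x))) \<longlonglongrightarrow> 0"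
    by (intro choice) blast
  then obtain g where gL: "\<And>j. g j \<in> L2"
    and lg: "\<And>j. (\<lambda>n. msq (\<lambda>x. cmod (H (r n) j x - g j x))) \<longlonglongrightarrow> 0" by blast
  have kg: "(\<lambda>n. kinc (diff3 (H (r n)) g)) \<longlonglongrightarrow> 0"
  proof -
    have "(\<lambda>n. \<Sum>j\<in>UNIV. msq (\<lambda>x. cmod (H (r n) j x - g j x))) \<longlonglongrightarrow> (\<Sum>j\<in>(UNIV::3 set). 0)"
      by (intro tendsto_sum lg)
    then show ?thesis by (simp add: kinc_eq diff3_def)
  qed
  have wg: "ac3 w g"
    unfolding ac3_def using ac_pair_limit[OF acj wL gL lim lg] by blast
  have dl: "(\<lambda>n. dist3 (V (r n)) (H (r n)) w g) \<longlonglongrightarrow> 0"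
    using tendsto_add[OF kw kg] by (simp add: dist3_def)
  have mw: "msq (\<lambda>x. cmod (w j x)) = m j" for j
  proof -
    define S where "S = sqrt (2 * m j + 2 * msq (\<lambda>x. cmod (w j x)))"
    have "\<bar>m j - msq (\<lambda>x. cmod (w j x))\<bar> \<le> sqrt (msq (\<lambda>x. cmod (V (r n) j x - w j x))) * S" for n
      using msq_cmod_diff_le[OF ac3_L2(1)[OF ac] wL, of "r n" j j] mass by (simp add: S_def)
    moreover have "(\<lambda>n. sqrt (msq (\<lambda>x. cmod (V (r n) j x - w j x))) * S) \<longlonglongrightarrow> sqrt 0 * S"
      by (intro tendsto_intros lw)
    ultimately have "\<bar>m j - msq (\<lambda>x. cmod (w j x))\<bar> \<le> sqrt 0 * S"
      by (intro LIMSEQ_le_const) auto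
    then show ?thesis by simp
  qed
  have "En w g \<le> L + e" if e: "0 < e" for e
  proof -
    \<comment> \<open>Continuity of the energy is available on bounded sets only, so the bound must
      cover the limit as well as the sequence.\<close>
    define C where "C = mtot + CK + kinc w + kinc g"
    have C: "0 \<le> C" using mtot_pos CK0 kinc_nonneg[of w] kinc_nonneg[of g] by (simp add: C_def)
    obtain \<delta> where d: "0 < \<delta>" and P: "\<forall>F G F' G'. ac3 F G \<longrightarrow> ac3 F' G' \<longrightarrow> kinc F + kinc G \<le> C \<longrightarrow>
      kinc F' + kinc G' \<le> C \<longrightarrow> dist3 F G F' G' \<le> \<delta> \<longrightarrow> \<bar>En F G - En F' G'\<bar> \<le> e / 2"
      using En_continuous[OF C, of "e / 2"] e by auto
    have "\<forall>\<^sub>F n in sequentially. dist3 (V (r n)) (H (r n)) w g < \<delta>"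
      by (rule order_tendstoD(2)[OF dl d])
    then obtain N1 where N1: "\<forall>n\<ge>N1. dist3 (V (r n)) (H (r n)) w g < \<delta>"
      unfolding eventually_sequentially by blast
    obtain N2 where N2: "\<forall>n\<ge>N2. En (V (r n)) (H (r n)) \<le> L + e / 2" using Eev[of "e / 2"] e by auto
    define n where "n = max N1 N2"
    have "\<bar>En (V (r n)) (H (r n)) - En w g\<bar> \<le> e / 2"
    proof (rule P[rule_format, OF ac wg])
      show "kinc (V (r n)) + kinc (H (r n)) \<le> C"
        using kV[of "r n"] CK[of "r n"] kinc_nonneg[of w] kinc_nonneg[of g] by (simp add: C_def)
      show "kinc w + kinc g \<le> C" using mtot_pos CK0 by (simp add: C_def)
      show "dist3 (V (r n)) (H (r n)) w g \<le> \<delta>" using N1 by (simp add: n_def less_imp_le)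
    qed
    moreover have "En (V (r n)) (H (r n)) \<le> L + e / 2" using N2 by (simp add: n_def)
    ultimately show ?thesis by linarith
  qed
  then have "En w g \<le> L" by (rule field_le_epsilon)
  then have "En w g = L" using En_ge[OF wg mw] by simp
  then have "is_minimizer w g" using wg mw by (simp add: is_minimizer_def)
  then show ?thesis using that r dl by blast
qed

lemma kinc_bounded:
  "\<exists>C\<ge>0. \<forall>F G. ac3 F G \<longrightarrow> kinc F \<le> M \<longrightarrow> En F G \<le> E \<longrightarrow> kinc G \<le> C"
proof -
  obtain C where "0 \<le> C" "\<forall>f h. ug3 f h \<longrightarrow> kin f \<le> M \<longrightarrow> kin h - pot f \<le> E \<longrightarrow> kin h \<le> C"
    using kin_bounded by blast
  then show ?thesis using ac3_ug3 unfolding kinc_def En_def potc_def by metis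
qed

text \<open>A sequence of counterexamples is minimizing. Each member is translated so that a value
  not smaller than c sits at the origin; energy, masses and the distance to the minimizers are
  unaffected, so a convergent subsequence contradicts the distance from them.\<close>

lemma exact_mass_stability:
  assumes \<epsilon>: "0 < \<epsilon>"
  shows "\<exists>\<delta>>0. \<forall>F G. ac3 F G \<longrightarrow> (\<forall>j. msq (\<lambda>x. cmod (F j x)) = m j) \<longrightarrow> En F G \<le> L + \<delta> \<longrightarrow>
    (\<exists>w g. is_minimizer w g \<and> dist3 F G w g < \<epsilon>)"
proof (rule ccontr)
  assume neg: "\<not> ?thesis"
  obtain CK where CK: "\<forall>F G. ac3 F G \<longrightarrow> kinc F \<le> mtot \<longrightarrow> En F G \<le> 0 \<longrightarrow> kinc G \<le> CK"
    using kinc_bounded by blast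
  obtain c where c: "0 < c"
    and nv: "\<And>f h. ug3 f h \<Longrightarrow> (\<And>j. msq (f j) = m j) \<Longrightarrow> kin h - pot f \<le> L / 2 \<Longrightarrow> \<exists>j x. c \<le> f j x"
    using nonvanishing by metis
  \<comment> \<open>The cap -L / 2 keeps the energies at most L / 2, as \<open>nonvanishing\<close>
    demands, and hence negative, as the choice of \<open>CK\<close> demands.\<close>
  define \<delta> where "\<delta> n = min (1 / real (Suc n)) (- L / 2)" for n
  have dp: "0 < \<delta> n" for n using L_neg by (simp add: \<delta>_def)
  define bad where "bad n F G \<longleftrightarrow> ac3 F G \<and> (\<forall>j. msq (\<lambda>x. cmod (F j x)) = m j) \<and> En F G \<le> L + \<delta> n \<and>
    \<not> (\<exists>w g. is_minimizer w g \<and> dist3 F G w g < \<epsilon>) \<and> (\<exists>i. c \<le> cmod (F i 0))" for n F G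
  have "\<exists>FG. bad n (fst FG) (snd FG)" for n
  proof -
    from neg have "\<exists>F G. ac3 F G \<and> (\<forall>j. msq (\<lambda>x. cmod (F j x)) = m j) \<and> En F G \<le> L + \<delta> n \<and>
      \<not> (\<exists>w g. is_minimizer w g \<and> dist3 F G w g < \<epsilon>)" using dp[of n] by meson
    then obtain F G where F: "ac3 F G" "\<forall>j. msq (\<lambda>x. cmod (F j x)) = m j" "En F G \<le> L + \<delta> n"
      and nm: "\<not> (\<exists>w g. is_minimizer w g \<and> dist3 F G w g < \<epsilon>)" by blast
    have "\<delta> n \<le> - L / 2" by (simp add: \<delta>_def)
    then have "En F G \<le> L / 2" using F(3) by linarith
    then have "kin (\<lambda>j x. cmod (G j x)) - pot (\<lambda>j x. cmod (F j x)) \<le> L / 2"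
      by (simp add: En_def kinc_def potc_def)
    then obtain i y where iy: "c \<le> cmod (F i y)" using nv[OF ac3_ug3[OF F(1)]] F(2) by blast
    have "bad n (shift3 y F) (shift3 y G)"
      unfolding bad_def
    proof (intro conjI)
      show "ac3 (shift3 y F) (shift3 y G)" by (rule ac3_shift3[OF F(1)])
      show "\<forall>j. msq (\<lambda>x. cmod (shift3 y F j x)) = m j"
        using F(2) msq_shift3[OF ac3_L2(1)[OF F(1)]] by simp
      show "En (shift3 y F) (shift3 y G) \<le> L + \<delta> n" using F(3) En_shift3[OF F(1)] by simp
      show "\<exists>i. c \<le> cmod (shift3 y F i 0)" using iy by (auto simp: shift3_def)
      show "\<not> (\<exists>w g. is_minimizer w g \<and> dist3 (shift3 y F) (shift3 y G) w g < \<epsilon>)"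
      proof
        assume "\<exists>w g. is_minimizer w g \<and> dist3 (shift3 y F) (shift3 y G) w g < \<epsilon>"
        then obtain w g where w: "is_minimizer w g" "dist3 (shift3 y F) (shift3 y G) w g < \<epsilon>" by blast
        have "dist3 F G (shift3 (- y) w) (shift3 (- y) g) = dist3 (shift3 y F) (shift3 y G) w g"
          using dist3_shift3[of "shift3 y F" "shift3 y G" w g "- y"] ac3_shift3[OF F(1)] w(1)
          by (simp add: shift3_shift3 is_minimizer_def)
        then show False using nm is_minimizer_shift3[OF w(1)] w(2) by metis
      qed
    qed
    then show ?thesis by (intro exI[of _ "(shift3 y F, shift3 y G)"]) simp
  qed
  then obtain FG where FG: "\<And>n. bad n (fst (FG n)) (snd (FG n))" by metis
  define V H where "V n = fst (FG n)" and "H n = snd (FG n)" for n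
  have b: "bad n (V n) (H n)" for n using FG by (simp add: V_def H_def)
  have ac: "ac3 (V n) (H n)" and mass: "msq (\<lambda>x. cmod (V n j x)) = m j" and E: "En (V n) (H n) \<le> L + \<delta> n"
    and nm: "\<not> (\<exists>w g. is_minimizer w g \<and> dist3 (V n) (H n) w g < \<epsilon>)" and nz: "\<exists>i. c \<le> cmod (V n i 0)" for n j
    using b[of n] unfolding bad_def by auto
  have kb: "kinc (H n) \<le> CK" for n
  proof -
    have "\<delta> n \<le> - L / 2" by (simp add: \<delta>_def)
    then have "En (V n) (H n) \<le> 0" using E[of n] L_neg by linarith
    moreover have "kinc (V n) \<le> mtot" using kinc_mtot[OF mass] by simp
    ultimately show ?thesis using CK ac by blast
  qed
  have El: "(\<lambda>n. En (V n) (H n)) \<longlonglongrightarrow> L"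
  proof (rule tendsto_sandwich)
    show "\<forall>\<^sub>F n in sequentially. L \<le> En (V n) (H n)" using En_ge[OF ac mass] by simp
    have "En (V n) (H n) \<le> L + 1 / real (Suc n)" for n
      using E[of n] unfolding \<delta>_def by linarith
    then show "\<forall>\<^sub>F n in sequentially. En (V n) (H n) \<le> L + 1 / real (Suc n)" by simp
    have "(\<lambda>n. L + 1 / real (Suc n)) \<longlonglongrightarrow> L + 0"
      by (intro tendsto_add tendsto_const LIMSEQ_Suc[OF lim_1_over_n])
    then show "(\<lambda>n. L + 1 / real (Suc n)) \<longlonglongrightarrow> L" by simp
  qed simp
  obtain r w g where "strict_mono (r :: nat \<Rightarrow> nat)" and w: "is_minimizer w g"
    and l: "(\<lambda>n. dist3 (V (r n)) (H (r n)) w g) \<longlonglongrightarrow> 0"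
    by (rule minimizing_sequence_converges[OF ac mass El kb c nz]) (rule that)
  from order_tendstoD(2)[OF l \<epsilon>] obtain n where "dist3 (V (r n)) (H (r n)) w g < \<epsilon>"
    unfolding eventually_sequentially by blast
  then show False using nm w by blast
qed

text \<open>Multiplying each component by a factor near 1 restores the exact masses. This moves the
  triple little and changes its energy little, so the exact version applies to the rescaled
  triple.\<close>

lemma mass_stability:
  assumes \<epsilon>: "0 < \<epsilon>"
  shows "\<exists>\<delta>>0. \<forall>F G. ac3 F G \<longrightarrow> (\<forall>j. \<bar>msq (\<lambda>x. cmod (F j x)) - m j\<bar> \<le> \<delta>) \<longrightarrow> En F G \<le> L + \<delta> \<longrightarrow>
    (\<exists>w g. is_minimizer w g \<and> dist3 F G w g < \<epsilon>)"
proof -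
  obtain \<delta>1 where d1: "0 < \<delta>1" and P1: "\<forall>F G. ac3 F G \<longrightarrow> (\<forall>j. msq (\<lambda>x. cmod (F j x)) = m j) \<longrightarrow>
    En F G \<le> L + \<delta>1 \<longrightarrow> (\<exists>w g. is_minimizer w g \<and> dist3 F G w g < \<epsilon> / 4)"
    using exact_mass_stability[of "\<epsilon> / 4"] \<epsilon> by auto
  \<comment> \<open>Each of the three masses may exceed its target by at most 1. The factor 4 in
    \<open>C\<close> allows for scaling factors up to 2.\<close>
  obtain CK where CK0: "0 \<le> CK" and CK: "\<forall>F G. ac3 F G \<longrightarrow> kinc F \<le> mtot + 3 \<longrightarrow> En F G \<le> L + 1 \<longrightarrow> kinc G \<le> CK"
    using kinc_bounded by blast
  define C where "C = 4 * (mtot + 3 + CK)"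
  have C: "0 < C" using mtot_pos CK0 by (simp add: C_def)
  obtain \<delta>2 where d2: "0 < \<delta>2" and P2: "\<forall>F G F' G'. ac3 F G \<longrightarrow> ac3 F' G' \<longrightarrow> kinc F + kinc G \<le> C \<longrightarrow>
    kinc F' + kinc G' \<le> C \<longrightarrow> dist3 F G F' G' \<le> \<delta>2 \<longrightarrow> \<bar>En F G - En F' G'\<bar> \<le> \<delta>1 / 2"
    using En_continuous[OF less_imp_le[OF C], of "\<delta>1 / 2"] d1 by auto
  \<comment> \<open>Bounds the deviation of the scaling factors from 1, so the squared distance to
    the rescaled triple is at most \<eta>^2 C. One half of the minimum serves the final distance,
    the other the change of energy.\<close>
  define \<eta> where "\<eta> = min 1 (min (\<epsilon> / 4) \<delta>2 / C)"
  have \<eta>: "0 < \<eta>" "\<eta> \<le> 1" using \<epsilon> d2 C by (auto simp: \<eta>_def)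
  have \<eta>C: "\<eta>\<^sup>2 * C \<le> min (\<epsilon> / 4) \<delta>2"
  proof -
    have "\<eta>\<^sup>2 \<le> \<eta>" using \<eta> by (simp add: power2_eq_square mult_left_le_one_le)
    also have "\<dots> \<le> min (\<epsilon> / 4) \<delta>2 / C" by (simp add: \<eta>_def)
    finally show ?thesis using C by (simp only: pos_le_divide_eq)
  qed
  define mm where "mm = Min (range m)"
  have mm: "0 < mm" "\<And>j. mm \<le> m j" unfolding mm_def by (subst Min_gr_iff) (auto simp: m_pos)
  \<comment> \<open>The last term keeps every mass above half its target and its relative error
    below \<eta>; the scaling factors, being square roots, then deviate from 1 by at most
    \<eta>.\<close>
  define \<delta> where "\<delta> = min (min 1 (\<delta>1 / 2)) (\<eta> * mm / 2)"
  have \<delta>: "0 < \<delta>" "\<delta> \<le> 1" "\<delta> \<le> \<delta>1 / 2" "\<delta> \<le> \<eta> * mm / 2"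
    using d1 \<eta> mm by (auto simp: \<delta>_def)
  have "\<exists>w g. is_minimizer w g \<and> dist3 F G w g < \<epsilon>"
    if F: "ac3 F G" and M: "\<forall>j. \<bar>msq (\<lambda>x. cmod (F j x)) - m j\<bar> \<le> \<delta>" and E: "En F G \<le> L + \<delta>" for F G
  proof -
    let ?M = "\<lambda>j. msq (\<lambda>x. cmod (F j x))"
    have Mb: "?M j \<le> m j + \<delta>" "m j - \<delta> \<le> ?M j" for j using M[rule_format, of j] by linarith+
    have "\<eta> * mm \<le> mm" using \<eta> mm by simp
    then have dm: "\<delta> \<le> m j / 2" for j using \<delta>(4) mm(2)[of j] by linarith
    have Mp: "m j / 2 \<le> ?M j" for j using Mb(2)[of j] dm[of j] by linarith
    have M0: "0 < ?M j" for j using Mp[of j] m_pos[of j] by linarith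
    have kF: "kinc F \<le> mtot + 3"
    proof -
      have "kinc F \<le> (\<Sum>j\<in>UNIV. m j + 1)" unfolding kinc_eq using Mb(1) \<delta>(2) by (intro sum_mono) (meson add_left_mono order_trans)
      then show ?thesis by (simp add: sum.distrib mtot_def)
    qed
    have kG: "kinc G \<le> CK" using CK F kF E \<delta>(2) by auto
    define \<theta> where "\<theta> j = sqrt (m j / ?M j)" for j
    have t0: "0 \<le> \<theta> j" "(\<theta> j)\<^sup>2 = m j / ?M j" for j using M0[of j] m_pos[of j] by (auto simp: \<theta>_def)
    have t1: "\<bar>\<theta> j - 1\<bar> \<le> \<eta>" for j
    proof -
      have "\<bar>\<theta> j - 1\<bar> * 1 \<le> \<bar>\<theta> j - 1\<bar> * (\<theta> j + 1)" using t0(1)[of j] by (intro mult_left_mono) auto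
      also have "\<dots> = \<bar>(\<theta> j)\<^sup>2 - 1\<bar>"
      proof -
        have "(\<theta> j)\<^sup>2 - 1 = (\<theta> j - 1) * (\<theta> j + 1)" by (simp add: power2_eq_square algebra_simps)
        then show ?thesis using t0(1)[of j] by (simp add: abs_mult)
      qed
      also have "(\<theta> j)\<^sup>2 - 1 = (m j - ?M j) / ?M j" using M0[of j] by (simp add: t0 diff_divide_distrib)
      also have "\<bar>(m j - ?M j) / ?M j\<bar> = \<bar>m j - ?M j\<bar> / ?M j" using M0[of j] by (simp add: abs_divide)
      also have "\<dots> \<le> (\<eta> * mm / 2) / (m j / 2)"
      proof (rule frac_le)
        show "\<bar>m j - ?M j\<bar> \<le> \<eta> * mm / 2" using M[rule_format, of j] \<delta>(4) by linarith
      qed (use Mp m_pos \<eta> mm in auto)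
      also have "\<dots> \<le> \<eta>"
      proof -
        have "\<eta> * mm / 2 \<le> \<eta> * (m j / 2)" using mm(2)[of j] \<eta> by simp
        then show ?thesis using m_pos[of j] by (simp add: divide_le_eq)
      qed
      finally show ?thesis by simp
    qed
    define F' G' where "F' j x = complex_of_real (\<theta> j) * F j x" and "G' j x = complex_of_real (\<theta> j) * G j x" for j x
    have F': "ac3 F' G'"
      using F unfolding ac3_def F'_def[abs_def] G'_def[abs_def] by (simp add: ac_pair_cmult)
    have cm: "cmod (F' j x) = \<theta> j * cmod (F j x)" "cmod (G' j x) = \<theta> j * cmod (G j x)" for j x
      using t0(1) by (simp_all add: F'_def G'_def norm_mult)
    have mF': "msq (\<lambda>x. cmod (F' j x)) = m j" for j
      using M0[of j] by (simp add: cm msq_scale t0)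
    have t4: "(\<theta> j)\<^sup>2 \<le> 4" for j
      using power_mono[of "\<theta> j" 2 2] t1[of j] \<eta>(2) t0(1)[of j] by simp
    have kF': "kinc F' \<le> 4 * kinc F" "kinc G' \<le> 4 * kinc G"
      unfolding kinc_eq cm msq_scale sum_distrib_left by (intro sum_mono mult_right_mono t4 msq_nonneg)+
    have dist: "dist3 F G F' G' \<le> \<eta>\<^sup>2 * (kinc F + kinc G)"
    proof -
      have cd: "cmod (diff3 U (\<lambda>j x. complex_of_real (\<theta> j) * U j x) j x) = \<bar>1 - \<theta> j\<bar> * cmod (U j x)" for U j x
      proof -
        have "diff3 U (\<lambda>j x. complex_of_real (\<theta> j) * U j x) j x = complex_of_real (1 - \<theta> j) * U j x"
          by (simp add: diff3_def algebra_simps)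
        then show ?thesis by (simp only: norm_mult norm_of_real)
      qed
      have sq: "\<bar>1 - \<theta> j\<bar>\<^sup>2 \<le> \<eta>\<^sup>2" for j
        using t1[of j] by (intro power_mono) (auto simp: abs_minus_commute)
      have "kinc (diff3 U (\<lambda>j x. complex_of_real (\<theta> j) * U j x)) \<le> \<eta>\<^sup>2 * kinc U" for U
        unfolding kinc_eq cd msq_scale sum_distrib_left by (intro sum_mono mult_right_mono sq msq_nonneg)
      from add_mono[OF this[of F] this[of G]] show ?thesis
        unfolding dist3_def F'_def[abs_def] G'_def[abs_def] by (simp add: distrib_left)
    qed
    also have "\<dots> \<le> \<eta>\<^sup>2 * C"
      using kF kG mtot_pos CK0 by (intro mult_left_mono) (auto simp: C_def)
    finally have D: "dist3 F G F' G' \<le> \<epsilon> / 4" "dist3 F G F' G' \<le> \<delta>2" using \<eta>C by auto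
    have "\<bar>En F G - En F' G'\<bar> \<le> \<delta>1 / 2"
    proof (rule P2[rule_format, OF F F' _ _ D(2)])
      show "kinc F + kinc G \<le> C" using kF kG mtot_pos CK0 by (simp add: C_def)
      show "kinc F' + kinc G' \<le> C" using kF' kF kG by (simp add: C_def)
    qed
    then have "En F' G' \<le> L + \<delta>1" using E \<delta>(3) by linarith
    then obtain w g where w: "is_minimizer w g" "dist3 F' G' w g < \<epsilon> / 4"
      using P1 F' mF' by blast
    have "ac3 w g" using w by (simp add: is_minimizer_def)
    from dist3_triangle[OF F F' this] have "dist3 F G w g < \<epsilon>" using D(1) w(2) by linarith
    then show ?thesis using w(1) by blast
  qed
  then show ?thesis using \<delta>(1) by blast
qed

end

section \<open>Solutions near the minimizers\<close>

text \<open>Links an arbitrary Borel representative f to its absolutely continuous representative F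
  and derivative G. Pointwise estimates are made on F and G, while norms, masses and energy take the
  same values for f.\<close>

definition represents :: "triple \<Rightarrow> triple \<Rightarrow> triple \<Rightarrow> bool" where
  "represents f F G \<longleftrightarrow> ac3 F G \<and> (\<forall>j. f j \<in> H1 \<and> (AE x in lborel. f j x = F j x) \<and>
     (AE x in lborel. weak_deriv (f j) x = G j x))"

lemma Y_represents: "f \<in> Y \<Longrightarrow> \<exists>F G. represents f F G"
proof -
  assume "f \<in> Y"
  then have H: "f j \<in> H1" for j by (simp add: Y_def)
  have "\<exists>F. \<forall>j. ac_pair (F j) (weak_deriv (f j)) \<and> (AE x in lborel. f j x = F j x)"
    by (intro choice allI) (metis H1_imp_ac_pair[OF H])
  then obtain F where "\<forall>j. ac_pair (F j) (weak_deriv (f j)) \<and> (AE x in lborel. f j x = F j x)" by blast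
  then have "represents f F (\<lambda>j. weak_deriv (f j))" using H by (simp add: represents_def ac3_def)
  then show ?thesis by blast
qed

lemma ac3_represents:
  assumes "ac3 F G" "\<And>j. f j \<in> borel_measurable borel" "\<And>j. AE x in lborel. f j x = F j x"
  shows "represents f F G"
  using assms ac_pair_imp_H1[of "F j" "G j" "f j" for j] by (simp add: represents_def ac3_def)

lemma represents_Y: "represents f F G \<Longrightarrow> f \<in> Y"
  by (simp add: represents_def Y_def)

lemma represents_measurable:
  assumes "represents f F G"
  shows "f j \<in> borel_measurable borel" "weak_deriv (f j) \<in> borel_measurable borel"
    "F j \<in> borel_measurable borel" "G j \<in> borel_measurable borel"
proof -
  have "f j \<in> H1" "ac3 F G" using assms by (simp_all add: represents_def)
  then show "f j \<in> borel_measurable borel" "weak_deriv (f j) \<in> borel_measurable borel"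
    "F j \<in> borel_measurable borel" "G j \<in> borel_measurable borel"
    using H1_weak_deriv(1,2)[of "f j"] ac3_L2[of F G j] by (simp_all add: L2_iff)
qed

lemma represents_self: "ac3 F G \<Longrightarrow> represents F F G"
  using ac3_L2(1)[of F G] by (intro ac3_represents) (auto simp: L2_iff)

lemma represents_eq_Y:
  assumes "represents f F G" "eq_Y g f" "g \<in> Y" shows "represents g F G"
proof (rule ac3_represents)
  show "ac3 F G" using assms by (simp add: represents_def)
  show "g j \<in> borel_measurable borel" for j
    using assms(3) H1_weak_deriv(1)[of "g j"] by (simp add: Y_def L2_iff)
  show "AE x in lborel. g j x = F j x" for j
  proof -
    have "AE x in lborel. f j x = F j x" "AE x in lborel. g j x = f j x"
      using assms by (simp_all add: represents_def eq_Y_def)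
    then show ?thesis by eventually_elim simp
  qed
qed

lemma represents_mass:
  assumes "represents f F G"
  shows "mass (f j) = msq (\<lambda>x. cmod (F j x))" "(norm_L2 (f j))\<^sup>2 = msq (\<lambda>x. cmod (F j x))"
proof -
  note [measurable] = represents_measurable[OF assms]
  have ae: "AE x in lborel. f j x = F j x" using assms by (simp add: represents_def)
  show m: "mass (f j) = msq (\<lambda>x. cmod (F j x))"
    unfolding mass_def msq_def by (rule integral_cong_AE) (use ae in auto)
  show "(norm_L2 (f j))\<^sup>2 = msq (\<lambda>x. cmod (F j x))"
    using m msq_nonneg[of "\<lambda>x. cmod (F j x)"] unfolding norm_L2_def mass_def by simp
qed

lemma represents_norm_Y:
  assumes "represents f F G" shows "norm_Y f = sqrt (kinc F + kinc G)"
proof -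
  note [measurable] = represents_measurable[OF assms]
  have ac: "ac3 F G" using assms by (simp add: represents_def)
  have "(norm_H1 (f j))\<^sup>2 = msq (\<lambda>x. cmod (F j x)) + msq (\<lambda>x. cmod (G j x))" for j
  proof -
    have ae: "AE x in lborel. f j x = F j x" "AE x in lborel. weak_deriv (f j) x = G j x"
      using assms by (simp_all add: represents_def)
    have "(norm_H1 (f j))\<^sup>2 = (LINT x|lborel. (cmod (f j x))\<^sup>2 + (cmod (weak_deriv (f j) x))\<^sup>2)"
      unfolding norm_H1_def by simp
    also have "\<dots> = (LINT x|lborel. (cmod (F j x))\<^sup>2 + (cmod (G j x))\<^sup>2)"
    proof (rule integral_cong_AE)
      show "AE x in lborel. (cmod (f j x))\<^sup>2 + (cmod (weak_deriv (f j) x))\<^sup>2 = (cmod (F j x))\<^sup>2 + (cmod (G j x))\<^sup>2"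
        using ae by eventually_elim simp
    qed simp_all
    also have "\<dots> = msq (\<lambda>x. cmod (F j x)) + msq (\<lambda>x. cmod (G j x))"
      using ac3_L2[OF ac, of j] by (simp add: msq_def L2_def)
    finally show ?thesis .
  qed
  then show ?thesis by (simp add: norm_Y_def kinc_eq sum.distrib)
qed

lemma represents_diff:
  assumes "represents f F G" "represents f' F' G'"
  shows "represents (f - f') (diff3 F F') (diff3 G G')"
proof (rule ac3_represents)
  show "ac3 (diff3 F F') (diff3 G G')" using assms by (simp add: represents_def ac3_diff3)
  show "(f - f') j \<in> borel_measurable borel" for j
    using represents_measurable(1)[OF assms(1), of j] represents_measurable(1)[OF assms(2), of j]
    by (simp add: fun_diff_def)
  show "AE x in lborel. (f - f') j x = diff3 F F' j x" for j
  proof -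
    have "AE x in lborel. f j x = F j x" "AE x in lborel. f' j x = F' j x"
      using assms by (simp_all add: represents_def)
    then show ?thesis by eventually_elim (simp add: diff3_def)
  qed
qed

lemma norm_Y_diff:
  "represents f F G \<Longrightarrow> represents f' F' G' \<Longrightarrow> norm_Y (f - f') = sqrt (dist3 F G F' G')"
  using represents_norm_Y[OF represents_diff] by (simp add: dist3_def)

lemma (in nls_coefficients) represents_energy:
  assumes "represents f F G" shows "energy p a f = En F G"
proof -
  note [measurable] = represents_measurable[OF assms]
  have ac: "ac3 F G" using assms by (simp add: represents_def)
  have ae: "AE x in lborel. \<forall>j. f j x = F j x \<and> weak_deriv (f j) x = G j x"
    using assms by (subst AE_all_countable) (auto simp: represents_def)
  have "energy p a f = (LINT x|lborel. (\<Sum>j\<in>UNIV. (cmod (G j x))\<^sup>2) - 1 / p * dens (\<lambda>j x. cmod (F j x)) x)"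
    unfolding energy_def dens_def
  proof (rule integral_cong_AE)
    show "AE x in lborel. (\<Sum>j\<in>UNIV. (cmod (weak_deriv (f j) x))\<^sup>2)
        - 1 / p * (\<Sum>k\<in>UNIV. \<Sum>j\<in>UNIV. a k j * cmod (f k x) powr p * cmod (f j x) powr p)
      = (\<Sum>j\<in>UNIV. (cmod (G j x))\<^sup>2) - 1 / p * (\<Sum>k\<in>UNIV. \<Sum>j\<in>UNIV. a k j * cmod (F k x) powr p * cmod (F j x) powr p)"
      using ae by eventually_elim simp
  qed simp_all
  also have "\<dots> = En F G"
    using dens_integrable[OF ac3_ug3[OF ac]] ac3_L2(2)[OF ac]
    by (simp add: En_def kinc_eq msq_def potc_def pot_def L2_def)
  finally show ?thesis .
qed

text \<open>\<open>well_posed\<close> grants the conservation laws to one particular solution;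
  uniqueness up to null sets at each time passes them on to every solution with the same
  datum.\<close>

lemma well_posed_conserves:
  assumes wp: "well_posed p a" and u: "nls_solution p a u" "eq_Y (u 0) u0" and u0: "represents u0 F0 G0"
    and "nls_coefficients p a"
  shows "\<exists>F G. represents (u \<tau>) F G \<and> nls_coefficients.En p a F G = nls_coefficients.En p a F0 G0 \<and>
    (\<forall>j. msq (\<lambda>x. cmod (F j x)) = msq (\<lambda>x. cmod (F0 j x)))"
proof -
  interpret nls_coefficients p a by fact
  obtain v where v: "nls_solution p a v" "eq_Y (v 0) u0"
    and uniq: "\<forall>w. nls_solution p a w \<and> eq_Y (w 0) u0 \<longrightarrow> (\<forall>\<tau>. eq_Y (w \<tau>) (v \<tau>))"
    and E: "\<forall>\<tau>. energy p a (v \<tau>) = energy p a (v 0)" and M: "\<forall>\<tau> j. mass (v \<tau> j) = mass (v 0 j)"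
    using wp represents_Y[OF u0] unfolding well_posed_def by blast
  have Y: "u \<tau> \<in> Y" "v \<tau> \<in> Y" for \<tau>
    using u v by (auto simp: nls_solution_def continuous_in_Y_def)
  have r0: "represents (v 0) F0 G0" using represents_eq_Y[OF u0 v(2) Y(2)] .
  obtain F G where r: "represents (v \<tau>) F G" using Y_represents[OF Y(2)] by blast
  have "eq_Y (u \<tau>) (v \<tau>)" using uniq u by blast
  then have "represents (u \<tau>) F G" using represents_eq_Y[OF r _ Y(1)] by blast
  moreover have "En F G = En F0 G0"
    using E represents_energy[OF r] represents_energy[OF r0] by simp
  moreover have "msq (\<lambda>x. cmod (F j x)) = msq (\<lambda>x. cmod (F0 j x))" for j
    using M[rule_format, of \<tau> j] represents_mass(1)[OF r, of j] represents_mass(1)[OF r0, of j] by simp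
  ultimately show ?thesis by blast
qed

section \<open>Passage from \<open>Y\<close> to the minimization problem, and stability\<close>

definition masses :: "real \<Rightarrow> real \<Rightarrow> real \<Rightarrow> 3 \<Rightarrow> real" where
  "masses r s t j = (if j = 1 then r else if j = 2 then s else t)"

lemma all_masses_iff: "(\<forall>j. q j = masses r s t j) \<longleftrightarrow> q 1 = r \<and> q 2 = s \<and> q 3 = t"
  by (simp add: forall_3 masses_def)

lemma represents_constraint_set:
  assumes "represents f F G"
  shows "f \<in> constraint_set r s t \<longleftrightarrow> (\<forall>j. msq (\<lambda>x. cmod (F j x)) = masses r s t j)"
  using represents_mass(2)[OF assms] represents_Y[OF assms]
  by (simp add: all_masses_iff constraint_set_def)

text \<open>A triple with upper gradients, regarded as complex valued, lies in \<open>Y\<close> with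
  the same masses and potential energy and with no larger kinetic energy, so the infimum over the
  constraint set bounds its energy from below.\<close>

lemma minimization_locale:
  assumes "2 \<le> p" "p < 3" "\<And>k j. 0 < a k j" "0 < r" "0 < s" "0 < t"
    and min: "ereal L = min_energy p a r s t"
  shows "minimization p a (masses r s t) L"
proof -
  interpret nls_coefficients p a by unfold_locales (use assms in auto)
  show ?thesis
  proof unfold_locales
    show "0 < masses r s t j" for j using assms by (simp add: masses_def)
    fix f h assume u: "ug3 f h" and m: "\<And>j. msq (f j) = masses r s t j"
    have "\<exists>g. \<forall>j. ac_pair (\<lambda>x. complex_of_real (f j x)) (g j) \<and> msq (\<lambda>x. cmod (g j x)) \<le> msq (h j)"
    proof (intro choice allI)
      fix j
      have "upper_grad (f j) (h j)" using u by (simp add: ug3_def)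
      then show "\<exists>g. ac_pair (\<lambda>x. complex_of_real (f j x)) g \<and> msq (\<lambda>x. cmod (g x)) \<le> msq (h j)"
        unfolding msq_def by (rule upper_grad_imp_ac_pair) blast
    qed
    then obtain g where g: "\<forall>j. ac_pair (\<lambda>x. complex_of_real (f j x)) (g j) \<and> msq (\<lambda>x. cmod (g j x)) \<le> msq (h j)" by blast
    define F where "F j x = complex_of_real (f j x)" for j x
    have F: "ac3 F g" using g by (simp add: ac3_def F_def[abs_def])
    have cF: "cmod (F j x) = f j x" for j x
      using upper_gradD(1)[of "f j" "h j" x] u by (simp add: F_def ug3_def)
    note rep = represents_self[OF F]
    have "F \<in> constraint_set r s t" using represents_constraint_set[OF rep] m by (simp add: cF)
    then have "ereal L \<le> ereal (energy p a F)" unfolding min min_energy_def by (rule INF_lower)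
    then have "L \<le> En F g" using represents_energy[OF rep] by simp
    also have "\<dots> \<le> kin h - pot f"
    proof -
      have "kinc g \<le> kin h" unfolding kinc_eq kin_def using g by (intro sum_mono) auto
      then show ?thesis by (simp add: En_def potc_def cF)
    qed
    finally show "L \<le> kin h - pot f" .
  qed
qed

theorem theorem4p1:
  fixes p r s t :: real and a :: "3 \<Rightarrow> 3 \<Rightarrow> real"
  assumes "2 \<le> p" and "p < 3"
    and "\<And>k j. 0 < a k j" and "\<And>k j. a k j = a j k"
    and "0 < r" and "0 < s" and "0 < t"
    and "well_posed p a"
  shows "\<forall>\<epsilon>::real. \<epsilon> > 0 \<longrightarrow> (\<exists>\<delta>::real. \<delta> > 0 \<and>
           (\<forall>u\<^sub>0\<in>Y. dist_Y_set u\<^sub>0 (minimizers p a r s t) < ereal \<delta> \<longrightarrow>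
              (\<forall>u. nls_solution p a u \<and> eq_Y (u 0) u\<^sub>0 \<longrightarrow>
                 (SUP \<tau>. dist_Y_set (u \<tau>) (minimizers p a r s t)) < ereal \<epsilon>)))"
proof (cases "minimizers p a r s t = {}")
  case True
  \<comment> \<open>Without minimizers no datum satisfies the closeness hypothesis, so any \<delta>
    works.\<close>
  then have "dist_Y_set v (minimizers p a r s t) = \<infinity>" for v
    by (simp add: dist_Y_set_def top_ereal_def)
  then show ?thesis by (intro allI impI exI[of _ 1]) simp
next
  case False
  then obtain \<Phi>0 where \<Phi>0: "\<Phi>0 \<in> minimizers p a r s t" by blast
  \<comment> \<open>Taking \<open>L\<close> as the energy of a minimizer makes the infimum a real
    number at once.\<close>
  define L where "L = energy p a \<Phi>0"
  define m where "m = masses r s t"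
  have L: "ereal L = min_energy p a r s t" using \<Phi>0 by (simp add: L_def minimizers_def)
  interpret minimization p a m L
    unfolding m_def by (rule minimization_locale) (use assms L in auto)
  have minI: "w \<in> minimizers p a r s t" if "is_minimizer w g" for w g
  proof -
    have "ac3 w g" using that by (simp add: is_minimizer_def)
    note rep = represents_self[OF this]
    have "\<forall>j. msq (\<lambda>x. cmod (w j x)) = masses r s t j" "En w g = L"
      using that by (simp_all add: is_minimizer_def flip: m_def)
    then show ?thesis
      using represents_constraint_set[OF rep, of r s t] represents_energy[OF rep] L
      by (simp add: minimizers_def)
  qed
  have minD: "\<exists>P Q. represents \<Phi> P Q \<and> is_minimizer P Q" if \<Phi>: "\<Phi> \<in> minimizers p a r s t" for \<Phi>
  proof -
    have "\<Phi> \<in> Y" using \<Phi> by (simp add: minimizers_def constraint_set_def)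
    then obtain P Q where rep: "represents \<Phi> P Q" using Y_represents by blast
    have "ereal (energy p a \<Phi>) = ereal L" using \<Phi> L by (simp add: minimizers_def)
    then have "En P Q = L" using represents_energy[OF rep] by simp
    moreover have "\<forall>j. msq (\<lambda>x. cmod (P j x)) = m j"
      using represents_constraint_set[OF rep, of r s t] \<Phi> by (simp add: minimizers_def m_def)
    ultimately have "is_minimizer P Q" using rep by (simp add: is_minimizer_def represents_def)
    then show ?thesis using rep by blast
  qed
  obtain CK where CK0: "0 \<le> CK" and CK: "\<forall>F G. ac3 F G \<longrightarrow> kinc F \<le> mtot \<longrightarrow> En F G \<le> L \<longrightarrow> kinc G \<le> CK"
    using kinc_bounded by blast
  define C where "C = 2 * (mtot + CK) + 2"
  have C: "0 \<le> C" using mtot_pos CK0 by (simp add: C_def)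
  show ?thesis
  proof (intro allI impI)
    fix \<epsilon> :: real assume \<epsilon>: "0 < \<epsilon>"
    \<comment> \<open>The square is there because \<open>dist3\<close> is a squared distance;
      \<epsilon> / 2 leaves room for a strict inequality after the supremum over time.\<close>
    obtain \<delta>1 where d1: "0 < \<delta>1" and P1: "\<forall>F G. ac3 F G \<longrightarrow> (\<forall>j. \<bar>msq (\<lambda>x. cmod (F j x)) - m j\<bar> \<le> \<delta>1) \<longrightarrow>
      En F G \<le> L + \<delta>1 \<longrightarrow> (\<exists>w g. is_minimizer w g \<and> dist3 F G w g < (\<epsilon> / 2)\<^sup>2)"
      using mass_stability[of "(\<epsilon> / 2)\<^sup>2"] \<epsilon> by auto
    obtain \<delta>2 where d2: "0 < \<delta>2" and P2: "\<forall>F G F' G'. ac3 F G \<longrightarrow> ac3 F' G' \<longrightarrow> kinc F + kinc G \<le> C \<longrightarrow>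
      kinc F' + kinc G' \<le> C \<longrightarrow> dist3 F G F' G' \<le> \<delta>2 \<longrightarrow> \<bar>En F G - En F' G'\<bar> \<le> \<delta>1"
      using En_continuous[OF C d1] by blast
    define q where "q = \<delta>1 / (sqrt (4 * C) + 1)"
    have sC: "0 < sqrt (4 * C) + 1" using C by (simp add: add_nonneg_pos)
    have q: "0 < q" using d1 sC by (simp add: q_def)
    \<comment> \<open>The bound 1 keeps the datum in the ball of size \<open>C\<close>,
      \<open>\<delta>2\<close> controls its energy, and q^2 controls its masses through
      \<open>msq_cmod_diff_le\<close>.\<close>
    define D0 where "D0 = min 1 (min \<delta>2 (q\<^sup>2))"
    have D0: "0 < D0" "D0 \<le> 1" "D0 \<le> \<delta>2" "D0 \<le> q\<^sup>2" using d2 q by (auto simp: D0_def)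
    have close: "(\<forall>j. \<bar>msq (\<lambda>x. cmod (F j x)) - m j\<bar> \<le> \<delta>1) \<and> En F G \<le> L + \<delta>1"
      if F: "ac3 F G" and P: "is_minimizer P Q" and D: "dist3 F G P Q \<le> D0" for F G P Q
    proof -
      have PQ: "ac3 P Q" and mP: "\<And>j. msq (\<lambda>x. cmod (P j x)) = m j" and EP: "En P Q = L"
        using P by (auto simp: is_minimizer_def)
      have kP: "kinc P = mtot" using kinc_mtot[OF mP] .
      have kQ: "kinc Q \<le> CK" using CK PQ kP EP by simp
      have cP: "kinc P + kinc Q \<le> C" using kP kQ mtot_pos CK0 by (simp add: C_def)
      have kinc_split: "kinc U \<le> 2 * kinc (diff3 U V) + 2 * kinc V" if "\<And>j. U j \<in> L2" "\<And>j. V j \<in> L2" for U V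
      proof -
        have "diff3 (diff3 U V) (\<lambda>j x. - V j x) = U" by (simp add: fun_eq_iff diff3_def)
        moreover have "(\<lambda>x. - V j x) \<in> L2" for j using L2_cmult[OF that(2)[of j], of "-1"] by simp
        moreover have "diff3 U V j \<in> L2" for j unfolding diff3_def[abs_def] using L2_diff that by blast
        ultimately have "kinc U \<le> 2 * kinc (diff3 U V) + 2 * kinc (\<lambda>j x. - V j x)"
          using kinc_diff3_le[of "diff3 U V" "\<lambda>j x. - V j x"] by simp
        then show ?thesis by (simp add: kinc_eq)
      qed
      have cF: "kinc F + kinc G \<le> C"
      proof -
        have "kinc F + kinc G \<le> (2 * kinc (diff3 F P) + 2 * kinc P) + (2 * kinc (diff3 G Q) + 2 * kinc Q)"
          by (intro add_mono kinc_split ac3_L2[OF F] ac3_L2[OF PQ])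
        also have "\<dots> = 2 * dist3 F G P Q + 2 * (kinc P + kinc Q)" by (simp add: dist3_def)
        also have "\<dots> \<le> 2 * 1 + 2 * (mtot + CK)"
          using D D0(2) kP kQ by (intro add_mono mult_left_mono) auto
        finally show ?thesis by (simp add: C_def)
      qed
      have "\<bar>En F G - En P Q\<bar> \<le> \<delta>1" using P2 F PQ cF cP D D0(3) by auto
      then have "En F G \<le> L + \<delta>1" using EP by linarith
      moreover have "\<bar>msq (\<lambda>x. cmod (F j x)) - m j\<bar> \<le> \<delta>1" for j
      proof -
        have "\<bar>msq (\<lambda>x. cmod (F j x)) - msq (\<lambda>x. cmod (P j x))\<bar>
          \<le> sqrt (msq (\<lambda>x. cmod (F j x - P j x))) * sqrt (2 * msq (\<lambda>x. cmod (F j x)) + 2 * msq (\<lambda>x. cmod (P j x)))"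
          by (rule msq_cmod_diff_le[OF ac3_L2(1)[OF F] ac3_L2(1)[OF PQ]])
        also have "\<dots> \<le> q * sqrt (4 * C)"
        proof (rule mult_mono)
          have "msq (\<lambda>x. cmod (F j x - P j x)) \<le> q\<^sup>2"
            using msq_le_kinc[of "diff3 F P" j] D D0(4) kinc_nonneg[of "diff3 G Q"] by (simp add: dist3_def diff3_def)
          then show "sqrt (msq (\<lambda>x. cmod (F j x - P j x))) \<le> q" using q by (intro real_le_lsqrt) auto
          show "sqrt (2 * msq (\<lambda>x. cmod (F j x)) + 2 * msq (\<lambda>x. cmod (P j x))) \<le> sqrt (4 * C)"
            using msq_le_kinc[of F j] msq_le_kinc[of P j] cF cP kinc_nonneg[of G] kinc_nonneg[of Q]
            by (intro real_sqrt_le_mono) linarith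
        qed (use q in \<open>auto simp: msq_nonneg\<close>)
        also have "\<dots> \<le> q * (sqrt (4 * C) + 1)" using q by (intro mult_left_mono) auto
        also have "\<dots> = \<delta>1" using sC unfolding q_def by (intro nonzero_eq_divide_eq[THEN iffD1]) auto
        finally show ?thesis using mP by simp
      qed
      ultimately show ?thesis by blast
    qed
    show "\<exists>\<delta>>0. \<forall>u\<^sub>0\<in>Y. dist_Y_set u\<^sub>0 (minimizers p a r s t) < ereal \<delta> \<longrightarrow>
        (\<forall>u. nls_solution p a u \<and> eq_Y (u 0) u\<^sub>0 \<longrightarrow>
          (SUP \<tau>. dist_Y_set (u \<tau>) (minimizers p a r s t)) < ereal \<epsilon>)"
    proof (intro exI[of _ "sqrt D0"] conjI ballI allI impI)
      show "0 < sqrt D0" using D0 by simp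
      fix u0 u assume u0: "u0 \<in> Y" and near: "dist_Y_set u0 (minimizers p a r s t) < ereal (sqrt D0)"
        and u: "nls_solution p a u \<and> eq_Y (u 0) u0"
      obtain F0 G0 where r0: "represents u0 F0 G0" using Y_represents[OF u0] by blast
      have F0: "ac3 F0 G0" using r0 by (simp add: represents_def)
      obtain \<Phi> where \<Phi>: "\<Phi> \<in> minimizers p a r s t" and "norm_Y (u0 - \<Phi>) < sqrt D0"
        using near unfolding dist_Y_set_def INF_less_iff by auto
      moreover obtain P Q where PQ: "represents \<Phi> P Q" "is_minimizer P Q" using minD[OF \<Phi>] by blast
      ultimately have "dist3 F0 G0 P Q \<le> D0" using norm_Y_diff[OF r0 PQ(1)] by simp
      then have cl: "\<And>j. \<bar>msq (\<lambda>x. cmod (F0 j x)) - m j\<bar> \<le> \<delta>1" "En F0 G0 \<le> L + \<delta>1"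
        using close[OF F0 PQ(2)] by blast+
      have "dist_Y_set (u \<tau>) (minimizers p a r s t) \<le> ereal (\<epsilon> / 2)" for \<tau>
      proof -
        obtain F G where r: "represents (u \<tau>) F G" and E: "En F G = En F0 G0"
          and M: "\<forall>j. msq (\<lambda>x. cmod (F j x)) = msq (\<lambda>x. cmod (F0 j x))"
          using well_posed_conserves[OF assms(8) _ _ r0 nls_coefficients_axioms] u by blast
        have "ac3 F G" using r by (simp add: represents_def)
        moreover have "\<forall>j. \<bar>msq (\<lambda>x. cmod (F j x)) - m j\<bar> \<le> \<delta>1" using cl(1) M by simp
        moreover have "En F G \<le> L + \<delta>1" using cl(2) E by simp
        ultimately obtain w g where w: "is_minimizer w g" "dist3 F G w g < (\<epsilon> / 2)\<^sup>2"
          using P1 by blast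
        have "represents w w g" using w(1) by (intro represents_self) (simp add: is_minimizer_def)
        then have "norm_Y (u \<tau> - w) = sqrt (dist3 F G w g)" using norm_Y_diff[OF r] by blast
        also have "\<dots> \<le> \<epsilon> / 2" using w(2) \<epsilon> by (intro real_le_lsqrt) auto
        finally have "ereal (norm_Y (u \<tau> - w)) \<le> ereal (\<epsilon> / 2)" by simp
        then show ?thesis unfolding dist_Y_set_def by (rule INF_lower2[OF minI[OF w(1)]])
      qed
      then have "(SUP \<tau>. dist_Y_set (u \<tau>) (minimizers p a r s t)) \<le> ereal (\<epsilon> / 2)" by (rule SUP_least)
      also have "\<dots> < ereal \<epsilon>" using \<epsilon> by simp
      finally show "(SUP \<tau>. dist_Y_set (u \<tau>) (minimizers p a r s t)) < ereal \<epsilon>" .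
    qed
  qed
qed

end
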